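(* Let $d\ge2$ and let $(\mathcal H,\mathsf S)$, $\mathsf S=(S_1,\dots,S_{d-1},P)$, be a contractive Hilbert module satisfying $Q=\operatorname{SOT-}\lim_{n\to\infty}P^{*n}P^n\ne0$. Then $(\mathcal H,\mathsf S)$ can be canonically embedded as a submodule of a unitary module $(\mathcal K,\mathsf R)$, $\mathsf R=(R_1,\dots,R_{d-1},U)$, by a canonical module map $\mathfrak J:\mathcal H\to\mathcal K$ such that (1) the map $\rho$ defined on the commutant algebra $\{R_1,\dots,R_{d-1},U\}'$ by $\rho(Y)=\mathfrak J^*Y\mathfrak J$ is a complete isometry onto $\mathcal T(\mathsf S)$; (2) there exists a surjective unital $*$-representation $$\pi:C^*(I_{\mathcal H},\mathcal T(\mathsf S))\to\{R_1,\dots,R_{d-1},U\}'$$ such that $\pi\circ\rho=I$, the identity map of $\{R_1,\dots,R_{d-1},U\}'$; (3) there exists a completely contractive, unital and multiplicative mapping $$\Theta:\{S_1,\dots,S_{d-1},P\}'\to\{R_1,\dots,R_{d-1},U\}'$$ defined by $\Theta(X)=\pi(\mathfrak J^*\mathfrak JX)$, which satisfies $\Theta(X)\mathfrak J=\mathfrak JX$ for all $X\in\{S_1,\dots,S_{d-1},P\}'$.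
   Context: Fix $d\ge2$. All Hilbert spaces are complex and all operators are bounded and linear. Let $e_k(z_1,\dots,z_d)=\sum_{1\le j_1<\cdots<j_k\le d}z_{j_1}\cdots z_{j_k}$. The closed symmetrized polydisc is $\Gamma_d=\{(e_1(\boldsymbol z),\dots,e_d(\boldsymbol z)):\boldsymbol z\in\overline{\mathbb D}^d\}\subset\mathbb C^d$, with points written $(s_1,\dots,s_{d-1},p)$; its distinguished boundary is $b\Gamma_d=\{(s_1,\dots,s_{d-1},p)\in\Gamma_d:|p|=1\}$. For a commuting $d$-tuple $\mathsf S=(S_1,\dots,S_{d-1},P)$ of bounded operators on $\mathcal H$, regard $\mathcal H$ as a module over $\mathcal A=\mathbb C[z_1,\dots,z_d]$ by $f\cdot h=f(S_1,\dots,S_{d-1},P)h$; denote it $(\mathcal H,\mathsf S)$. It is a contractive Hilbert module if $\|f(\mathsf S)h\|\le\big(\sup_{\Gamma_d}|f|\big)\|h\|$ for all $f\in\mathcal A$, $h\in\mathcal H$. A contractive Hilbert module $(\mathcal K,\mathsf R)$, $\mathsf R=(R_1,\dots,R_{d-1},U)$, is a unitary module if all entries of $\mathsf R$ are normal and the Taylor joint spectrum of $\mathsf R$ is contained in $b\Gamma_d$. A module map $\mathfrak J:(\mathcal H,\mathsf S)\to(\mathcal K,\mathsf R)$ is a bounded operator with $\mathfrak J(f\cdot h)=f\cdot\mathfrak Jh$ for all $f\in\mathcal A$, $h\in\mathcal H$. A contractive module map $\mathfrak J$ is canonical (and $(\mathcal H,\mathsf S)$ is then said to be canonically embedded as a submodule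 of $(\mathcal K,\mathsf R)$) if no proper closed subspace of $\mathcal K$ contains $\mathfrak J\mathcal H$ and reduces $\mathsf R$, and $\mathfrak J^*\mathfrak J=\operatorname{SOT-}\lim_n P^{*n}P^n$. A bounded operator $A$ on $\mathcal H$ is an $\mathsf S$-Toeplitz operator if $S_i^*AP=AS_{d-i}$ for each $1\le i\le d-1$ and $P^*AP=A$. The ($*$-closed, norm closed) vector space of all $\mathsf S$-Toeplitz operators is $\mathcal T(\mathsf S)$, and $C^*(I_{\mathcal H},\mathcal T(\mathsf S))$ is the $C^*$-algebra generated by $I_{\mathcal H}$ and $\mathcal T(\mathsf S)$. For a set $E$ of operators on a Hilbert space, $E'$ denotes its commutant, i.e. all bounded operators commuting with every element of $E$. *)

theory Defs
  imports
    "HOL-Analysis.Analysis"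
    "HOL-Library.Function_Algebras"
    "HOL-Library.Poly_Mapping"
begin

section \<open>Complex Hilbert spaces\<close>

text \<open>
  Hilbert spaces are carrier-based, because the theory has to quantify existentially over them:
  a space is a complex subspace \<open>vecs H\<close> of an ambient complex vector space, whose addition comes
  from the type and whose scalar multiplication is \<open>smul H\<close>. The inner product is linear in
  its first argument. Nothing is required of \<open>ip H\<close> outside \<open>vecs H\<close>.

  HOL cannot quantify existentially over types, so an extension space of a space over \<open>'a\<close> is sought
  over \<open>nat \<Rightarrow> 'a\<close>. This is no restriction for the extensions considered below: if \<open>J\<close> is a canonical
  map into a unitary module over \<open>K\<close> with last entry \<open>U\<close>, minimality makes \<open>k \<mapsto> (J\<^sup>*U\<^sup>nk)\<^sub>n\<close> injective on \<open>K\<close>.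
\<close>

record 'v hspace =
  vecs :: "'v set"
  smul :: "complex \<Rightarrow> 'v \<Rightarrow> 'v"
  ip :: "'v \<Rightarrow> 'v \<Rightarrow> complex"

definition hnorm :: "'v hspace \<Rightarrow> 'v \<Rightarrow> real" where
  "hnorm H x = sqrt (Re (ip H x x))"

text \<open>The guard makes this a total symmetric nonnegative function, as \<open>Metric_space\<close> demands.\<close>

definition hdist :: "'v::ab_group_add hspace \<Rightarrow> 'v \<Rightarrow> 'v \<Rightarrow> real" where
  "hdist H x y = (if x \<in> vecs H \<and> y \<in> vecs H then hnorm H (x - y) else 0)"

definition htopology :: "'v::ab_group_add hspace \<Rightarrow> 'v topology" where
  "htopology H = Metric_space.mtopology (vecs H) (hdist H)"

locale hilbert_space = vector_space "smul H" for H :: "'v::ab_group_add hspace" +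
  assumes vecs_subspace: "subspace (vecs H)"
    and ip_cnj: "\<lbrakk>x \<in> vecs H; y \<in> vecs H\<rbrakk> \<Longrightarrow> ip H y x = cnj (ip H x y)"
    and ip_add: "\<lbrakk>x \<in> vecs H; y \<in> vecs H; z \<in> vecs H\<rbrakk> \<Longrightarrow> ip H (x + y) z = ip H x z + ip H y z"
    and ip_smul: "\<lbrakk>x \<in> vecs H; y \<in> vecs H\<rbrakk> \<Longrightarrow> ip H (smul H c x) y = c * ip H x y"
    and ip_nonneg: "x \<in> vecs H \<Longrightarrow> 0 \<le> Re (ip H x x)"
    and ip_definite: "\<lbrakk>x \<in> vecs H; ip H x x = 0\<rbrakk> \<Longrightarrow> x = 0"
    and complete: "Metric_space.mcomplete (vecs H) (hdist H)"

definition closed_subspace :: "'v::ab_group_add hspace \<Rightarrow> 'v set \<Rightarrow> bool" where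
  "closed_subspace H M \<longleftrightarrow> module.subspace (smul H) M \<and> closedin (htopology H) M"

section \<open>Bounded operators\<close>

text \<open>
  An operator is a function on the ambient type that vanishes outside the domain space. Thus equality
  of operators is equality of functions, and sums and products of operators are the pointwise
  sums and compositions of functions. The identity operator, however, is \<open>idop H\<close> and not \<open>id\<close>.
\<close>

definition bounded_ops ::
    "'v::ab_group_add hspace \<Rightarrow> 'w::ab_group_add hspace \<Rightarrow> ('v \<Rightarrow> 'w) set" where
  "bounded_ops H K = {T.
     (\<forall>x\<in>vecs H. T x \<in> vecs K) \<and>
     (\<forall>x\<in>vecs H. \<forall>y\<in>vecs H. T (x + y) = T x + T y) \<and>
     (\<forall>c. \<forall>x\<in>vecs H. T (smul H c x) = smul K c (T x)) \<and>
     (\<exists>C. \<forall>x\<in>vecs H. hnorm K (T x) \<le> C * hnorm H x) \<and>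
     (\<forall>x. x \<notin> vecs H \<longrightarrow> T x = 0)}"

definition idop :: "'v::ab_group_add hspace \<Rightarrow> 'v \<Rightarrow> 'v" where
  "idop H = (\<lambda>x. if x \<in> vecs H then x else 0)"

definition opscale :: "'w hspace \<Rightarrow> complex \<Rightarrow> ('v \<Rightarrow> 'w) \<Rightarrow> 'v \<Rightarrow> 'w" where
  "opscale K c T = (\<lambda>x. smul K c (T x))"

definition opnorm :: "'v hspace \<Rightarrow> 'w hspace \<Rightarrow> ('v \<Rightarrow> 'w) \<Rightarrow> real" where
  "opnorm H K T = (SUP x\<in>{x \<in> vecs H. hnorm H x \<le> 1}. hnorm K (T x))"

definition adj ::
    "'v::ab_group_add hspace \<Rightarrow> 'w::ab_group_add hspace \<Rightarrow> ('v \<Rightarrow> 'w) \<Rightarrow> 'w \<Rightarrow> 'v" where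
  "adj H K T = (THE T'. T' \<in> bounded_ops K H \<and>
     (\<forall>x\<in>vecs H. \<forall>y\<in>vecs K. ip K (T x) y = ip H x (T' y)))"

definition sot_limit ::
    "'v::ab_group_add hspace \<Rightarrow> (nat \<Rightarrow> 'v \<Rightarrow> 'v) \<Rightarrow> ('v \<Rightarrow> 'v) \<Rightarrow> bool" where
  "sot_limit H T Q \<longleftrightarrow> Q \<in> bounded_ops H H \<and>
     (\<forall>x\<in>vecs H. limitin (htopology H) (\<lambda>n. T n x) (Q x) sequentially)"

definition commutant :: "'v::ab_group_add hspace \<Rightarrow> ('v \<Rightarrow> 'v) set \<Rightarrow> ('v \<Rightarrow> 'v) set" where
  "commutant H E = {X \<in> bounded_ops H H. \<forall>T\<in>E. X \<circ> T = T \<circ> X}"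

definition reduces :: "'v::ab_group_add hspace \<Rightarrow> 'v set \<Rightarrow> ('v \<Rightarrow> 'v) \<Rightarrow> bool" where
  "reduces H M T \<longleftrightarrow> T ` M \<subseteq> M \<and> adj H H T ` M \<subseteq> M"

section \<open>C*-algebras of operators and matrix norms\<close>

definition opdist :: "'v::ab_group_add hspace \<Rightarrow> ('v \<Rightarrow> 'v) \<Rightarrow> ('v \<Rightarrow> 'v) \<Rightarrow> real" where
  "opdist H S T =
     (if S \<in> bounded_ops H H \<and> T \<in> bounded_ops H H then opnorm H H (S - T) else 0)"

definition cstar_subalgebra :: "'v::ab_group_add hspace \<Rightarrow> ('v \<Rightarrow> 'v) set \<Rightarrow> bool" where
  "cstar_subalgebra H A \<longleftrightarrow>
     A \<subseteq> bounded_ops H H \<and> 0 \<in> A \<and>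
     (\<forall>S\<in>A. \<forall>T\<in>A. S + T \<in> A \<and> S \<circ> T \<in> A) \<and>
     (\<forall>T\<in>A. adj H H T \<in> A \<and> (\<forall>c. opscale H c T \<in> A)) \<and>
     closedin (Metric_space.mtopology (bounded_ops H H) (opdist H)) A"

definition cstar_generated :: "'v::ab_group_add hspace \<Rightarrow> ('v \<Rightarrow> 'v) set \<Rightarrow> ('v \<Rightarrow> 'v) set" where
  "cstar_generated H E = \<Inter>{A. cstar_subalgebra H A \<and> E \<subseteq> A}"

text \<open>The norm of the operator matrix \<open>T i j\<close>, \<open>i, j < n\<close>, acting on the \<open>n\<close>-fold direct sum of \<open>H\<close>.\<close>

definition matrix_opnorm ::
    "'v::ab_group_add hspace \<Rightarrow> nat \<Rightarrow> (nat \<Rightarrow> nat \<Rightarrow> 'v \<Rightarrow> 'v) \<Rightarrow> real" where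
  "matrix_opnorm H n T =
     (SUP x\<in>{x. (\<forall>j<n. x j \<in> vecs H) \<and> (\<Sum>j<n. (hnorm H (x j))\<^sup>2) \<le> 1}.
        sqrt (\<Sum>i<n. (hnorm H (\<Sum>j<n. T i j (x j)))\<^sup>2))"

definition linear_on_ops :: "'v::ab_group_add hspace \<Rightarrow> 'w::ab_group_add hspace \<Rightarrow>
    ('v \<Rightarrow> 'v) set \<Rightarrow> (('v \<Rightarrow> 'v) \<Rightarrow> ('w \<Rightarrow> 'w)) \<Rightarrow> bool" where
  "linear_on_ops H K A \<Phi> \<longleftrightarrow>
     (\<forall>S\<in>A. \<forall>T\<in>A. \<Phi> (S + T) = \<Phi> S + \<Phi> T) \<and>
     (\<forall>c. \<forall>T\<in>A. \<Phi> (opscale H c T) = opscale K c (\<Phi> T))"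

definition complete_isometry :: "'v::ab_group_add hspace \<Rightarrow> 'w::ab_group_add hspace \<Rightarrow>
    ('v \<Rightarrow> 'v) set \<Rightarrow> (('v \<Rightarrow> 'v) \<Rightarrow> ('w \<Rightarrow> 'w)) \<Rightarrow> bool" where
  "complete_isometry H K A \<Phi> \<longleftrightarrow>
     \<Phi> ` A \<subseteq> bounded_ops K K \<and> linear_on_ops H K A \<Phi> \<and>
     (\<forall>n T. (\<forall>i<n. \<forall>j<n. T i j \<in> A) \<longrightarrow>
        matrix_opnorm K n (\<lambda>i j. \<Phi> (T i j)) = matrix_opnorm H n T)"

definition complete_contraction :: "'v::ab_group_add hspace \<Rightarrow> 'w::ab_group_add hspace \<Rightarrow>
    ('v \<Rightarrow> 'v) set \<Rightarrow> (('v \<Rightarrow> 'v) \<Rightarrow> ('w \<Rightarrow> 'w)) \<Rightarrow> bool" where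
  "complete_contraction H K A \<Phi> \<longleftrightarrow>
     \<Phi> ` A \<subseteq> bounded_ops K K \<and> linear_on_ops H K A \<Phi> \<and>
     (\<forall>n T. (\<forall>i<n. \<forall>j<n. T i j \<in> A) \<longrightarrow>
        matrix_opnorm K n (\<lambda>i j. \<Phi> (T i j)) \<le> matrix_opnorm H n T)"

definition multiplicative_on ::
    "('v \<Rightarrow> 'v) set \<Rightarrow> (('v \<Rightarrow> 'v) \<Rightarrow> ('w \<Rightarrow> 'w)) \<Rightarrow> bool" where
  "multiplicative_on A \<Phi> \<longleftrightarrow> (\<forall>S\<in>A. \<forall>T\<in>A. \<Phi> (S \<circ> T) = \<Phi> S \<circ> \<Phi> T)"

definition unital_star_representation :: "'v::ab_group_add hspace \<Rightarrow> 'w::ab_group_add hspace \<Rightarrow>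
    ('v \<Rightarrow> 'v) set \<Rightarrow> (('v \<Rightarrow> 'v) \<Rightarrow> ('w \<Rightarrow> 'w)) \<Rightarrow> bool" where
  "unital_star_representation H K A \<phi> \<longleftrightarrow>
     \<phi> ` A \<subseteq> bounded_ops K K \<and> linear_on_ops H K A \<phi> \<and> multiplicative_on A \<phi> \<and>
     (\<forall>T\<in>A. \<phi> (adj H H T) = adj K K (\<phi> T)) \<and> \<phi> (idop H) = idop K"

section \<open>The symmetrized polydisc\<close>

text \<open>
  A \<open>d\<close>-tuple is a function on \<open>nat\<close> of which only the values at \<open>1, \<dots>, d\<close> matter; for points of
  complex \<open>d\<close>-space the remaining values are fixed to \<open>undefined\<close> by \<open>restrict\<close>. The last entry
  of a tuple, at \<open>d\<close>, is the one written \<open>p\<close>, \<open>P\<close> or \<open>U\<close> in the literature.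
\<close>

definition esym :: "nat \<Rightarrow> nat \<Rightarrow> (nat \<Rightarrow> complex) \<Rightarrow> complex" where
  "esym d k z = (\<Sum>X | X \<subseteq> {1..d} \<and> card X = k. \<Prod>j\<in>X. z j)"

definition Gamma :: "nat \<Rightarrow> (nat \<Rightarrow> complex) set" where
  "Gamma d = {restrict (\<lambda>k. esym d k z) {1..d} | z. \<forall>j\<in>{1..d}. cmod (z j) \<le> 1}"

definition bGamma :: "nat \<Rightarrow> (nat \<Rightarrow> complex) set" where
  "bGamma d = {w \<in> Gamma d. cmod (w d) = 1}"

text \<open>Polynomials in the variables \<open>1, \<dots>, d\<close>: a monomial is its finitely supported exponent vector.\<close>

type_synonym cpoly = "(nat \<Rightarrow>\<^sub>0 nat) \<Rightarrow>\<^sub>0 complex"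

definition polys :: "nat \<Rightarrow> cpoly set" where
  "polys d = {f. \<forall>m\<in>Poly_Mapping.keys f. Poly_Mapping.keys m \<subseteq> {1..d}}"

definition poly_eval :: "nat \<Rightarrow> cpoly \<Rightarrow> (nat \<Rightarrow> complex) \<Rightarrow> complex" where
  "poly_eval d f z =
     (\<Sum>m\<in>Poly_Mapping.keys f.
        Poly_Mapping.lookup f m * (\<Prod>i\<in>{1..d}. z i ^ Poly_Mapping.lookup m i))"

section \<open>Hilbert modules over the polynomial algebra\<close>

definition commuting_tuple ::
    "nat \<Rightarrow> 'v::ab_group_add hspace \<Rightarrow> (nat \<Rightarrow> 'v \<Rightarrow> 'v) \<Rightarrow> bool" where
  "commuting_tuple d H S \<longleftrightarrow>
     (\<forall>i\<in>{1..d}. S i \<in> bounded_ops H H) \<and> (\<forall>i\<in>{1..d}. \<forall>j\<in>{1..d}. S i \<circ> S j = S j \<circ> S i)"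

text \<open>\<open>monomial_act d S m h\<close> is \<open>S\<^sub>1\<close> to the power \<open>m\<^sub>1\<close>, \<dots>, \<open>S\<^sub>d\<close> to the power \<open>m\<^sub>d\<close>, applied to \<open>h\<close>.\<close>

definition monomial_act :: "nat \<Rightarrow> (nat \<Rightarrow> 'v \<Rightarrow> 'v) \<Rightarrow> (nat \<Rightarrow>\<^sub>0 nat) \<Rightarrow> 'v \<Rightarrow> 'v" where
  "monomial_act d S m h = foldr (\<lambda>i x. (S i ^^ Poly_Mapping.lookup m i) x) [1..<Suc d] h"

definition poly_act ::
    "nat \<Rightarrow> 'v::ab_group_add hspace \<Rightarrow> (nat \<Rightarrow> 'v \<Rightarrow> 'v) \<Rightarrow> cpoly \<Rightarrow> 'v \<Rightarrow> 'v" where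
  "poly_act d H S f h =
     (\<Sum>m\<in>Poly_Mapping.keys f. smul H (Poly_Mapping.lookup f m) (monomial_act d S m h))"

definition contractive_hilbert_module ::
    "nat \<Rightarrow> 'v::ab_group_add hspace \<Rightarrow> (nat \<Rightarrow> 'v \<Rightarrow> 'v) \<Rightarrow> bool" where
  "contractive_hilbert_module d H S \<longleftrightarrow>
     hilbert_space H \<and> commuting_tuple d H S \<and>
     (\<forall>f\<in>polys d. \<forall>h\<in>vecs H.
        hnorm H (poly_act d H S f h) \<le> (SUP z\<in>Gamma d. cmod (poly_eval d f z)) * hnorm H h)"

text \<open>
  The Taylor spectrum is defined by the cochain form of the Koszul complex: the \<open>p\<close>-cochains are families of
  vectors indexed by the \<open>p\<close>-element subsets of \<open>{1..d}\<close>, that is, elements of the tensor product of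
  the space with the \<open>p\<close>-th exterior power of complex \<open>d\<close>-space.
\<close>

definition koszul_cochains :: "nat \<Rightarrow> 'v::ab_group_add hspace \<Rightarrow> nat \<Rightarrow> (nat set \<Rightarrow> 'v) set" where
  "koszul_cochains d H p = {x. \<forall>I.
     (if I \<subseteq> {1..d} \<and> card I = p then x I \<in> vecs H else x I = 0)}"

definition koszul_diff :: "nat \<Rightarrow> 'v::ab_group_add hspace \<Rightarrow> (nat \<Rightarrow> 'v \<Rightarrow> 'v) \<Rightarrow>
    (nat set \<Rightarrow> 'v) \<Rightarrow> nat set \<Rightarrow> 'v" where
  "koszul_diff d H T x = (\<lambda>I. if I \<subseteq> {1..d}
     then \<Sum>j\<in>I. smul H ((- 1) ^ card {i \<in> I. i < j}) (T j (x (I - {j}))) else 0)"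

definition koszul_exact :: "nat \<Rightarrow> 'v::ab_group_add hspace \<Rightarrow> (nat \<Rightarrow> 'v \<Rightarrow> 'v) \<Rightarrow> bool" where
  "koszul_exact d H T \<longleftrightarrow>
     (\<forall>p\<le>d. {x \<in> koszul_cochains d H p. koszul_diff d H T x = 0} =
        (if p = 0 then {0} else koszul_diff d H T ` koszul_cochains d H (p - 1)))"

definition taylor_spectrum ::
    "nat \<Rightarrow> 'v::ab_group_add hspace \<Rightarrow> (nat \<Rightarrow> 'v \<Rightarrow> 'v) \<Rightarrow> (nat \<Rightarrow> complex) set" where
  "taylor_spectrum d H T = {w \<in> extensional {1..d}.
     \<not> koszul_exact d H (\<lambda>i. T i - opscale H (w i) (idop H))}"

definition unitary_module ::
    "nat \<Rightarrow> 'v::ab_group_add hspace \<Rightarrow> (nat \<Rightarrow> 'v \<Rightarrow> 'v) \<Rightarrow> bool" where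
  "unitary_module d K R \<longleftrightarrow>
     contractive_hilbert_module d K R \<and>
     (\<forall>i\<in>{1..d}. adj K K (R i) \<circ> R i = R i \<circ> adj K K (R i)) \<and>
     taylor_spectrum d K R \<subseteq> bGamma d"

definition module_map :: "nat \<Rightarrow> 'v::ab_group_add hspace \<Rightarrow> (nat \<Rightarrow> 'v \<Rightarrow> 'v) \<Rightarrow>
    'w::ab_group_add hspace \<Rightarrow> (nat \<Rightarrow> 'w \<Rightarrow> 'w) \<Rightarrow> ('v \<Rightarrow> 'w) \<Rightarrow> bool" where
  "module_map d H S K R J \<longleftrightarrow>
     J \<in> bounded_ops H K \<and>
     (\<forall>f\<in>polys d. \<forall>h\<in>vecs H. J (poly_act d H S f h) = poly_act d K R f (J h))"

definition adj_powers :: "'v::ab_group_add hspace \<Rightarrow> ('v \<Rightarrow> 'v) \<Rightarrow> nat \<Rightarrow> 'v \<Rightarrow> 'v" where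
  "adj_powers H P n = (adj H H P ^^ n) \<circ> (P ^^ n)"

definition canonical_module_map :: "nat \<Rightarrow> 'v::ab_group_add hspace \<Rightarrow> (nat \<Rightarrow> 'v \<Rightarrow> 'v) \<Rightarrow>
    'w::ab_group_add hspace \<Rightarrow> (nat \<Rightarrow> 'w \<Rightarrow> 'w) \<Rightarrow> ('v \<Rightarrow> 'w) \<Rightarrow> bool" where
  "canonical_module_map d H S K R J \<longleftrightarrow>
     module_map d H S K R J \<and>
     (\<forall>h\<in>vecs H. hnorm K (J h) \<le> hnorm H h) \<and>
     (\<forall>M. closed_subspace K M \<and> J ` vecs H \<subseteq> M \<and> (\<forall>i\<in>{1..d}. reduces K M (R i))
        \<longrightarrow> M = vecs K) \<and>
     sot_limit H (adj_powers H (S d)) (adj H K J \<circ> J)"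

definition toeplitz_ops ::
    "nat \<Rightarrow> 'v::ab_group_add hspace \<Rightarrow> (nat \<Rightarrow> 'v \<Rightarrow> 'v) \<Rightarrow> ('v \<Rightarrow> 'v) set" where
  "toeplitz_ops d H S = {A \<in> bounded_ops H H.
     (\<forall>i\<in>{1..d - 1}. adj H H (S i) \<circ> A \<circ> S d = A \<circ> S (d - i)) \<and>
     adj H H (S d) \<circ> A \<circ> S d = A}"

end

theory Submission
  imports Defs "HOL-Complex_Analysis.Conformal_Mappings" "HOL-Computational_Algebra.Fundamental_Theorem_Algebra"
begin

text \<open>
  With \<open>P\<close> the last entry of the tuple, the extension space \<open>K\<close> is realised concretely as the space of
  bounded backward orbits \<open>(k\<^sub>n)\<close> of \<open>P\<^sup>*\<close>, with \<open>\<langle>k, l\<rangle> = lim \<langle>k\<^sub>n, l\<^sub>n\<rangle>\<close>; the unitary \<open>U\<close> is the shift and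
  \<open>J h = (Q P\<^sup>n h)\<^sub>n\<close>, so that \<open>J\<^sup>*\<close> is evaluation at \<open>0\<close>. Write \<open>T \<sim> Y\<close> if \<open>T k\<^sub>m - (Y k)\<^sub>m\<close> tends to \<open>0\<close> for every
  \<open>k\<close> in \<open>K\<close>. This relation respects sums, products and matrix norms, and \<open>T\<close> determines \<open>Y\<close>. Every \<open>X\<close> commuting
  with \<open>P\<close> and every \<open>A\<close> with \<open>P\<^sup>* A P = A\<close> has a partner: the partners of the \<open>S\<^sub>i\<close> form the tuple \<open>R\<close>, the
  partner of a Toeplitz operator \<open>A\<close> is the unique \<open>Y\<close> in the commutant of \<open>R\<close> with \<open>J\<^sup>* Y J = A\<close>, and
  \<open>\<pi>\<close> and \<open>\<Theta>\<close> both send an operator to its partner.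

  Applying contractivity to \<open>p + l s\<^bsub>d-i\<^esub> - cnj l p s\<^sub>i\<close> for small \<open>l\<close> gives \<open>R\<^sub>i\<^sup>* = U\<^sup>* R\<^bsub>d-i\<^esub>\<close>, hence normality.
  A point of the Taylor spectrum is then a joint approximate eigenvalue, so it lies in the polynomial
  hull of the symmetrized polydisc, which is polynomially convex: the complete homogeneous symmetric polynomials, which are
  the coefficients of \<open>1 / (1 - s\<^sub>1 t + s\<^sub>2 t\<^sup>2 - \<dots>)\<close>, separate it from its complement.
\<close>

section \<open>Geometry of carrier-based Hilbert spaces\<close>

text \<open>The abstract extension completes \<open>H\<close> in the seminorm of \<open>Q\<close>
  and adjoins inverses of \<open>P\<close>; such a quotient would live over another type, while
  backward orbits name its vectors uniquely over \<open>nat => 'a\<close>. The limits rest on one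
  estimate: \<open>P^l k_m\<close> differs from \<open>k_(m+l)\<close> by at most
  \<open>sqrt (|k|^2 - |k_m|^2)\<close>, uniformly in \<open>l\<close>. Late members of a backward
  orbit thus move almost like an orbit of \<open>P\<close>, which makes operators on
  \<open>H\<close> converge along orbits.

  The obstacle is that the compression \<open>J* Y J\<close> is not multiplicative, so
  \<open>pi\<close> cannot be read off products of Toeplitz operators by inverting
  \<open>rho\<close>. The asymptotic relation is multiplicative, but as a strong limit it does not
  pass to adjoints; the algebra on which \<open>pi\<close> is studied therefore demands a partner of
  the adjoint too. \<open>X\<close> and \<open>Q X\<close> share their partner, which is why
  \<open>X |-> pi (J* J X)\<close> is multiplicative.

  For the spectrum, \<open>R_i* = U* R_(d-i)\<close> yields more than normality: every
  \<open>R_i*\<close> commutes with every \<open>R_j\<close>. Hence the operators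
  \<open>(sum T_i* T_i)^(-1) T_i*\<close> commute with all \<open>T_j\<close>, as the homotopy
  requires.\<close>

locale pre_hilbert = vector_space "smul H" for H :: "'v::ab_group_add hspace" +
  assumes vecs_subspace: "subspace (vecs H)"
    and ip_cnj: "\<lbrakk>x \<in> vecs H; y \<in> vecs H\<rbrakk> \<Longrightarrow> ip H y x = cnj (ip H x y)"
    and ip_add: "\<lbrakk>x \<in> vecs H; y \<in> vecs H; z \<in> vecs H\<rbrakk> \<Longrightarrow> ip H (x + y) z = ip H x z + ip H y z"
    and ip_smul: "\<lbrakk>x \<in> vecs H; y \<in> vecs H\<rbrakk> \<Longrightarrow> ip H (smul H c x) y = c * ip H x y"
    and ip_nonneg: "x \<in> vecs H \<Longrightarrow> 0 \<le> Re (ip H x x)"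
    and ip_definite: "\<lbrakk>x \<in> vecs H; ip H x x = 0\<rbrakk> \<Longrightarrow> x = 0"

text \<open>The inner product calculus is developed without completeness, so that it is already
  available for a space whose completeness is still being proved.\<close>

sublocale hilbert_space \<subseteq> pre_hilbert
  by unfold_locales (fact vecs_subspace ip_cnj ip_add ip_smul ip_nonneg ip_definite)+

context pre_hilbert
begin

lemma vecs_0 [simp, intro]: "0 \<in> vecs H"
  using vecs_subspace by (rule subspace_0)

lemma vecs_add [simp, intro]: "\<lbrakk>x \<in> vecs H; y \<in> vecs H\<rbrakk> \<Longrightarrow> x + y \<in> vecs H"
  using vecs_subspace by (rule subspace_add)

lemma vecs_diff [simp, intro]: "\<lbrakk>x \<in> vecs H; y \<in> vecs H\<rbrakk> \<Longrightarrow> x - y \<in> vecs H"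
  using vecs_subspace by (rule subspace_diff)

lemma vecs_scale [simp, intro]: "x \<in> vecs H \<Longrightarrow> smul H c x \<in> vecs H"
  using vecs_subspace by (rule subspace_scale)

lemma vecs_neg [simp, intro]: "x \<in> vecs H \<Longrightarrow> - x \<in> vecs H"
  using vecs_subspace by (rule subspace_neg)

lemma vecs_sum [intro]: "(\<And>i. i \<in> I \<Longrightarrow> f i \<in> vecs H) \<Longrightarrow> sum f I \<in> vecs H"
  using vecs_subspace by (rule subspace_sum)

lemma ip_add_right:
  assumes "x \<in> vecs H" "y \<in> vecs H" "z \<in> vecs H"
  shows "ip H x (y + z) = ip H x y + ip H x z"
  using assms ip_cnj[of "y + z" x] ip_cnj[of y x] ip_cnj[of z x] ip_add[of y z x] by simp

lemma ip_smul_right: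
  assumes "x \<in> vecs H" "y \<in> vecs H"
  shows "ip H x (smul H c y) = cnj c * ip H x y"
  using assms ip_cnj[of "smul H c y" x] ip_cnj[of y x] ip_smul[of y x c] by simp

lemma ip_neg: "\<lbrakk>x \<in> vecs H; y \<in> vecs H\<rbrakk> \<Longrightarrow> ip H (- x) y = - ip H x y"
  using ip_smul[of x y "-1"] by simp

lemma ip_neg_right: "\<lbrakk>x \<in> vecs H; y \<in> vecs H\<rbrakk> \<Longrightarrow> ip H x (- y) = - ip H x y"
  using ip_smul_right[of x y "-1"] by simp

lemma ip_diff:
  "\<lbrakk>x \<in> vecs H; y \<in> vecs H; z \<in> vecs H\<rbrakk> \<Longrightarrow> ip H (x - y) z = ip H x z - ip H y z"
  using ip_add[of x "- y" z] ip_neg[of y z] by simp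

lemma ip_diff_right:
  "\<lbrakk>x \<in> vecs H; y \<in> vecs H; z \<in> vecs H\<rbrakk> \<Longrightarrow> ip H x (y - z) = ip H x y - ip H x z"
  using ip_add_right[of x y "- z"] ip_neg_right[of x z] by simp

lemma ip_zero [simp]: "x \<in> vecs H \<Longrightarrow> ip H 0 x = 0"
  using ip_smul[of x x 0] by simp

lemma ip_zero_right [simp]: "x \<in> vecs H \<Longrightarrow> ip H x 0 = 0"
  using ip_smul_right[of x x 0] by simp

lemmas ip_simps = ip_add ip_add_right ip_smul ip_smul_right ip_diff ip_diff_right ip_neg ip_neg_right

lemma ip_sum:
  "\<lbrakk>\<And>i. i \<in> I \<Longrightarrow> f i \<in> vecs H; y \<in> vecs H\<rbrakk> \<Longrightarrow> ip H (sum f I) y = (\<Sum>i\<in>I. ip H (f i) y)"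
  by (induction I rule: infinite_finite_induct) (auto simp: ip_add vecs_sum)

lemma hnorm_nonneg [simp]: "x \<in> vecs H \<Longrightarrow> 0 \<le> hnorm H x"
  by (simp add: hnorm_def ip_nonneg)

lemma hnorm_sq: "x \<in> vecs H \<Longrightarrow> (hnorm H x)\<^sup>2 = Re (ip H x x)"
  by (simp add: hnorm_def ip_nonneg)

lemma ip_self: "x \<in> vecs H \<Longrightarrow> ip H x x = complex_of_real ((hnorm H x)\<^sup>2)"
  using ip_cnj[of x x] by (simp add: hnorm_sq complex_eq_iff)

lemma hnorm_0 [simp]: "hnorm H 0 = 0"
  by (simp add: hnorm_def)

lemma hnorm_eq_0 [simp]: "x \<in> vecs H \<Longrightarrow> hnorm H x = 0 \<longleftrightarrow> x = 0"
  using ip_self[of x] ip_definite[of x] by auto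

lemma hnorm_smul: "x \<in> vecs H \<Longrightarrow> hnorm H (smul H c x) = cmod c * hnorm H x"
proof -
  assume x: "x \<in> vecs H"
  have "ip H (smul H c x) (smul H c x) = (c * cnj c) * ip H x x"
    using x by (simp add: ip_smul ip_smul_right)
  also have "\<dots> = complex_of_real ((cmod c * hnorm H x)\<^sup>2)"
    unfolding complex_norm_square[symmetric] ip_self[OF x] by (simp add: power_mult_distrib)
  finally have "(hnorm H (smul H c x))\<^sup>2 = (cmod c * hnorm H x)\<^sup>2"
    using x ip_self[of "smul H c x"] by (simp only: of_real_eq_iff vecs_scale)
  then show ?thesis using x by (simp add: power2_eq_iff_nonneg)
qed

lemma hnorm_neg [simp]: "x \<in> vecs H \<Longrightarrow> hnorm H (- x) = hnorm H x"
  using hnorm_smul[of x "-1"] by simp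

lemma hnorm_minus_commute: "\<lbrakk>x \<in> vecs H; y \<in> vecs H\<rbrakk> \<Longrightarrow> hnorm H (x - y) = hnorm H (y - x)"
  using hnorm_neg[of "y - x"] by simp

lemma hnorm_add_sq:
  assumes "x \<in> vecs H" "y \<in> vecs H"
  shows "(hnorm H (x + y))\<^sup>2 = (hnorm H x)\<^sup>2 + (hnorm H y)\<^sup>2 + 2 * Re (ip H x y)"
  using assms ip_cnj[of x y] by (simp add: hnorm_sq ip_add ip_add_right)

lemma hnorm_diff_sq:
  assumes "x \<in> vecs H" "y \<in> vecs H"
  shows "(hnorm H (x - y))\<^sup>2 = (hnorm H x)\<^sup>2 + (hnorm H y)\<^sup>2 - 2 * Re (ip H x y)"
  using hnorm_add_sq[of x "- y"] assms by (simp add: ip_neg_right)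

lemma parallelogram:
  assumes "x \<in> vecs H" "y \<in> vecs H"
  shows "(hnorm H (x + y))\<^sup>2 + (hnorm H (x - y))\<^sup>2 = 2 * (hnorm H x)\<^sup>2 + 2 * (hnorm H y)\<^sup>2"
  using hnorm_add_sq[OF assms] hnorm_diff_sq[OF assms] by simp

lemma Re_ip_le:
  assumes "x \<in> vecs H" "y \<in> vecs H"
  shows "Re (ip H x y) \<le> hnorm H x * hnorm H y"
proof (cases "hnorm H x = 0 \<or> hnorm H y = 0")
  case True
  then show ?thesis using assms by auto
next
  case False
  define a b where "a = hnorm H x" and "b = hnorm H y"
  have ab: "a > 0" "b > 0"
    using False assms hnorm_nonneg[of x] hnorm_nonneg[of y] unfolding a_def b_def by linarith+
  have "0 \<le> (hnorm H (smul H (of_real b) x - smul H (of_real a) y))\<^sup>2" by simp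
  also have "\<dots> = (b * a)\<^sup>2 + (a * b)\<^sup>2 - 2 * (a * b) * Re (ip H x y)"
    using assms ab by (simp add: hnorm_diff_sq hnorm_smul ip_smul ip_smul_right a_def[symmetric] b_def[symmetric])
  finally have "(a * b) * Re (ip H x y) \<le> (a * b) * (a * b)"
    by (simp add: power2_eq_square algebra_simps)
  then have "Re (ip H x y) \<le> a * b" using ab
    by (metis mult_le_cancel_left_pos mult_pos_pos)
  then show ?thesis by (simp add: a_def b_def)
qed

lemma Cauchy_Schwarz:
  assumes "x \<in> vecs H" "y \<in> vecs H"
  shows "cmod (ip H x y) \<le> hnorm H x * hnorm H y"
proof (cases "ip H x y = 0")
  case False
  define c where "c = cnj (ip H x y) / cmod (ip H x y)"
  have c1: "cmod c = 1" using False by (simp add: c_def norm_divide)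
  have "c * ip H x y = cmod (ip H x y)"
    using False by (simp add: c_def field_simps flip: complex_norm_square power2_eq_square)
  then have "cmod (ip H x y) = Re (ip H (smul H c x) y)"
    using assms by (simp add: ip_smul)
  also have "\<dots> \<le> hnorm H x * hnorm H y"
    using Re_ip_le[of "smul H c x" y] assms c1 by (simp add: hnorm_smul)
  finally show ?thesis .
qed (use assms in simp)

lemma hnorm_triangle:
  assumes "x \<in> vecs H" "y \<in> vecs H"
  shows "hnorm H (x + y) \<le> hnorm H x + hnorm H y"
proof (rule power2_le_imp_le)
  show "(hnorm H (x + y))\<^sup>2 \<le> (hnorm H x + hnorm H y)\<^sup>2"
    using Re_ip_le[OF assms] hnorm_add_sq[OF assms] by (simp add: power2_sum)
qed (use assms in simp)

lemma hnorm_triangle_diff: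
  "\<lbrakk>x \<in> vecs H; y \<in> vecs H\<rbrakk> \<Longrightarrow> hnorm H (x - y) \<le> hnorm H x + hnorm H y"
  using hnorm_triangle[of x "- y"] by simp

lemma hnorm_diff_triangle:
  "\<lbrakk>x \<in> vecs H; y \<in> vecs H; z \<in> vecs H\<rbrakk> \<Longrightarrow> hnorm H (x - z) \<le> hnorm H (x - y) + hnorm H (y - z)"
  using hnorm_triangle[of "x - y" "y - z"] by simp

lemma hnorm_reverse_triangle:
  assumes "x \<in> vecs H" "y \<in> vecs H"
  shows "\<bar>hnorm H x - hnorm H y\<bar> \<le> hnorm H (x - y)"
  using hnorm_triangle[of "x - y" y] hnorm_triangle[of "y - x" x] hnorm_minus_commute[of x y] assms
  by simp

lemma hnorm_sum_le:
  "(\<And>i. i \<in> I \<Longrightarrow> f i \<in> vecs H) \<Longrightarrow> hnorm H (sum f I) \<le> (\<Sum>i\<in>I. hnorm H (f i))"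
proof (induction I rule: infinite_finite_induct)
  case (insert i I)
  then show ?case
    using hnorm_triangle[of "f i" "sum f I"] by (fastforce intro: vecs_sum)
qed auto

sublocale metric: Metric_space "vecs H" "hdist H"
proof
  show "0 \<le> hdist H x y" for x y by (simp add: hdist_def)
  show "hdist H x y = hdist H y x" for x y by (simp add: hdist_def hnorm_minus_commute)
  show "hdist H x y = 0 \<longleftrightarrow> x = y" if "x \<in> vecs H" "y \<in> vecs H" for x y
    using that by (simp add: hdist_def)
  show "hdist H x z \<le> hdist H x y + hdist H y z"
    if "x \<in> vecs H" "y \<in> vecs H" "z \<in> vecs H" for x y z
    using that by (simp add: hdist_def hnorm_diff_triangle)
qed

lemma limitin_iff:
  assumes "\<And>n. X n \<in> vecs H"
  shows "limitin (htopology H) X l sequentially \<longleftrightarrow>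
    l \<in> vecs H \<and> (\<lambda>n. hnorm H (X n - l)) \<longlonglongrightarrow> 0"
  unfolding htopology_def metric.limitin_metric_dist_null
  using assms by (auto simp: hdist_def)

lemma closedin_iff:
  "closedin (htopology H) M \<longleftrightarrow> M \<subseteq> vecs H \<and>
    (\<forall>X l. (\<forall>n. X n \<in> M) \<and> l \<in> vecs H \<and> (\<lambda>n. hnorm H (X n - l)) \<longlonglongrightarrow> 0 \<longrightarrow> l \<in> M)"
  (is "?L \<longleftrightarrow> ?R")
proof -
  have "?L \<longleftrightarrow> M \<subseteq> vecs H \<and>
     (\<forall>\<sigma> l. range \<sigma> \<subseteq> M \<and> limitin (htopology H) \<sigma> l sequentially \<longrightarrow> l \<in> M)"
    unfolding htopology_def by (rule metric.metric_closedin_iff_sequentially_closed)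
  also have "\<dots> \<longleftrightarrow> ?R"
  proof (intro conj_cong refl all_cong1)
    fix X l assume "M \<subseteq> vecs H"
    then show "(range X \<subseteq> M \<and> limitin (htopology H) X l sequentially \<longrightarrow> l \<in> M) \<longleftrightarrow>
      ((\<forall>n. X n \<in> M) \<and> l \<in> vecs H \<and> (\<lambda>n. hnorm H (X n - l)) \<longlonglongrightarrow> 0 \<longrightarrow> l \<in> M)"
      using limitin_iff[of X l] by blast
  qed
  finally show ?thesis .
qed

lemma MCauchy_iff:
  "metric.MCauchy X \<longleftrightarrow> (\<forall>n. X n \<in> vecs H) \<and>
     (\<forall>e>0. \<exists>N. \<forall>m\<ge>N. \<forall>n\<ge>N. hnorm H (X m - X n) < e)"
  unfolding metric.MCauchy_def by (auto simp: hdist_def image_subset_iff)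

lemma tendsto_norm:
  assumes "\<And>n. X n \<in> vecs H" "l \<in> vecs H" "(\<lambda>n. hnorm H (X n - l)) \<longlonglongrightarrow> 0"
  shows "(\<lambda>n. hnorm H (X n)) \<longlonglongrightarrow> hnorm H l"
proof (rule LIM_zero_cancel, rule Lim_null_comparison[OF _ assms(3)])
  show "\<forall>\<^sub>F n in sequentially. norm (hnorm H (X n) - hnorm H l) \<le> hnorm H (X n - l)"
    using assms hnorm_reverse_triangle by simp
qed

lemma tendsto_ip:
  assumes X: "\<And>n. X n \<in> vecs H" "l \<in> vecs H" "(\<lambda>n. hnorm H (X n - l)) \<longlonglongrightarrow> 0" and y: "y \<in> vecs H"
  shows "(\<lambda>n. ip H (X n) y) \<longlonglongrightarrow> ip H l y"
proof (rule LIM_zero_cancel, rule Lim_null_comparison)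
  show "\<forall>\<^sub>F n in sequentially. norm (ip H (X n) y - ip H l y) \<le> hnorm H (X n - l) * hnorm H y"
    using Cauchy_Schwarz[of "X _ - l" y] assms by (simp add: ip_diff)
  show "(\<lambda>n. hnorm H (X n - l) * hnorm H y) \<longlonglongrightarrow> 0"
    using tendsto_mult_right[OF X(3)] by simp
qed

lemma tendsto_add_vecs:
  assumes "\<And>n. X n \<in> vecs H" "\<And>n. Y n \<in> vecs H" "l \<in> vecs H" "m \<in> vecs H"
    and "(\<lambda>n. hnorm H (X n - l)) \<longlonglongrightarrow> 0" "(\<lambda>n. hnorm H (Y n - m)) \<longlonglongrightarrow> 0"
  shows "(\<lambda>n. hnorm H (X n + Y n - (l + m))) \<longlonglongrightarrow> 0"
proof (rule Lim_null_comparison)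
  show "\<forall>\<^sub>F n in sequentially. norm (hnorm H (X n + Y n - (l + m))) \<le> hnorm H (X n - l) + hnorm H (Y n - m)"
    using hnorm_triangle[of "X _ - l" "Y _ - m"] assms(1-4) by (simp add: algebra_simps)
  show "(\<lambda>n. hnorm H (X n - l) + hnorm H (Y n - m)) \<longlonglongrightarrow> 0"
    using tendsto_add[OF assms(5,6)] by simp
qed

lemma tendsto_diff_vecs:
  assumes "\<And>n. X n \<in> vecs H" "\<And>n. Y n \<in> vecs H" "l \<in> vecs H" "m \<in> vecs H"
    and "(\<lambda>n. hnorm H (X n - l)) \<longlonglongrightarrow> 0" "(\<lambda>n. hnorm H (Y n - m)) \<longlonglongrightarrow> 0"
  shows "(\<lambda>n. hnorm H (X n - Y n - (l - m))) \<longlonglongrightarrow> 0"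
proof -
  have "(\<lambda>n. hnorm H (- Y n - (- m))) \<longlonglongrightarrow> 0"
    using assms hnorm_minus_commute by simp
  then show ?thesis using tendsto_add_vecs[of X "\<lambda>n. - Y n" l "- m"] assms by simp
qed

lemma limit_unique:
  assumes "\<And>n. X n \<in> vecs H" "l \<in> vecs H" "l' \<in> vecs H"
    and "(\<lambda>n. hnorm H (X n - l)) \<longlonglongrightarrow> 0" "(\<lambda>n. hnorm H (X n - l')) \<longlonglongrightarrow> 0"
  shows "l = l'"
  using metric.limitin_metric_unique[of X l sequentially l'] assms limitin_iff[of X]
  by (simp add: htopology_def)

text \<open>A complex sesquilinear form is determined by its diagonal: the values at
  \<open>x + y\<close> and \<open>x + i y\<close> isolate the sum and the difference of the two
  mixed terms. It serves to obtain adjoints from quadratic forms.\<close>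

lemma polarization:
  assumes T: "\<And>x. x \<in> vecs H \<Longrightarrow> T x \<in> vecs H" "\<And>x. x \<in> vecs H \<Longrightarrow> V x \<in> vecs H"
    and add: "\<And>x y. \<lbrakk>x \<in> vecs H; y \<in> vecs H\<rbrakk> \<Longrightarrow> T (x + y) = T x + T y"
      "\<And>x y. \<lbrakk>x \<in> vecs H; y \<in> vecs H\<rbrakk> \<Longrightarrow> V (x + y) = V x + V y"
    and sc: "\<And>x c. x \<in> vecs H \<Longrightarrow> T (smul H c x) = smul H c (T x)"
      "\<And>x c. x \<in> vecs H \<Longrightarrow> V (smul H c x) = smul H c (V x)"
    and eq: "\<And>x. x \<in> vecs H \<Longrightarrow> ip H (T x) x = ip H x (V x)"
    and x: "x \<in> vecs H" and y: "y \<in> vecs H"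
  shows "ip H (T x) y = ip H x (V y)"
proof -
  define D where "D u v = ip H (T u) v - ip H u (V v)" for u v
  have D0: "D u u = 0" if "u \<in> vecs H" for u using eq that by (simp add: D_def)
  have "D (x + y) (x + y) = D x x + D y y + (D x y + D y x)"
    using x y T by (simp add: D_def ip_simps add)
  then have 1: "D x y + D y x = 0" using D0 x y by simp
  have "D (x + smul H \<i> y) (x + smul H \<i> y) = D x x + D y y + \<i> * (D y x - D x y)"
    using x y T by (simp add: D_def ip_simps add sc algebra_simps)
  then have "D y x - D x y = 0" using D0 x y by simp
  with 1 have "D x y = 0" by (simp add: complex_eq_iff)
  then show ?thesis by (simp add: D_def)
qed

end

section \<open>Completeness and the Riesz representation\<close>

context hilbert_space
begin

lemma Cauchy_converges:
  assumes "\<And>n. X n \<in> vecs H" "\<And>e. 0 < e \<Longrightarrow> \<exists>N. \<forall>m\<ge>N. \<forall>n\<ge>N. hnorm H (X m - X n) < e"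
  obtains l where "l \<in> vecs H" "(\<lambda>n. hnorm H (X n - l)) \<longlonglongrightarrow> 0"
proof -
  have "metric.MCauchy X" using assms MCauchy_iff by blast
  then obtain l where "limitin (htopology H) X l sequentially"
    using complete unfolding metric.mcomplete_def htopology_def by blast
  then show thesis using that limitin_iff assms(1) by blast
qed

text \<open>The representing vector \<open>z\<close> minimises \<open>|x|^2 - 2 Re (f x)\<close>,
  which is \<open>|x - z|^2 - |z|^2\<close> after completing the square. This variational argument
  rests on the parallelogram law and completeness alone.\<close>

lemma riesz:
  assumes f: "\<And>x. x \<in> vecs H \<Longrightarrow> cmod (f x) \<le> C * hnorm H x"
    "\<And>x y. \<lbrakk>x \<in> vecs H; y \<in> vecs H\<rbrakk> \<Longrightarrow> f (x + y) = f x + f y"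
    "\<And>x c. x \<in> vecs H \<Longrightarrow> f (smul H c x) = c * f x"
  obtains z where "z \<in> vecs H" "\<And>x. x \<in> vecs H \<Longrightarrow> f x = ip H x z"
proof -
  define g where "g x = (hnorm H x)\<^sup>2 - 2 * Re (f x)" for x
  define I where "I = Inf (g ` vecs H)"
  have lb: "- C\<^sup>2 \<le> g x" if "x \<in> vecs H" for x
  proof -
    have "Re (f x) \<le> C * hnorm H x"
      using f(1)[OF that] complex_Re_le_cmod[of "f x"] by linarith
    moreover have "0 \<le> (hnorm H x - C)\<^sup>2" by simp
    ultimately show ?thesis unfolding g_def power2_diff
      by (simp add: algebra_simps)
  qed
  have bdd: "bdd_below (g ` vecs H)" using lb by (intro bdd_belowI[of _ "- C\<^sup>2"]) auto
  have Ile: "I \<le> g x" if "x \<in> vecs H" for x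
    unfolding I_def using bdd that by (simp add: cInf_lower)
  have fs: "f 0 = 0" using f(3)[of 0 0] by simp
  \<comment> \<open>The midpoint gains \<open>|x - y|^2 / 4\<close> over the mean of the two values;
    as it cannot drop below \<open>I\<close>, a minimising sequence is Cauchy.\<close>
  have half: "g (smul H (1/2) (x + y)) = (g x + g y) / 2 - (hnorm H (x - y))\<^sup>2 / 4"
    if "x \<in> vecs H" "y \<in> vecs H" for x y
  proof -
    have "(hnorm H (smul H (1/2) (x + y)))\<^sup>2 = (hnorm H (x + y))\<^sup>2 / 4"
      using that by (subst hnorm_smul) (auto simp: power_divide)
    moreover have "Re (f (smul H (1/2) (x + y))) = (Re (f x) + Re (f y)) / 2"
      using that by (subst f(3)) (auto simp: f(2))
    ultimately show ?thesis
      using parallelogram[OF that] unfolding g_def by argo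
  qed
  have "\<exists>x\<in>vecs H. g x < I + 1 / real (Suc n)" for n
  proof -
    have "Inf (g ` vecs H) < I + 1 / real (Suc n)" by (simp add: I_def)
    then show ?thesis using bdd by (subst (asm) cInf_less_iff) (auto intro: vecs_0)
  qed
  then obtain X where X: "\<And>n. X n \<in> vecs H" "\<And>n. g (X n) < I + 1 / real (Suc n)" by metis
  define r where "r n = 1 / real (Suc n)" for n
  have dist: "(hnorm H (X m - X n))\<^sup>2 \<le> 2 * r m + 2 * r n" for m n
  proof -
    have *: "D \<le> 2 * a + 2 * b" if "u = (p + q) / 2 - D / 4" "p < I + a" "q < I + b" "I \<le> u"
      for u p q D a b :: real using that by argo
    show ?thesis
      by (rule *[OF half[OF X(1) X(1)] X(2)[folded r_def] X(2)[folded r_def] Ile]) (use X(1) in blast)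
  qed
  have "\<exists>N. \<forall>m\<ge>N. \<forall>n\<ge>N. hnorm H (X m - X n) < e" if e: "0 < e" for e
  proof -
    obtain N where N: "r N < e\<^sup>2 / 4"
      unfolding r_def using e by (meson nat_approx_posE divide_pos_pos zero_less_numeral zero_less_power)
    have "hnorm H (X m - X n) < e" if "m \<ge> N" "n \<ge> N" for m n
    proof -
      have "r m \<le> r N" "r n \<le> r N"
        using that by (simp_all add: r_def field_simps)
      then have "(hnorm H (X m - X n))\<^sup>2 < e\<^sup>2" using dist[of m n] N by linarith
      then show ?thesis using e by (simp add: power2_less_imp_less)
    qed
    then show ?thesis by blast
  qed
  then obtain z where z: "z \<in> vecs H" "(\<lambda>n. hnorm H (X n - z)) \<longlonglongrightarrow> 0"
    using Cauchy_converges[of X] X(1) by metis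
  have "(\<lambda>n. f (X n)) \<longlonglongrightarrow> f z"
  proof (rule LIM_zero_cancel, rule Lim_null_comparison)
    have "f (X n) - f z = f (X n - z)" for n
      using f(2)[of "X n - z" z] X(1) z(1) by simp
    then show "\<forall>\<^sub>F n in sequentially. norm (f (X n) - f z) \<le> C * hnorm H (X n - z)"
      using f(1) X(1) z(1) by simp
    show "(\<lambda>n. C * hnorm H (X n - z)) \<longlonglongrightarrow> 0" using tendsto_mult_left[OF z(2)] by simp
  qed
  then have "(\<lambda>n. g (X n)) \<longlonglongrightarrow> g z"
    unfolding g_def using tendsto_norm[OF X(1) z] by (intro tendsto_intros)
  moreover have "(\<lambda>n. I + 1 / real (Suc n)) \<longlonglongrightarrow> I + 0"
    by (intro tendsto_intros LIMSEQ_Suc[OF lim_1_over_n])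
  ultimately have "g z \<le> I + 0"
    by (rule LIMSEQ_le) (use X(2) less_imp_le in blast)
  then have min: "g z \<le> g x" if "x \<in> vecs H" for x using Ile that by force
  \<comment> \<open>First variation: along \<open>z + t x\<close> the functional is a quadratic
    polynomial in \<open>t\<close> with its minimum at \<open>0\<close>, so the linear coefficient
    \<open>2 r\<close> vanishes.\<close>
  have key: "Re (f x) = Re (ip H x z)" if x: "x \<in> vecs H" for x
  proof -
    define r where "r = Re (ip H x z) - Re (f x)"
    have "0 \<le> 2 * t * r + t\<^sup>2 * (hnorm H x)\<^sup>2" for t :: real
    proof -
      have "g (z + smul H t x) = g z + 2 * t * r + t\<^sup>2 * (hnorm H x)\<^sup>2"
        using x z(1) ip_cnj[of x z]
        by (simp add: g_def f hnorm_add_sq hnorm_smul ip_smul_right power_mult_distrib r_def algebra_simps)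
      then show ?thesis using min[of "z + smul H t x"] x z(1) by simp
    qed note q = this
    have "r = 0"
    proof (rule ccontr)
      assume "r \<noteq> 0"
      \<comment> \<open>The summand \<open>1\<close> keeps the division by \<open>s\<close>
        meaningful for \<open>x = 0\<close>.\<close>
      define s where "s = (hnorm H x)\<^sup>2 + 1"
      have s: "s > 0" by (simp add: s_def add_nonneg_pos)
      have "0 \<le> 2 * (- r / s) * r + (- r / s)\<^sup>2 * (hnorm H x)\<^sup>2" by (rule q)
      also have "\<dots> \<le> 2 * (- r / s) * r + (- r / s)\<^sup>2 * s"
        by (intro add_left_mono mult_left_mono) (auto simp: s_def)
      also have "\<dots> = - (r\<^sup>2 / s)" using s by (simp add: power2_eq_square field_simps)
      finally show False using s \<open>r \<noteq> 0\<close> by (simp add: divide_le_0_iff)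
    qed
    then show ?thesis by (simp add: r_def)
  qed
  \<comment> \<open>The imaginary part comes from the real part at \<open>i x\<close>.\<close>
  have "f x = ip H x z" if x: "x \<in> vecs H" for x
    using key[OF x] key[of "smul H \<i> x"] x z(1) f(3)[OF x] by (simp add: ip_smul complex_eq_iff)
  then show thesis using that z(1) by blast
qed

end

section \<open>Bounded operators and adjoints\<close>

lemma bounded_opsD:
  assumes "T \<in> bounded_ops H K"
  shows bounded_ops_vecs: "x \<in> vecs H \<Longrightarrow> T x \<in> vecs K"
    and bounded_ops_add: "\<lbrakk>x \<in> vecs H; y \<in> vecs H\<rbrakk> \<Longrightarrow> T (x + y) = T x + T y"
    and bounded_ops_smul: "x \<in> vecs H \<Longrightarrow> T (smul H c x) = smul K c (T x)"
    and bounded_ops_outside: "x \<notin> vecs H \<Longrightarrow> T x = 0"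
  using assms by (auto simp: bounded_ops_def)

lemma bounded_ops_ext:
  assumes "T \<in> bounded_ops H K" "V \<in> bounded_ops H K" "\<And>x. x \<in> vecs H \<Longrightarrow> T x = V x"
  shows "T = V"
proof
  show "T x = V x" for x
    using assms bounded_ops_outside[of T H K x] bounded_ops_outside[of V H K x]
    by (cases "x \<in> vecs H") auto
qed

locale pre_hilbert_pair = H: pre_hilbert H + K: pre_hilbert K
  for H :: "'v::ab_group_add hspace" and K :: "'w::ab_group_add hspace"
begin

lemma bounded_opsI:
  assumes "\<And>x. x \<in> vecs H \<Longrightarrow> T x \<in> vecs K"
    "\<And>x y. \<lbrakk>x \<in> vecs H; y \<in> vecs H\<rbrakk> \<Longrightarrow> T (x + y) = T x + T y"
    "\<And>x c. x \<in> vecs H \<Longrightarrow> T (smul H c x) = smul K c (T x)"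
    "\<And>x. x \<in> vecs H \<Longrightarrow> hnorm K (T x) \<le> C * hnorm H x"
    "\<And>x. x \<notin> vecs H \<Longrightarrow> T x = 0"
  shows "T \<in> bounded_ops H K"
  using assms unfolding bounded_ops_def by blast

lemma bounded_ops_0:
  assumes "T \<in> bounded_ops H K"
  shows "T 0 = 0"
  using bounded_ops_add[OF assms, of 0 0] by simp

lemma bounded_ops_neg:
  assumes "T \<in> bounded_ops H K" "x \<in> vecs H"
  shows "T (- x) = - T x"
  using bounded_ops_smul[OF assms, of "-1"] by simp

lemma bounded_ops_diff:
  assumes "T \<in> bounded_ops H K" "x \<in> vecs H" "y \<in> vecs H"
  shows "T (x - y) = T x - T y"
  using bounded_ops_add[OF assms(1,2), of "- y"] bounded_ops_neg[OF assms(1,3)] assms(3) by simp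

lemma bounded_ops_sum:
  assumes "T \<in> bounded_ops H K" "\<And>i. i \<in> I \<Longrightarrow> f i \<in> vecs H"
  shows "T (sum f I) = (\<Sum>i\<in>I. T (f i))"
  using assms(2)
proof (induction I rule: infinite_finite_induct)
  case (insert i I)
  then show ?case using bounded_ops_add[OF assms(1), of "f i" "sum f I"] by (auto intro: H.vecs_sum)
qed (auto simp: bounded_ops_0[OF assms(1)])

lemma bounded_ops_bound:
  assumes "T \<in> bounded_ops H K"
  obtains C where "0 < C" "\<And>x. x \<in> vecs H \<Longrightarrow> hnorm K (T x) \<le> C * hnorm H x"
proof -
  obtain C where C: "\<And>x. x \<in> vecs H \<Longrightarrow> hnorm K (T x) \<le> C * hnorm H x"
    using assms unfolding bounded_ops_def by blast
  have "hnorm K (T x) \<le> (\<bar>C\<bar> + 1) * hnorm H x" if "x \<in> vecs H" for x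
    using C[OF that] mult_right_mono[of C "\<bar>C\<bar> + 1" "hnorm H x"] H.hnorm_nonneg[OF that] by linarith
  then show thesis using that[of "\<bar>C\<bar> + 1"] by simp
qed

lemma tendsto_op:
  assumes T: "T \<in> bounded_ops H K" and X: "\<And>n. X n \<in> vecs H" "l \<in> vecs H"
    and lim: "(\<lambda>n. hnorm H (X n - l)) \<longlonglongrightarrow> 0"
  shows "(\<lambda>n. hnorm K (T (X n) - T l)) \<longlonglongrightarrow> 0"
proof -
  obtain C where C: "\<And>x. x \<in> vecs H \<Longrightarrow> hnorm K (T x) \<le> C * hnorm H x"
    using bounded_ops_bound[OF T] by blast
  show ?thesis
  proof (rule Lim_null_comparison)
    show "\<forall>\<^sub>F n in sequentially. norm (hnorm K (T (X n) - T l)) \<le> C * hnorm H (X n - l)"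
      using C[of "X _ - l"] X bounded_ops_diff[OF T] bounded_ops_vecs[OF T] by simp
    show "(\<lambda>n. C * hnorm H (X n - l)) \<longlonglongrightarrow> 0" using tendsto_mult_left[OF lim] by simp
  qed
qed

lemma opnorm_le:
  assumes "0 \<le> C" "\<And>x. x \<in> vecs H \<Longrightarrow> hnorm K (T x) \<le> C * hnorm H x"
  shows "opnorm H K T \<le> C"
  unfolding opnorm_def
proof (rule cSUP_least)
  show "{x \<in> vecs H. hnorm H x \<le> 1} \<noteq> {}" using H.vecs_0 by force
  show "hnorm K (T x) \<le> C" if "x \<in> {x \<in> vecs H. hnorm H x \<le> 1}" for x
    using that order_trans[OF assms(2)[of x] mult_left_le[of "hnorm H x" C]] assms(1) by simp
qed

lemma opnorm_upper:
  assumes T: "T \<in> bounded_ops H K" and x: "x \<in> vecs H" "hnorm H x \<le> 1"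
  shows "hnorm K (T x) \<le> opnorm H K T"
  unfolding opnorm_def
proof (rule cSUP_upper)
  obtain C where C: "0 < C" "\<And>x. x \<in> vecs H \<Longrightarrow> hnorm K (T x) \<le> C * hnorm H x"
    using bounded_ops_bound[OF T] by blast
  show "bdd_above ((\<lambda>x. hnorm K (T x)) ` {x \<in> vecs H. hnorm H x \<le> 1})"
  proof (rule bdd_aboveI2)
    show "hnorm K (T x) \<le> C" if "x \<in> {x \<in> vecs H. hnorm H x \<le> 1}" for x
      using that order_trans[OF C(2)[of x] mult_left_le[of "hnorm H x" C]] C(1) by simp
  qed
qed (use x in simp)

lemma opnorm_nonneg: "T \<in> bounded_ops H K \<Longrightarrow> 0 \<le> opnorm H K T"
  using opnorm_upper[of T 0] by (simp add: bounded_ops_0)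

lemma opnorm_bound:
  assumes T: "T \<in> bounded_ops H K" and x: "x \<in> vecs H"
  shows "hnorm K (T x) \<le> opnorm H K T * hnorm H x"
proof (cases "x = 0")
  case False
  then have n: "hnorm H x > 0" using x H.hnorm_nonneg[OF x] H.hnorm_eq_0[OF x] by linarith
  have "hnorm K (T (smul H (of_real (1 / hnorm H x)) x)) \<le> opnorm H K T"
    by (rule opnorm_upper[OF T]) (use x n in \<open>simp_all add: H.hnorm_smul norm_divide\<close>)
  then have "hnorm K (T x) / hnorm H x \<le> opnorm H K T"
    using n x bounded_ops_vecs[OF T x]
    by (simp add: bounded_ops_smul[OF T x] K.hnorm_smul norm_divide)
  then show ?thesis using n by (simp add: field_simps)
qed (use T in \<open>simp add: bounded_ops_0\<close>)

lemma bounded_ops_plus: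
  assumes "T \<in> bounded_ops H K" "V \<in> bounded_ops H K"
  shows "T + V \<in> bounded_ops H K"
proof (rule bounded_opsI)
  show "hnorm K ((T + V) x) \<le> (opnorm H K T + opnorm H K V) * hnorm H x" if "x \<in> vecs H" for x
    using K.hnorm_triangle[of "T x" "V x"] opnorm_bound[OF assms(1) that] opnorm_bound[OF assms(2) that]
      bounded_ops_vecs[OF assms(1) that] bounded_ops_vecs[OF assms(2) that]
    by (simp add: distrib_right)
qed (simp_all add: bounded_ops_vecs[OF assms(1)] bounded_ops_vecs[OF assms(2)] bounded_ops_add[OF assms(1)]
    bounded_ops_add[OF assms(2)] bounded_ops_smul[OF assms(1)] bounded_ops_smul[OF assms(2)]
    bounded_ops_outside[OF assms(1)] bounded_ops_outside[OF assms(2)] K.scale_right_distrib)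

lemma bounded_ops_opscale:
  assumes "T \<in> bounded_ops H K"
  shows "opscale K c T \<in> bounded_ops H K"
proof (rule bounded_opsI)
  show "hnorm K (opscale K c T x) \<le> (cmod c * opnorm H K T) * hnorm H x" if "x \<in> vecs H" for x
    using opnorm_bound[OF assms that] bounded_ops_vecs[OF assms that]
    by (simp add: opscale_def K.hnorm_smul mult.assoc mult_left_mono)
qed (use assms in \<open>auto simp: opscale_def bounded_opsD K.scale_right_distrib mult.commute\<close>)

lemma bounded_ops_zero: "0 \<in> bounded_ops H K"
  by (rule bounded_opsI[where C = 0]) auto

lemma bounded_ops_minus:
  assumes "T \<in> bounded_ops H K" "V \<in> bounded_ops H K"
  shows "T - V \<in> bounded_ops H K"
proof -
  have "T - V = T + opscale K (-1) V"
    by (simp add: fun_eq_iff opscale_def)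
  then show ?thesis using bounded_ops_plus[OF assms(1) bounded_ops_opscale[OF assms(2)]] by metis
qed

text \<open>Makes the definite description in \<open>adj\<close> usable: uniqueness is definiteness
  applied to the difference of two candidates. Concrete adjoints are identified this way.\<close>

lemma adj_eqI:
  assumes "V \<in> bounded_ops K H"
    and "\<And>x y. \<lbrakk>x \<in> vecs H; y \<in> vecs K\<rbrakk> \<Longrightarrow> ip K (T x) y = ip H x (V y)"
  shows "adj H K T = V"
  unfolding adj_def
proof (rule the_equality)
  fix W assume W: "W \<in> bounded_ops K H \<and> (\<forall>x\<in>vecs H. \<forall>y\<in>vecs K. ip K (T x) y = ip H x (W y))"
  show "W = V"
  proof (rule bounded_ops_ext)
    fix y assume y: "y \<in> vecs K"
    define x where "x = W y - V y"
    have x: "x \<in> vecs H" and w: "W y \<in> vecs H" "V y \<in> vecs H"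
      using y W assms bounded_ops_vecs unfolding x_def by blast+
    have "ip H x x = ip H x (W y) - ip H x (V y)"
      using H.ip_diff_right[OF x w] by (simp add: x_def)
    also have "\<dots> = 0" using W assms(2) x y by simp
    finally show "W y = V y" using H.ip_definite[OF x] by (simp add: x_def)
  qed (use W assms in auto)
qed (use assms in blast)

end

lemma (in pre_hilbert) pre_hilbert_pair_self: "pre_hilbert_pair H H"
  by (simp add: pre_hilbert_pair_def pre_hilbert_axioms)

lemma bounded_ops_comp:
  assumes "pre_hilbert_pair H K" "pre_hilbert_pair K L"
    and T: "T \<in> bounded_ops H K" and V: "V \<in> bounded_ops K L"
  shows "V \<circ> T \<in> bounded_ops H L"
proof -
  interpret HK: pre_hilbert_pair H K by fact
  interpret KL: pre_hilbert_pair K L by fact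
  interpret HL: pre_hilbert_pair H L ..
  show ?thesis
  proof (rule HL.bounded_opsI)
    show "hnorm L ((V \<circ> T) x) \<le> (opnorm K L V * opnorm H K T) * hnorm H x" if "x \<in> vecs H" for x
    proof -
      have "hnorm L (V (T x)) \<le> opnorm K L V * hnorm K (T x)"
        using KL.opnorm_bound[OF V] bounded_ops_vecs[OF T that] by blast
      also have "\<dots> \<le> opnorm K L V * (opnorm H K T * hnorm H x)"
        using HK.opnorm_bound[OF T that] KL.opnorm_nonneg[OF V] by (rule mult_left_mono)
      finally show ?thesis by (simp add: mult.assoc)
    qed
  qed (use T V in \<open>auto simp: bounded_opsD KL.bounded_ops_0\<close>)
qed

lemma (in pre_hilbert) ops_comp:
  "\<lbrakk>V \<in> bounded_ops H H; T \<in> bounded_ops H H\<rbrakk> \<Longrightarrow> V \<circ> T \<in> bounded_ops H H"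
  using bounded_ops_comp[OF pre_hilbert_pair_self pre_hilbert_pair_self] by blast

locale hilbert_pair = H: hilbert_space H + K: pre_hilbert K
  for H :: "'v::ab_group_add hspace" and K :: "'w::ab_group_add hspace"
begin

sublocale pre_hilbert_pair H K ..

lemma
  assumes T: "T \<in> bounded_ops H K"
  shows adj_bounded_ops: "adj H K T \<in> bounded_ops K H"
    and ip_adj: "\<lbrakk>x \<in> vecs H; y \<in> vecs K\<rbrakk> \<Longrightarrow> ip K (T x) y = ip H x (adj H K T y)"
proof -
  have ex: "\<exists>z\<in>vecs H. \<forall>x\<in>vecs H. ip K (T x) y = ip H x z" if y: "y \<in> vecs K" for y
  proof -
    obtain z where "z \<in> vecs H" "\<And>x. x \<in> vecs H \<Longrightarrow> ip K (T x) y = ip H x z"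
    proof (rule H.riesz)
      show "cmod (ip K (T x) y) \<le> (opnorm H K T * hnorm K y) * hnorm H x" if x: "x \<in> vecs H" for x
      proof -
        have "cmod (ip K (T x) y) \<le> hnorm K (T x) * hnorm K y"
          using K.Cauchy_Schwarz y bounded_ops_vecs[OF T x] by blast
        also have "\<dots> \<le> (opnorm H K T * hnorm H x) * hnorm K y"
          using opnorm_bound[OF T x] y by (simp add: mult_right_mono)
        finally show ?thesis by (simp add: mult_ac)
      qed
    qed (use T y in \<open>auto simp: bounded_opsD K.ip_add K.ip_smul\<close>)
    then show ?thesis by blast
  qed
  define V where "V y = (if y \<in> vecs K then SOME z. z \<in> vecs H \<and> (\<forall>x\<in>vecs H. ip K (T x) y = ip H x z) else 0)" for y
  have V: "V y \<in> vecs H \<and> (\<forall>x\<in>vecs H. ip K (T x) y = ip H x (V y))" if "y \<in> vecs K" for y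
    using someI_ex[of "\<lambda>z. z \<in> vecs H \<and> (\<forall>x\<in>vecs H. ip K (T x) y = ip H x z)"] ex[OF that] that
    unfolding V_def by auto
  have uniq: "z = z'" if "z \<in> vecs H" "z' \<in> vecs H" "\<And>x. x \<in> vecs H \<Longrightarrow> ip H x z = ip H x z'" for z z'
  proof -
    have "ip H (z - z') (z - z') = 0"
      using that(3)[of "z - z'"] that(1,2) by (simp add: H.ip_diff_right)
    then show ?thesis using H.ip_definite[of "z - z'"] that by simp
  qed
  have Vbd: "V \<in> bounded_ops K H"
  proof -
    interpret KH: pre_hilbert_pair K H ..
    show ?thesis
    proof (rule KH.bounded_opsI)
      show "V (x + y) = V x + V y" if "x \<in> vecs K" "y \<in> vecs K" for x y
      proof (rule uniq)
        fix u assume u: "u \<in> vecs H"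
        have "ip K (T u) (x + y) = ip K (T u) x + ip K (T u) y"
          using bounded_ops_vecs[OF T u] that by (rule K.ip_add_right)
        then show "ip H u (V (x + y)) = ip H u (V x + V y)"
          using V that u H.ip_add_right by simp
      qed (use V that in auto)
      show "V (smul K c x) = smul H c (V x)" if "x \<in> vecs K" for x c
      proof (rule uniq)
        fix u assume u: "u \<in> vecs H"
        have "ip K (T u) (smul K c x) = cnj c * ip K (T u) x"
          using bounded_ops_vecs[OF T u] that by (rule K.ip_smul_right)
        then show "ip H u (V (smul K c x)) = ip H u (smul H c (V x))"
          using V[of x] V[of "smul K c x"] that u H.ip_smul_right by simp
      qed (use V that in auto)
      show "hnorm H (V y) \<le> opnorm H K T * hnorm K y" if y: "y \<in> vecs K" for y
      proof (cases "V y = 0")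
        case True
        then show ?thesis using opnorm_nonneg[OF T] y by simp
      next
        case False
        have v: "V y \<in> vecs H" using V y by blast
        \<comment> \<open>Testing the adjoint identity with \<open>x = V y\<close> bounds the norm
          of \<open>V y\<close> itself.\<close>
        have "hnorm H (V y) * hnorm H (V y) = Re (ip K (T (V y)) y)"
          using V[OF y] v by (simp add: H.ip_self power2_eq_square)
        also have "\<dots> \<le> hnorm K (T (V y)) * hnorm K y"
          using K.Re_ip_le bounded_ops_vecs[OF T v] y by blast
        also have "\<dots> \<le> (opnorm H K T * hnorm H (V y)) * hnorm K y"
          using opnorm_bound[OF T v] y by (simp add: mult_right_mono)
        finally have "hnorm H (V y) * hnorm H (V y) \<le> hnorm H (V y) * (opnorm H K T * hnorm K y)"
          by (simp add: mult_ac)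
        moreover have "hnorm H (V y) > 0"
          using False v H.hnorm_nonneg[OF v] H.hnorm_eq_0[OF v] by linarith
        ultimately show ?thesis by simp
      qed
      show "V y \<in> vecs H" if "y \<in> vecs K" for y using V that by blast
      show "V y = 0" if "y \<notin> vecs K" for y using that by (simp add: V_def)
    qed
  qed
  have "adj H K T = V" using Vbd V by (intro adj_eqI) auto
  then show "adj H K T \<in> bounded_ops K H"
    and "\<lbrakk>x \<in> vecs H; y \<in> vecs K\<rbrakk> \<Longrightarrow> ip K (T x) y = ip H x (adj H K T y)"
    using Vbd V by auto
qed

lemma ip_adj':
  assumes "T \<in> bounded_ops H K" "x \<in> vecs H" "y \<in> vecs K"
  shows "ip K y (T x) = ip H (adj H K T y) x"
  using ip_adj[OF assms] K.ip_cnj[of "T x" y] H.ip_cnj[of x "adj H K T y"]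
    bounded_ops_vecs[OF assms(1,2)] bounded_ops_vecs[OF adj_bounded_ops[OF assms(1)] assms(3)] assms
  by simp

lemma hnorm_adj_le:
  assumes T: "T \<in> bounded_ops H K" and y: "y \<in> vecs K" and "0 \<le> C"
    and C: "\<And>x. x \<in> vecs H \<Longrightarrow> hnorm K (T x) \<le> C * hnorm H x"
  shows "hnorm H (adj H K T y) \<le> C * hnorm K y"
proof (cases "adj H K T y = 0")
  case False
  define v where "v = adj H K T y"
  have v: "v \<in> vecs H" unfolding v_def using bounded_ops_vecs[OF adj_bounded_ops[OF T] y] .
  have n: "hnorm H v > 0" using False v H.hnorm_nonneg[OF v] H.hnorm_eq_0[OF v] unfolding v_def by linarith
  have "hnorm H v * hnorm H v = Re (ip K (T v) y)"
    using ip_adj[OF T v y] v by (simp add: H.ip_self power2_eq_square flip: v_def)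
  also have "\<dots> \<le> hnorm K (T v) * hnorm K y"
    using K.Re_ip_le bounded_ops_vecs[OF T v] y by blast
  also have "\<dots> \<le> (C * hnorm H v) * hnorm K y"
    using C[OF v] y by (simp add: mult_right_mono)
  finally have "hnorm H v * hnorm H v \<le> hnorm H v * (C * hnorm K y)" by (simp add: mult_ac)
  then show ?thesis using n by (simp add: v_def)
qed (use assms in simp)

end

context hilbert_space
begin

lemma hilbert_pair_self: "hilbert_pair H H"
  by (simp add: hilbert_pair_def hilbert_space_axioms pre_hilbert_axioms)

interpretation self: hilbert_pair H H by (rule hilbert_pair_self)

lemma adj_comp:
  assumes "S \<in> bounded_ops H H" "T \<in> bounded_ops H H"
  shows "adj H H (S \<circ> T) = adj H H T \<circ> adj H H S"
proof (rule self.adj_eqI)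
  show "adj H H T \<circ> adj H H S \<in> bounded_ops H H"
    using assms by (intro ops_comp self.adj_bounded_ops)
  show "ip H ((S \<circ> T) x) y = ip H x ((adj H H T \<circ> adj H H S) y)" if "x \<in> vecs H" "y \<in> vecs H" for x y
    using that assms bounded_ops_vecs[OF assms(2)] bounded_ops_vecs[OF self.adj_bounded_ops[OF assms(1)]]
    by (simp add: self.ip_adj)
qed

lemma adj_plus:
  assumes "S \<in> bounded_ops H H" "T \<in> bounded_ops H H"
  shows "adj H H (S + T) = adj H H S + adj H H T"
proof (rule self.adj_eqI)
  show "ip H ((S + T) x) y = ip H x ((adj H H S + adj H H T) y)" if "x \<in> vecs H" "y \<in> vecs H" for x y
    using that assms
      bounded_ops_vecs[OF assms(1)] bounded_ops_vecs[OF assms(2)]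
      bounded_ops_vecs[OF self.adj_bounded_ops[OF assms(1)]] bounded_ops_vecs[OF self.adj_bounded_ops[OF assms(2)]]
    by (simp add: self.ip_adj ip_add ip_add_right)
qed (use assms in \<open>intro self.bounded_ops_plus self.adj_bounded_ops\<close>)

lemma adj_opscale:
  assumes "T \<in> bounded_ops H H"
  shows "adj H H (opscale H c T) = opscale H (cnj c) (adj H H T)"
proof (rule self.adj_eqI)
  show "ip H (opscale H c T x) y = ip H x (opscale H (cnj c) (adj H H T) y)" if "x \<in> vecs H" "y \<in> vecs H" for x y
    using that assms
      bounded_ops_vecs[OF assms] bounded_ops_vecs[OF self.adj_bounded_ops[OF assms]]
    by (simp add: opscale_def self.ip_adj ip_smul ip_smul_right)
qed (use assms in \<open>intro self.bounded_ops_opscale self.adj_bounded_ops\<close>)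

lemma adj_adj:
  assumes "T \<in> bounded_ops H H"
  shows "adj H H (adj H H T) = T"
  by (rule self.adj_eqI) (use assms self.ip_adj'[OF assms] in auto)

lemma adj_idop: "adj H H (idop H) = idop H"
  by (rule self.adj_eqI) (auto simp: idop_def intro!: self.bounded_opsI[where C = 1])

end

section \<open>The operator metric and norms of operator matrices\<close>

context pre_hilbert
begin

interpretation self: pre_hilbert_pair H H by (rule pre_hilbert_pair_self)

lemma bounded_ops_idop: "idop H \<in> bounded_ops H H"
  by (auto simp: idop_def intro!: self.bounded_opsI[where C = 1])

text \<open>\<open>cstar_subalgebra\<close> speaks of closedness in the operator norm; the metric
  space instance supplies its characterisation by sequences.\<close>

sublocale opmetric: Metric_space "bounded_ops H H" "opdist H"
proof
  show "0 \<le> opdist H S T" for S T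
    by (simp add: opdist_def self.opnorm_nonneg self.bounded_ops_minus)
  have le: "opnorm H H (S - T) \<le> opnorm H H (T - S)"
    if S: "S \<in> bounded_ops H H" and T: "T \<in> bounded_ops H H" for S T
  proof (rule self.opnorm_le)
    show "0 \<le> opnorm H H (T - S)" using S T by (simp add: self.opnorm_nonneg self.bounded_ops_minus)
    show "hnorm H ((S - T) x) \<le> opnorm H H (T - S) * hnorm H x" if x: "x \<in> vecs H" for x
      using self.opnorm_bound[OF self.bounded_ops_minus[OF T S] x] hnorm_minus_commute[of "S x" "T x"]
        bounded_ops_vecs[OF S x] bounded_ops_vecs[OF T x] by simp
  qed
  then show "opdist H S T = opdist H T S" for S T
    by (simp add: opdist_def order_antisym)
  show "opdist H S T = 0 \<longleftrightarrow> S = T" if S: "S \<in> bounded_ops H H" and T: "T \<in> bounded_ops H H" for S T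
  proof
    assume "opdist H S T = 0"
    then have "opnorm H H (S - T) = 0" using S T by (simp add: opdist_def)
    then have "hnorm H ((S - T) x) = 0" if "x \<in> vecs H" for x
      using self.opnorm_bound[OF self.bounded_ops_minus[OF S T] that]
        hnorm_nonneg[OF bounded_ops_vecs[OF self.bounded_ops_minus[OF S T] that]] by simp
    then show "S = T"
      using bounded_ops_vecs[OF S] bounded_ops_vecs[OF T] by (intro bounded_ops_ext[OF S T]) simp
  next
    assume "S = T"
    then show "opdist H S T = 0"
      using self.opnorm_le[of 0 "\<lambda>_. 0"] self.opnorm_nonneg[OF self.bounded_ops_zero]
      by (simp add: opdist_def zero_fun_def)
  qed
  show "opdist H S V \<le> opdist H S T + opdist H T V"
    if S: "S \<in> bounded_ops H H" and T: "T \<in> bounded_ops H H" and V: "V \<in> bounded_ops H H" for S T V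
  proof -
    have "opnorm H H (S - V) \<le> opnorm H H (S - T) + opnorm H H (T - V)"
    proof (rule self.opnorm_le)
      show "0 \<le> opnorm H H (S - T) + opnorm H H (T - V)"
        using S T V by (simp add: self.opnorm_nonneg self.bounded_ops_minus)
      fix x assume x: "x \<in> vecs H"
      show "hnorm H ((S - V) x) \<le> (opnorm H H (S - T) + opnorm H H (T - V)) * hnorm H x"
        using self.opnorm_bound[OF self.bounded_ops_minus[OF S T] x]
          self.opnorm_bound[OF self.bounded_ops_minus[OF T V] x]
          hnorm_diff_triangle[of "S x" "T x" "V x"]
          bounded_ops_vecs[OF S x] bounded_ops_vecs[OF T x] bounded_ops_vecs[OF V x]
        by (simp add: distrib_right)
    qed
    then show ?thesis using S T V by (simp add: opdist_def)
  qed
qed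

lemma op_limitD:
  assumes "limitin opmetric.mtopology X T sequentially" "\<And>n. X n \<in> bounded_ops H H"
  shows "T \<in> bounded_ops H H" "(\<lambda>n. opnorm H H (X n - T)) \<longlonglongrightarrow> 0"
  using assms unfolding opmetric.limitin_metric_dist_null by (auto simp: opdist_def)

text \<open>A supremum of reals is informative only for a bounded set, so boundedness comes first:
  the entries of a column of norm at most \<open>1\<close> have norm at most \<open>1\<close>, and
  each row is bounded by the sum of its operator norms. The general inequality follows by
  scaling.\<close>

lemma
  assumes T: "\<And>i j. \<lbrakk>i < n; j < n\<rbrakk> \<Longrightarrow> T i j \<in> bounded_ops H H"
  shows matrix_opnorm_nonneg: "0 \<le> matrix_opnorm H n T"
    and hnorm_matrix_le: "(\<And>j. j < n \<Longrightarrow> x j \<in> vecs H) \<Longrightarrow> sqrt (\<Sum>i<n. (hnorm H (\<Sum>j<n. T i j (x j)))\<^sup>2)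
    \<le> matrix_opnorm H n T * sqrt (\<Sum>j<n. (hnorm H (x j))\<^sup>2)"
proof -
  define g where "g x = sqrt (\<Sum>i<n. (hnorm H (\<Sum>j<n. T i j (x j)))\<^sup>2)" for x
  define B where "B = {x. (\<forall>j<n. x j \<in> vecs H) \<and> (\<Sum>j<n. (hnorm H (x j))\<^sup>2) \<le> 1}"
  define s where "s = sqrt (\<Sum>j<n. (hnorm H (x j))\<^sup>2)"
  have bdd: "bdd_above (g ` B)"
  proof (rule bdd_aboveI2)
    fix x assume "x \<in> B"
    then have x: "\<And>j. j < n \<Longrightarrow> x j \<in> vecs H" and x1: "(\<Sum>j<n. (hnorm H (x j))\<^sup>2) \<le> 1"
      by (auto simp: B_def)
    have j1: "hnorm H (x j) \<le> 1" if "j < n" for j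
    proof -
      have "(hnorm H (x j))\<^sup>2 \<le> (\<Sum>j<n. (hnorm H (x j))\<^sup>2)"
        using that by (intro member_le_sum) auto
      then have "(hnorm H (x j))\<^sup>2 \<le> 1\<^sup>2" using x1 by simp
      then show ?thesis by (rule power2_le_imp_le) simp
    qed
    have "hnorm H (\<Sum>j<n. T i j (x j)) \<le> (\<Sum>j<n. opnorm H H (T i j))" if i: "i < n" for i
    proof -
      have "hnorm H (\<Sum>j<n. T i j (x j)) \<le> (\<Sum>j<n. hnorm H (T i j (x j)))"
        using bounded_ops_vecs[OF T[OF i]] x by (intro hnorm_sum_le) auto
      also have "\<dots> \<le> (\<Sum>j<n. opnorm H H (T i j))"
        using self.opnorm_upper[OF T[OF i]] x j1 by (intro sum_mono) auto
      finally show ?thesis .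
    qed
    then show "g x \<le> sqrt (\<Sum>i<n. (\<Sum>j<n. opnorm H H (T i j))\<^sup>2)"
      unfolding g_def using bounded_ops_vecs[OF T] x
      by (intro real_sqrt_le_mono sum_mono power_mono hnorm_nonneg vecs_sum) auto
  qed
  have "g (\<lambda>j. 0) \<le> matrix_opnorm H n T"
    unfolding matrix_opnorm_def g_def[symmetric] B_def[symmetric] using bdd
    by (rule cSUP_upper[rotated]) (simp add: B_def)
  then show nonneg: "0 \<le> matrix_opnorm H n T"
    by (simp add: g_def self.bounded_ops_0 T)
  assume x: "\<And>j. j < n \<Longrightarrow> x j \<in> vecs H"
  show "sqrt (\<Sum>i<n. (hnorm H (\<Sum>j<n. T i j (x j)))\<^sup>2)
    \<le> matrix_opnorm H n T * sqrt (\<Sum>j<n. (hnorm H (x j))\<^sup>2)"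
  proof (cases "s = 0")
    case True
    then have "hnorm H (x j) = 0" if "j < n" for j
      using that unfolding s_def by (simp add: sum_nonneg_eq_0_iff)
    then have "x j = 0" if "j < n" for j using x that by simp
    then have "g x = 0" by (simp add: g_def self.bounded_ops_0 T)
    then show ?thesis using True by (simp add: g_def flip: s_def)
  next
    case False
    then have s: "s > 0" unfolding s_def by (simp add: sum_nonneg order_less_le)
    have ssq: "s\<^sup>2 = (\<Sum>j<n. (hnorm H (x j))\<^sup>2)" unfolding s_def by (simp add: sum_nonneg)
    define y where "y j = smul H (of_real (1/s)) (x j)" for j
    have "(\<Sum>j<n. (hnorm H (y j))\<^sup>2) = (\<Sum>j<n. (1/s)\<^sup>2 * (hnorm H (x j))\<^sup>2)"
      using x s by (intro sum.cong) (auto simp: y_def hnorm_smul norm_divide power_divide)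
    also have "\<dots> = (1/s)\<^sup>2 * s\<^sup>2" by (simp only: ssq sum_distrib_left)
    also have "\<dots> = 1" using s by (simp add: power_divide)
    finally have yB: "y \<in> B" using x by (simp add: B_def y_def)
    have gy: "g y = g x / s"
    proof -
      have "hnorm H (\<Sum>j<n. T i j (y j)) = (1/s) * hnorm H (\<Sum>j<n. T i j (x j))" if i: "i < n" for i
      proof -
        have "(\<Sum>j<n. T i j (y j)) = (\<Sum>j<n. smul H (of_real (1/s)) (T i j (x j)))"
          unfolding y_def using x T i by (intro sum.cong refl bounded_ops_smul[OF T]) auto
        also have "\<dots> = smul H (of_real (1/s)) (\<Sum>j<n. T i j (x j))"
          by (simp add: scale_sum_right)
        finally show ?thesis
          using hnorm_smul[OF vecs_sum[of "{..<n}" "\<lambda>j. T i j (x j)"]] bounded_ops_vecs[OF T[OF i]] x s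
          by (simp add: norm_divide)
      qed
      then have "g y = sqrt (\<Sum>i<n. (1/s)\<^sup>2 * (hnorm H (\<Sum>j<n. T i j (x j)))\<^sup>2)"
        unfolding g_def by (intro arg_cong[where f = sqrt] sum.cong) (auto simp: power_divide)
      also have "\<dots> = g x / s" using s
        by (simp add: g_def real_sqrt_mult real_sqrt_divide flip: sum_distrib_left)
      finally show ?thesis .
    qed
    have "g y \<le> matrix_opnorm H n T"
      unfolding matrix_opnorm_def g_def[symmetric] B_def[symmetric] using bdd yB by (rule cSUP_upper[rotated])
    then show ?thesis using s gy by (simp add: g_def[symmetric] s_def[symmetric] field_simps)
  qed
qed

lemma matrix_opnorm_le:
  assumes "0 \<le> C"
    and "\<And>x. (\<And>j. j < n \<Longrightarrow> x j \<in> vecs H) \<Longrightarrow>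
      sqrt (\<Sum>i<n. (hnorm H (\<Sum>j<n. T i j (x j)))\<^sup>2) \<le> C * sqrt (\<Sum>j<n. (hnorm H (x j))\<^sup>2)"
  shows "matrix_opnorm H n T \<le> C"
  unfolding matrix_opnorm_def
proof (rule cSUP_least)
  have "(\<lambda>j. 0) \<in> {x. (\<forall>j<n. x j \<in> vecs H) \<and> (\<Sum>j<n. (hnorm H (x j))\<^sup>2) \<le> 1}"
    using vecs_0 by (simp del: sum_constant add: sum.neutral)
  then show "{x. (\<forall>j<n. x j \<in> vecs H) \<and> (\<Sum>j<n. (hnorm H (x j))\<^sup>2) \<le> 1} \<noteq> {}" by (metis empty_iff)
  fix x assume x: "x \<in> {x. (\<forall>j<n. x j \<in> vecs H) \<and> (\<Sum>j<n. (hnorm H (x j))\<^sup>2) \<le> 1}"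
  then have "sqrt (\<Sum>i<n. (hnorm H (\<Sum>j<n. T i j (x j)))\<^sup>2) \<le> C * sqrt (\<Sum>j<n. (hnorm H (x j))\<^sup>2)"
    by (intro assms) auto
  also have "\<dots> \<le> C * 1" using x assms(1) by (intro mult_left_mono) auto
  finally show "sqrt (\<Sum>i<n. (hnorm H (\<Sum>j<n. T i j (x j)))\<^sup>2) \<le> C" by simp
qed

end

section \<open>Exactness of the Koszul complex\<close>

definition koszul_sign :: "nat set \<Rightarrow> nat \<Rightarrow> complex" where
  "koszul_sign I j = (- 1) ^ card {i \<in> I. i < j}"

text \<open>The factor by which inserting or deleting \<open>l\<close> changes
  \<open>koszul_sign I j\<close>. It is \<open>1\<close> for \<open>l = j\<close>, since only
  elements strictly below \<open>j\<close> are counted.\<close>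

definition order_sign :: "nat \<Rightarrow> nat \<Rightarrow> complex" where
  "order_sign l j = (if l < j then - 1 else 1)"

lemma order_sign_swap: "l \<noteq> j \<Longrightarrow> order_sign l j = - order_sign j l"
  by (auto simp: order_sign_def)

lemma order_sign_self [simp]: "order_sign j j = 1"
  by (simp add: order_sign_def)

lemma order_sign_sq [simp]: "order_sign l j * (order_sign l j * c) = c"
  by (auto simp: order_sign_def)

lemma koszul_sign_sq [simp]: "koszul_sign I j * koszul_sign I j = 1"
  by (simp add: koszul_sign_def flip: power_mult_distrib)

lemma koszul_sign_sq' [simp]: "koszul_sign I j * (koszul_sign I j * c) = c"
  by (simp flip: mult.assoc)

lemma koszul_sign_remove:
  assumes "finite I" "l \<in> I"
  shows "koszul_sign I j = order_sign l j * koszul_sign (I - {l}) j"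
proof (cases "l < j")
  case True
  then have "{i \<in> I. i < j} = insert l {i \<in> I - {l}. i < j}" using assms by auto
  moreover have "card (insert l {i \<in> I - {l}. i < j}) = Suc (card {i \<in> I - {l}. i < j})"
    using assms by (intro card_insert_disjoint) auto
  ultimately show ?thesis using True by (simp add: koszul_sign_def order_sign_def)
next
  case False
  then have "{i \<in> I. i < j} = {i \<in> I - {l}. i < j}" by auto
  then show ?thesis using False by (simp add: koszul_sign_def order_sign_def)
qed

lemma koszul_sign_minus:
  "\<lbrakk>finite I; l \<in> I\<rbrakk> \<Longrightarrow> koszul_sign (I - {l}) j = order_sign l j * koszul_sign I j"
  using koszul_sign_remove[of I l j] by simp

lemma koszul_sign_insert:
  "\<lbrakk>finite I; l \<notin> I\<rbrakk> \<Longrightarrow> koszul_sign (insert l I) j = order_sign l j * koszul_sign I j"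
  using koszul_sign_remove[of "insert l I" l j] by simp

context pre_hilbert
begin

interpretation self: pre_hilbert_pair H H by (rule pre_hilbert_pair_self)

text \<open>Exchanging the summations gives \<open>S = - S\<close>. The ambient type is only an
  abelian group, so the factor two is cancelled through the scalar \<open>1 + 1\<close>.\<close>

lemma sum_antisym_0:
  assumes "finite I" "\<And>j l. \<lbrakk>j \<in> I; l \<in> I; j \<noteq> l\<rbrakk> \<Longrightarrow> g j l = - g l j"
  shows "(\<Sum>j\<in>I. \<Sum>l\<in>I - {j}. g j l) = (0::'v)"
proof -
  define h where "h j l = (if j = l then 0 else g j l)" for j l
  have eq: "(\<Sum>l\<in>I - {j}. g j l) = (\<Sum>l\<in>I. h j l)" if "j \<in> I" for j
    using assms(1) that by (intro sum.mono_neutral_cong_left) (auto simp: h_def)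
  define S where "S = (\<Sum>j\<in>I. \<Sum>l\<in>I. h j l)"
  have "S = (\<Sum>l\<in>I. \<Sum>j\<in>I. h j l)" unfolding S_def by (rule sum.swap)
  also have "\<dots> = (\<Sum>l\<in>I. \<Sum>j\<in>I. - h l j)"
  proof (intro sum.cong refl)
    show "h j l = - h l j" if "l \<in> I" "j \<in> I" for l j
      using assms(2)[OF that(2,1)] unfolding h_def by (cases "j = l") auto
  qed
  also have "\<dots> = - S" by (simp add: S_def sum_negf)
  finally have "S + S = 0" by (simp only: eq_neg_iff_add_eq_0)
  moreover have "smul H (1 + 1) S = S + S" by (subst scale_left_distrib) simp
  ultimately have "S = 0" by simp
  then show ?thesis using eq by (simp add: S_def)
qed

text \<open>Interior multiplication by the \<open>B j\<close>, the counterpart of the exterior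
  multiplication in \<open>koszul_diff\<close>; it lowers the degree by one.\<close>

definition koszul_homotopy :: "nat \<Rightarrow> (nat \<Rightarrow> 'v \<Rightarrow> 'v) \<Rightarrow> (nat set \<Rightarrow> 'v) \<Rightarrow> nat set \<Rightarrow> 'v" where
  "koszul_homotopy d B x = (\<lambda>I. if I \<subseteq> {1..d}
     then \<Sum>j\<in>{1..d} - I. smul H (koszul_sign I j) (B j (x (insert j I))) else 0)"

lemma koszul_diff_eq:
  "I \<subseteq> {1..d} \<Longrightarrow> koszul_diff d H T x I = (\<Sum>j\<in>I. smul H (koszul_sign I j) (T j (x (I - {j}))))"
  by (simp add: koszul_diff_def koszul_sign_def)

lemma op_smul_sum:
  assumes "T \<in> bounded_ops H H" "\<And>j. j \<in> J \<Longrightarrow> f j \<in> vecs H"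
  shows "T (\<Sum>j\<in>J. smul H (c j) (f j)) = (\<Sum>j\<in>J. smul H (c j) (T (f j)))"
  using assms by (subst self.bounded_ops_sum[OF assms(1)]) (auto simp: bounded_ops_smul[OF assms(1)])

lemma koszul_diff_diff:
  assumes T: "\<And>j. j \<in> {1..d} \<Longrightarrow> T j \<in> bounded_ops H H"
    and comm: "\<And>i j. \<lbrakk>i \<in> {1..d}; j \<in> {1..d}\<rbrakk> \<Longrightarrow> T i \<circ> T j = T j \<circ> T i"
    and x: "\<And>I. x I \<in> vecs H"
  shows "koszul_diff d H T (koszul_diff d H T x) = 0"
proof
  fix I
  show "koszul_diff d H T (koszul_diff d H T x) I = 0 I"
  proof (cases "I \<subseteq> {1..d}")
    case True
    then have fin: "finite I" by (rule finite_subset) simp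
    have in_d: "j \<in> {1..d}" if "j \<in> I" for j using True that by blast
    have "koszul_diff d H T (koszul_diff d H T x) I =
      (\<Sum>j\<in>I. smul H (koszul_sign I j)
         (T j (\<Sum>l\<in>I - {j}. smul H (koszul_sign (I - {j}) l) (T l (x (I - {j} - {l}))))))"
      unfolding koszul_diff_eq[OF True] using True
      by (intro sum.cong refl arg_cong2[where f = "smul H"] arg_cong[where f = "T _"] koszul_diff_eq) auto
    also have "\<dots> = (\<Sum>j\<in>I. \<Sum>l\<in>I - {j}. smul H (koszul_sign I j * koszul_sign (I - {j}) l)
         (T j (T l (x (I - {j} - {l})))))"
    proof (intro sum.cong refl)
      fix j assume j: "j \<in> I"
      have "T l (x (I - {j} - {l})) \<in> vecs H" if "l \<in> I - {j}" for l
        using that bounded_ops_vecs[OF T[OF in_d] x] by blast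
      then show "smul H (koszul_sign I j)
         (T j (\<Sum>l\<in>I - {j}. smul H (koszul_sign (I - {j}) l) (T l (x (I - {j} - {l}))))) =
        (\<Sum>l\<in>I - {j}. smul H (koszul_sign I j * koszul_sign (I - {j}) l) (T j (T l (x (I - {j} - {l})))))"
        by (subst op_smul_sum[OF T[OF in_d[OF j]]]) (blast, simp add: scale_sum_right)
    qed
    also have "\<dots> = 0"
    proof (rule sum_antisym_0[OF fin])
      fix j l assume jl: "j \<in> I" "l \<in> I" "j \<noteq> l"
      have "T j (T l (x (I - {j} - {l}))) = T l (T j (x (I - {l} - {j})))"
        using comm[of j l] in_d jl by (simp add: fun_eq_iff Diff_insert2[symmetric] insert_commute flip: Diff_insert)
      moreover have "koszul_sign I j * koszul_sign (I - {j}) l = - (koszul_sign I l * koszul_sign (I - {l}) j)"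
        using jl fin order_sign_swap[of j l] by (simp add: koszul_sign_minus)
      ultimately show "smul H (koszul_sign I j * koszul_sign (I - {j}) l) (T j (T l (x (I - {j} - {l})))) =
        - smul H (koszul_sign I l * koszul_sign (I - {l}) j) (T l (T j (x (I - {l} - {j}))))"
        by simp
    qed
    finally show ?thesis by simp
  qed (simp add: koszul_diff_def)
qed

text \<open>A Cartan formula for exterior and interior multiplication. The two composites produce
  the off-diagonal terms with opposite signs; the diagonal terms with \<open>j\<close> in
  \<open>I\<close> come from one composite, those with \<open>j\<close> outside \<open>I\<close>
  from the other.\<close>

lemma koszul_homotopy_identity:
  assumes T: "\<And>j. j \<in> {1..d} \<Longrightarrow> T j \<in> bounded_ops H H"
    and B: "\<And>j. j \<in> {1..d} \<Longrightarrow> B j \<in> bounded_ops H H"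
    and comm: "\<And>i j. \<lbrakk>i \<in> {1..d}; j \<in> {1..d}\<rbrakk> \<Longrightarrow> B i \<circ> T j = T j \<circ> B i"
    and x: "\<And>I. x I \<in> vecs H"
    and I: "I \<subseteq> {1..d}"
  shows "koszul_diff d H T (koszul_homotopy d B x) I + koszul_homotopy d B (koszul_diff d H T x) I =
    (\<Sum>j\<in>{1..d}. B j (T j (x I)))"
proof -
  let ?A = "{1..d}"
  have fin: "finite I" using I by (rule finite_subset) simp
  have in_d: "j \<in> ?A" if "j \<in> I" for j using I that by blast
  have Bx: "B j (x J) \<in> vecs H" and Tx: "T j (x J) \<in> vecs H" if "j \<in> ?A" for j J
    using that bounded_ops_vecs[OF B x] bounded_ops_vecs[OF T x] by auto
  have TB: "T i (B j y) = B j (T i y)" if "i \<in> ?A" "j \<in> ?A" for i j y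
    using comm[OF that(2,1)] by (simp add: fun_eq_iff)
  \<comment> \<open>The term that exchanges \<open>l\<close> in \<open>I\<close> for
    \<open>j\<close> outside \<open>I\<close>, normalised so that one composite yields
    \<open>m j l\<close> and the other \<open>- m j l\<close>.\<close>
  define m where "m j l = smul H (koszul_sign I l * (koszul_sign I j * order_sign l j))
      (B j (T l (x (insert j (I - {l})))))" for j l
  have 1: "koszul_diff d H T (koszul_homotopy d B x) I =
    (\<Sum>l\<in>I. B l (T l (x I))) + (\<Sum>l\<in>I. \<Sum>j\<in>?A - I. m j l)"
  proof -
    have "smul H (koszul_sign I l) (T l (koszul_homotopy d B x (I - {l}))) =
      B l (T l (x I)) + (\<Sum>j\<in>?A - I. m j l)" if l: "l \<in> I" for l
    proof -
      have sub: "I - {l} \<subseteq> ?A" and set: "?A - (I - {l}) = insert l (?A - I)" using I l by auto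
      have "T l (koszul_homotopy d B x (I - {l})) =
        (\<Sum>j\<in>?A - (I - {l}). smul H (koszul_sign (I - {l}) j) (T l (B j (x (insert j (I - {l}))))))"
        unfolding koszul_homotopy_def using Bx
        by (simp only: sub if_True) (rule op_smul_sum[OF T[OF in_d[OF l]]], blast)
      also have "\<dots> = smul H (koszul_sign (I - {l}) l) (B l (T l (x I))) +
        (\<Sum>j\<in>?A - I. smul H (koszul_sign (I - {l}) j) (B j (T l (x (insert j (I - {l}))))))"
        unfolding set using l fin in_d[OF l]
        by (subst sum.insert) (auto simp: TB insert_absorb intro!: sum.cong)
      finally show ?thesis using l fin
        by (simp add: scale_right_distrib scale_sum_right m_def koszul_sign_minus mult_ac)
    qed
    then show ?thesis unfolding koszul_diff_eq[OF I] by (simp add: sum.distrib)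
  qed
  have 2: "koszul_homotopy d B (koszul_diff d H T x) I =
    (\<Sum>j\<in>?A - I. B j (T j (x I))) + (\<Sum>j\<in>?A - I. \<Sum>l\<in>I. - m j l)"
  proof -
    have "smul H (koszul_sign I j) (B j (koszul_diff d H T x (insert j I))) =
      B j (T j (x I)) + (\<Sum>l\<in>I. - m j l)" if j: "j \<in> ?A - I" for j
    proof -
      have sub: "insert j I \<subseteq> ?A" using I j by auto
      have "B j (koszul_diff d H T x (insert j I)) =
        (\<Sum>l\<in>insert j I. smul H (koszul_sign (insert j I) l) (B j (T l (x (insert j I - {l})))))"
        unfolding koszul_diff_eq[OF sub] using sub B[of j] j Tx by (subst op_smul_sum) auto
      also have "\<dots> = smul H (koszul_sign (insert j I) j) (B j (T j (x I))) +
        (\<Sum>l\<in>I. smul H (koszul_sign (insert j I) l) (B j (T l (x (insert j (I - {l}))))))"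
      proof -
        have "insert j I - {l} = insert j (I - {l})" if "l \<in> I" for l using j that by auto
        then show ?thesis using j fin by (subst sum.insert) (auto intro!: sum.cong)
      qed
      also have "(\<Sum>l\<in>I. smul H (koszul_sign (insert j I) l) (B j (T l (x (insert j (I - {l})))))) =
        (\<Sum>l\<in>I. smul H (koszul_sign I j) (- m j l))"
      proof (intro sum.cong refl)
        fix l assume l: "l \<in> I"
        then have "order_sign l j = - order_sign j l" using j by (intro order_sign_swap) auto
        then show "smul H (koszul_sign (insert j I) l) (B j (T l (x (insert j (I - {l}))))) =
          smul H (koszul_sign I j) (- m j l)"
          using j fin by (simp add: m_def koszul_sign_insert mult_ac)
      qed
      finally show ?thesis using j fin
        by (simp add: scale_right_distrib scale_sum_right koszul_sign_insert)
    qed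
    then show ?thesis using I by (simp add: koszul_homotopy_def sum.distrib)
  qed
  have "(\<Sum>j\<in>?A - I. \<Sum>l\<in>I. - m j l) = - (\<Sum>l\<in>I. \<Sum>j\<in>?A - I. m j l)"
    by (subst sum.swap) (simp add: sum_negf)
  moreover have "(\<Sum>j\<in>?A. B j (T j (x I))) = (\<Sum>l\<in>I. B l (T l (x I))) + (\<Sum>j\<in>?A - I. B j (T j (x I)))"
    using sum.subset_diff[OF I] by (simp add: add.commute)
  ultimately show ?thesis using 1 2 by simp
qed

text \<open>When the \<open>B j (T j x)\<close> add up to \<open>x\<close>, the homotopy identity
  reads \<open>dh + hd = 1\<close>, so a cocycle \<open>x\<close> equals \<open>d (h x)\<close>. The
  rest is bookkeeping of degrees.\<close>

lemma koszul_exactI: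
  assumes T: "\<And>j. j \<in> {1..d} \<Longrightarrow> T j \<in> bounded_ops H H"
    and B: "\<And>j. j \<in> {1..d} \<Longrightarrow> B j \<in> bounded_ops H H"
    and commT: "\<And>i j. \<lbrakk>i \<in> {1..d}; j \<in> {1..d}\<rbrakk> \<Longrightarrow> T i \<circ> T j = T j \<circ> T i"
    and commB: "\<And>i j. \<lbrakk>i \<in> {1..d}; j \<in> {1..d}\<rbrakk> \<Longrightarrow> B i \<circ> T j = T j \<circ> B i"
    and one: "\<And>x. x \<in> vecs H \<Longrightarrow> (\<Sum>j\<in>{1..d}. B j (T j x)) = x"
  shows "koszul_exact d H T"
  unfolding koszul_exact_def
proof (intro allI impI)
  fix p assume "p \<le> d"
  have chain_vecs: "x I \<in> vecs H" if "x \<in> koszul_cochains d H q" for x q I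
    using that unfolding koszul_cochains_def by (cases "I \<subseteq> {1..d} \<and> card I = q") (auto dest!: spec[of _ I])
  have chain_0: "x I = 0" if "x \<in> koszul_cochains d H q" "\<not> (I \<subseteq> {1..d} \<and> card I = q)" for x q I
    using that unfolding koszul_cochains_def by (auto dest!: spec[of _ I])
  have dh: "x = koszul_diff d H T (koszul_homotopy d B x)"
    if x: "x \<in> koszul_cochains d H q" and "koszul_diff d H T x = 0" for x q
  proof
    fix I
    show "x I = koszul_diff d H T (koszul_homotopy d B x) I"
    proof (cases "I \<subseteq> {1..d}")
      case True
      have "koszul_homotopy d B 0 I = 0"
        using B by (simp add: koszul_homotopy_def self.bounded_ops_0)
      then show ?thesis
        using koszul_homotopy_identity[where T = T and B = B and x = x, OF T B commB chain_vecs[OF x] True] one[OF chain_vecs[OF x]] that(2)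
        by simp
    qed (simp add: koszul_diff_def chain_0[OF x])
  qed
  show "{x \<in> koszul_cochains d H p. koszul_diff d H T x = 0} =
        (if p = 0 then {0} else koszul_diff d H T ` koszul_cochains d H (p - 1))"
  proof (cases "p = 0")
    case True
    have "x = 0" if x: "x \<in> koszul_cochains d H p" "koszul_diff d H T x = 0" for x
    proof
      fix I
      show "x I = 0 I"
      proof (cases "I = {}")
        case True
        \<comment> \<open>In degree zero \<open>x = d (h x)\<close> gives the claim at once, because
          at the empty set the differential is an empty sum.\<close>
        then show ?thesis using fun_cong[OF dh[OF x], of "{}"] by (simp add: koszul_diff_eq)
      next
        case False
        then have "\<not> (I \<subseteq> {1..d} \<and> card I = p)"
          using \<open>p = 0\<close> finite_subset[of I "{1..d}"] by auto
        then show ?thesis using chain_0[OF x(1)] by simp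
      qed
    qed
    moreover have "0 \<in> koszul_cochains d H p" by (simp add: koszul_cochains_def)
    moreover have "koszul_diff d H T 0 = 0"
    proof
      show "koszul_diff d H T 0 I = 0 I" for I
        using T unfolding koszul_diff_def by (auto intro!: sum.neutral simp: self.bounded_ops_0 subset_iff)
    qed
    ultimately show ?thesis using True by auto
  next
    case False
    have "koszul_homotopy d B x \<in> koszul_cochains d H (p - 1)" if x: "x \<in> koszul_cochains d H p" for x
      unfolding koszul_cochains_def
    proof (intro CollectI allI)
      fix I
      have "koszul_homotopy d B x I \<in> vecs H" if "I \<subseteq> {1..d}"
        using that chain_vecs[OF x] bounded_ops_vecs[OF B] by (auto simp: koszul_homotopy_def intro!: vecs_sum)
      moreover have "koszul_homotopy d B x I = 0" if "\<not> (I \<subseteq> {1..d} \<and> card I = p - 1)"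
      proof (cases "I \<subseteq> {1..d}")
        case True
        then have fin: "finite I" by (rule finite_subset) simp
        have "x (insert j I) = 0" if "j \<in> {1..d} - I" for j
          using that \<open>\<not> (I \<subseteq> {1..d} \<and> card I = p - 1)\<close> True fin by (intro chain_0[OF x]) auto
        then show ?thesis using B by (simp add: koszul_homotopy_def self.bounded_ops_0)
      qed (simp add: koszul_homotopy_def)
      ultimately show "if I \<subseteq> {1..d} \<and> card I = p - 1 then koszul_homotopy d B x I \<in> vecs H
        else koszul_homotopy d B x I = 0" by auto
    qed
    moreover have "koszul_diff d H T y \<in> koszul_cochains d H p" if y: "y \<in> koszul_cochains d H (p - 1)" for y
      unfolding koszul_cochains_def
    proof (intro CollectI allI)
      fix I
      have in_d: "T j \<in> bounded_ops H H" if "I \<subseteq> {1..d}" "j \<in> I" for j using T that by blast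
      have "koszul_diff d H T y I \<in> vecs H" if "I \<subseteq> {1..d}"
        using chain_vecs[OF y] bounded_ops_vecs[OF in_d[OF that]] that
        by (auto simp: koszul_diff_eq intro!: vecs_sum)
      moreover have "koszul_diff d H T y I = 0" if "\<not> (I \<subseteq> {1..d} \<and> card I = p)"
      proof (cases "I \<subseteq> {1..d}")
        case True
        then have fin: "finite I" by (rule finite_subset) simp
        have "y (I - {j}) = 0" if "j \<in> I" for j
          using that \<open>\<not> (I \<subseteq> {1..d} \<and> card I = p)\<close> True fin \<open>p \<noteq> 0\<close> card_Suc_Diff1[OF fin that]
          by (intro chain_0[OF y]) auto
        then show ?thesis using in_d[OF True] by (simp add: koszul_diff_eq[OF True] self.bounded_ops_0)
      qed (simp add: koszul_diff_def)
      ultimately show "if I \<subseteq> {1..d} \<and> card I = p then koszul_diff d H T y I \<in> vecs H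
        else koszul_diff d H T y I = 0" by auto
    qed
    moreover have "koszul_diff d H T (koszul_diff d H T y) = 0" if "y \<in> koszul_cochains d H (p - 1)" for y
      using T commT chain_vecs[OF that] by (rule koszul_diff_diff)
    ultimately show ?thesis using False dh by (auto intro!: image_eqI)
  qed
qed

end

section \<open>Polynomials and the symmetrized polydisc\<close>

lemma poly_eval_superset:
  assumes "finite B" "Poly_Mapping.keys f \<subseteq> B"
  shows "poly_eval d f z = (\<Sum>m\<in>B. Poly_Mapping.lookup f m * (\<Prod>i\<in>{1..d}. z i ^ Poly_Mapping.lookup m i))"
  unfolding poly_eval_def using assms by (intro sum.mono_neutral_left) (auto simp: in_keys_iff)

lemma poly_eval_add: "poly_eval d (f + g) z = poly_eval d f z + poly_eval d g z"
proof -
  let ?B = "Poly_Mapping.keys f \<union> Poly_Mapping.keys g"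
  have "finite ?B" by simp
  then show ?thesis
    using keys_add[of f g]
    by (simp add: poly_eval_superset[of ?B] lookup_add distrib_right sum.distrib)
qed

lemma poly_eval_single:
  "poly_eval d (Poly_Mapping.single m c) z = c * (\<Prod>i\<in>{1..d}. z i ^ Poly_Mapping.lookup m i)"
  by (subst poly_eval_superset[of "{m}"]) (auto simp: lookup_single)

lemma polys_add: "\<lbrakk>f \<in> polys d; g \<in> polys d\<rbrakk> \<Longrightarrow> f + g \<in> polys d"
  using keys_add[of f g] unfolding polys_def by blast

lemma polys_single: "Poly_Mapping.keys m \<subseteq> {1..d} \<Longrightarrow> Poly_Mapping.single m c \<in> polys d"
  by (auto simp: polys_def)

lemma prod_power_single:
  assumes "(i::nat) \<in> {1..d}"
  shows "(\<Prod>j\<in>{1..d}. z j ^ Poly_Mapping.lookup (Poly_Mapping.single i 1) j) = (z i :: complex)"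
proof -
  have "(\<Prod>j\<in>{1..d}. z j ^ Poly_Mapping.lookup (Poly_Mapping.single i 1) j) =
    (\<Prod>j\<in>{1..d}. if i = j then z j else 1)"
    by (intro prod.cong) (auto simp: lookup_single when_def)
  also have "\<dots> = (if i \<in> {1..d} then z i else 1)" by (rule prod.delta') simp
  also have "\<dots> = z i" using assms by simp
  finally show ?thesis .
qed

lemma keys_add_single: "Poly_Mapping.keys (m + Poly_Mapping.single i (1::nat)) \<subseteq> insert i (Poly_Mapping.keys m)"
  using keys_add[of m "Poly_Mapping.single i 1"] by auto

text \<open>Polynomial functions rather than polynomials, so that functions given by a recursion
  need not be written as explicit coefficient maps.\<close>

definition is_poly :: "nat \<Rightarrow> ((nat \<Rightarrow> complex) \<Rightarrow> complex) \<Rightarrow> bool" where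
  "is_poly d \<phi> \<longleftrightarrow> (\<exists>f\<in>polys d. \<forall>z. poly_eval d f z = \<phi> z)"

lemma is_poly_const: "is_poly d (\<lambda>_. c)"
  unfolding is_poly_def
  by (intro bexI[of _ "Poly_Mapping.single 0 c"]) (auto simp: poly_eval_single polys_single)

lemma is_poly_add: "\<lbrakk>is_poly d \<phi>; is_poly d \<psi>\<rbrakk> \<Longrightarrow> is_poly d (\<lambda>z. \<phi> z + \<psi> z)"
  unfolding is_poly_def by (metis polys_add poly_eval_add)

lemma is_poly_sum:
  "(\<And>i. i \<in> I \<Longrightarrow> is_poly d (\<phi> i)) \<Longrightarrow> is_poly d (\<lambda>z. \<Sum>i\<in>I. \<phi> i z)"
  by (induction I rule: infinite_finite_induct) (auto intro: is_poly_const is_poly_add)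

lemma is_poly_term:
  assumes "is_poly d \<phi>" "i \<in> {1..d}"
  shows "is_poly d (\<lambda>z. c * z i * \<phi> z)"
proof -
  obtain f where f: "f \<in> polys d" "\<And>z. poly_eval d f z = \<phi> z" using assms by (auto simp: is_poly_def)
  let ?X = "Poly_Mapping.single i (1::nat)"
  have "is_poly d (\<lambda>z. \<Sum>m\<in>Poly_Mapping.keys f.
      poly_eval d (Poly_Mapping.single (m + ?X) (c * Poly_Mapping.lookup f m)) z)"
  proof (rule is_poly_sum)
    fix m assume "m \<in> Poly_Mapping.keys f"
    then have "Poly_Mapping.keys m \<subseteq> {1..d}" using f(1) by (auto simp: polys_def)
    then have "Poly_Mapping.keys (m + ?X) \<subseteq> {1..d}" using keys_add_single[of m i] assms(2) by blast
    then show "is_poly d (poly_eval d (Poly_Mapping.single (m + ?X) (c * Poly_Mapping.lookup f m)))"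
      unfolding is_poly_def using polys_single by blast
  qed
  moreover have "(\<Sum>m\<in>Poly_Mapping.keys f.
      poly_eval d (Poly_Mapping.single (m + ?X) (c * Poly_Mapping.lookup f m)) z) = c * z i * \<phi> z" for z
  proof -
    have "poly_eval d (Poly_Mapping.single (m + ?X) (c * Poly_Mapping.lookup f m)) z =
      c * z i * (Poly_Mapping.lookup f m * (\<Prod>j\<in>{1..d}. z j ^ Poly_Mapping.lookup m j))" for m
      using prod_power_single[OF assms(2), of z]
      by (simp add: poly_eval_single lookup_add power_add prod.distrib mult_ac)
    then show ?thesis by (simp add: f(2)[symmetric] poly_eval_def sum_distrib_left)
  qed
  ultimately show ?thesis by simp
qed

section \<open>Bounds on the symmetrized polydisc\<close>

lemma Gamma_nonempty: "Gamma d \<noteq> {}"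
  unfolding Gamma_def by (auto intro!: exI[of _ "\<lambda>_. 0"])

text \<open>The constant counts all subsets of \<open>{1..d}\<close> rather than those of size
  \<open>k\<close>, so that one bound serves every coordinate.\<close>

lemma cmod_esym_le:
  assumes "\<And>j. j \<in> {1..d} \<Longrightarrow> cmod (z j) \<le> 1"
  shows "cmod (esym d k z) \<le> 2 ^ d"
proof -
  have "cmod (esym d k z) \<le> (\<Sum>X | X \<subseteq> {1..d} \<and> card X = k. cmod (\<Prod>j\<in>X. z j))"
    unfolding esym_def by (rule norm_sum)
  also have "\<dots> \<le> (\<Sum>X | X \<subseteq> {1..d} \<and> card X = k. 1)"
  proof (rule sum_mono)
    fix X assume "X \<in> {X. X \<subseteq> {1..d} \<and> card X = k}"
    then show "cmod (\<Prod>j\<in>X. z j) \<le> 1"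
      unfolding prod_norm[symmetric] using assms by (intro prod_le_1) auto
  qed
  also have "\<dots> \<le> (\<Sum>X\<in>Pow {1..d}. 1)" by (rule sum_mono2) auto
  also have "\<dots> = 2 ^ d" by (simp add: card_Pow)
  finally show ?thesis .
qed

lemma cmod_Gamma_le: "w \<in> Gamma d \<Longrightarrow> i \<in> {1..d} \<Longrightarrow> cmod (w i) \<le> 2 ^ d"
  unfolding Gamma_def using cmod_esym_le by auto

lemma esym_last: "esym d d z = (\<Prod>j\<in>{1..d}. z j)"
proof -
  have "{X. X \<subseteq> {1..d} \<and> card X = d} = {{1..d}}"
    using card_subset_eq[of "{1..d}"] by auto
  then show ?thesis by (simp add: esym_def)
qed

lemma esym_0: "esym d 0 z = 1"
proof -
  have "{X. X \<subseteq> {1..d} \<and> card X = 0} = {{}}" using finite_subset[of _ "{1..d}"] by auto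
  then show ?thesis by (simp add: esym_def)
qed

text \<open>Without boundedness the supremum in \<open>contractive_hilbert_module\<close> would be
  an unspecified number and give no estimate.\<close>

lemma poly_eval_bdd: "bdd_above ((\<lambda>z. cmod (poly_eval d f z)) ` Gamma d)"
proof (rule bdd_aboveI2)
  fix z assume z: "z \<in> Gamma d"
  have "cmod (poly_eval d f z) \<le> (\<Sum>m\<in>Poly_Mapping.keys f.
      cmod (Poly_Mapping.lookup f m * (\<Prod>i\<in>{1..d}. z i ^ Poly_Mapping.lookup m i)))"
    unfolding poly_eval_def by (rule norm_sum)
  also have "\<dots> \<le> (\<Sum>m\<in>Poly_Mapping.keys f.
      cmod (Poly_Mapping.lookup f m) * (\<Prod>i\<in>{1..d}. (2 ^ d) ^ Poly_Mapping.lookup m i))"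
    unfolding norm_mult prod_norm[symmetric] norm_power
    using cmod_Gamma_le[OF z] by (intro sum_mono mult_left_mono prod_mono conjI power_mono) auto
  finally show "cmod (poly_eval d f z) \<le> (\<Sum>m\<in>Poly_Mapping.keys f.
      cmod (Poly_Mapping.lookup f m) * (\<Prod>i\<in>{1..d}. (2 ^ d) ^ Poly_Mapping.lookup m i))" .
qed

lemma poly_eval_le_SUP:
  "w \<in> Gamma d \<Longrightarrow> cmod (poly_eval d f w) \<le> (SUP z\<in>Gamma d. cmod (poly_eval d f z))"
  by (rule cSUP_upper[OF _ poly_eval_bdd])

lemma SUP_poly_eval_nonneg: "0 \<le> (SUP z\<in>Gamma d. cmod (poly_eval d f z))"
  using Gamma_nonempty[of d] poly_eval_le_SUP[of _ d f] norm_ge_zero order_trans by (metis ex_in_conv)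

text \<open>Induction over the set \<open>B\<close> of coordinates still allowed inside the disc:
  with the others fixed, the one-variable maximum principle pushes coordinate \<open>b\<close> onto
  the circle.\<close>

lemma maximum_modulus_polydisc:
  assumes "finite A"
    and hol: "\<And>z j. j \<in> A \<Longrightarrow> (\<lambda>t. f (z(j := t))) holomorphic_on UNIV"
    and bd: "\<And>z. (\<And>j. j \<in> A \<Longrightarrow> cmod (z j) = 1) \<Longrightarrow> cmod (f z) \<le> M"
    and z: "\<And>j. j \<in> A \<Longrightarrow> cmod (z j) \<le> 1"
  shows "cmod (f z) \<le> M"
proof -
  have "B \<subseteq> A \<Longrightarrow> (\<And>j. j \<in> A - B \<Longrightarrow> cmod (z j) = 1) \<Longrightarrow> (\<And>j. j \<in> B \<Longrightarrow> cmod (z j) \<le> 1) \<Longrightarrow>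
    cmod (f z) \<le> M" if "finite B" for B z
    using that
  proof (induction B arbitrary: z)
    case empty
    then show ?case by (intro bd) auto
  next
    case (insert b B)
    define g where "g t = f (z(b := t))" for t
    have g: "g holomorphic_on UNIV" using hol[of b z] insert.prems(1) by (simp add: g_def[abs_def])
    have "cmod (g (z b)) \<le> M"
    proof (rule maximum_modulus_frontier[where f = g and \<xi> = "z b" and S = "cball 0 1"])
      show "g holomorphic_on interior (cball 0 1)" using g holomorphic_on_subset by blast
      show "continuous_on (closure (cball 0 1)) g"
        using g holomorphic_on_imp_continuous_on continuous_on_subset by blast
      show "cmod (g t) \<le> M" if "t \<in> frontier (cball 0 1)" for t
        unfolding g_def using that insert.prems insert.hyps
        by (intro insert.IH) (auto simp: frontier_cball)
    qed (use insert.prems in auto)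
    then show ?case by (simp add: g_def)
  qed
  from this[OF assms(1), of z] show ?thesis using z by simp
qed

lemma esym_holomorphic: "(\<lambda>t. esym d k (z(j := t))) holomorphic_on UNIV"
proof -
  have "(\<lambda>t. (z(j := t)) l) holomorphic_on UNIV" for l
    by (cases "l = j") (auto intro: holomorphic_intros)
  then show ?thesis unfolding esym_def by (intro holomorphic_on_sum holomorphic_on_prod)
qed

text \<open>On the torus the inverse of \<open>z j\<close> is its conjugate, so the product over a
  set is the full product times the conjugate of the product over the complement.\<close>

lemma esym_complement:
  assumes z: "\<And>j. j \<in> {1..d} \<Longrightarrow> cmod (z j) = 1" and "i \<le> d"
  shows "esym d (d - i) z = cnj (esym d i z) * esym d d z"
proof -
  let ?A = "{1..d}"
  have "esym d (d - i) z = (\<Sum>Y | Y \<subseteq> ?A \<and> card Y = i. \<Prod>j\<in>?A - Y. z j)"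
    unfolding esym_def
  proof (rule sum.reindex_bij_witness[where i = "\<lambda>Y. ?A - Y" and j = "\<lambda>X. ?A - X"])
    fix X assume "X \<in> {X. X \<subseteq> ?A \<and> card X = d - i}"
    then show "?A - X \<in> {Y. Y \<subseteq> ?A \<and> card Y = i}" "?A - (?A - X) = X" "(\<Prod>j\<in>?A - (?A - X). z j) = (\<Prod>j\<in>X. z j)"
      using \<open>i \<le> d\<close> finite_subset[of X ?A] by (auto simp: card_Diff_subset double_diff)
  next
    fix Y assume "Y \<in> {Y. Y \<subseteq> ?A \<and> card Y = i}"
    then show "?A - (?A - Y) = Y" "?A - Y \<in> {X. X \<subseteq> ?A \<and> card X = d - i}"
      using finite_subset[of Y ?A] by (auto simp: card_Diff_subset)
  qed
  also have "\<dots> = (\<Sum>Y | Y \<subseteq> ?A \<and> card Y = i. cnj (\<Prod>j\<in>Y. z j) * (\<Prod>j\<in>?A. z j))"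
  proof (rule sum.cong[OF refl])
    fix Y assume "Y \<in> {Y. Y \<subseteq> ?A \<and> card Y = i}"
    then have Y: "Y \<subseteq> ?A" by simp
    have "(\<Prod>j\<in>?A. z j) = (\<Prod>j\<in>?A - Y. z j) * (\<Prod>j\<in>Y. z j)"
      using prod.subset_diff[OF Y] by simp
    moreover have "cnj (\<Prod>j\<in>Y. z j) * (\<Prod>j\<in>Y. z j) = 1"
    proof -
      have "cnj (z j) * z j = 1" if "j \<in> Y" for j
        using z[of j] Y that complex_norm_square[of "z j"] by (auto simp: mult.commute)
      then show ?thesis by (simp flip: prod.distrib)
    qed
    ultimately show "(\<Prod>j\<in>?A - Y. z j) = cnj (\<Prod>j\<in>Y. z j) * (\<Prod>j\<in>?A. z j)"
      by (simp add: mult_ac)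
  qed
  also have "\<dots> = cnj (esym d i z) * esym d d z"
    by (simp add: esym_last sum_distrib_right) (simp add: esym_def sum_distrib_right)
  finally show ?thesis .
qed

text \<open>On the torus \<open>s\<^bsub>d-i\<^esub> = cnj s\<^sub>i p\<close>, so the polynomial below has modulus
  \<open>\<bar>1 + 2 \<i> Im (l cnj s\<^sub>i)\<bar>\<close> there: its deviation from \<open>1\<close> is of second order in \<open>l\<close>.\<close>

lemma Gamma_second_order_bound:
  assumes w: "w \<in> Gamma d" and i: "i \<in> {1..d - 1}"
  shows "cmod (w d + l * w (d - i) - cnj l * (w d * w i)) \<le> sqrt (1 + 4 * (cmod l * 2 ^ d)\<^sup>2)"
proof -
  obtain z where z: "\<And>j. j \<in> {1..d} \<Longrightarrow> cmod (z j) \<le> 1" and wz: "w = restrict (\<lambda>k. esym d k z) {1..d}"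
    using w unfolding Gamma_def by blast
  define f where "f z = esym d d z + l * esym d (d - i) z - cnj l * (esym d d z * esym d i z)" for z
  have "cmod (f z) \<le> sqrt (1 + 4 * (cmod l * 2 ^ d)\<^sup>2)"
  proof (rule maximum_modulus_polydisc[where A = "{1..d}" and f = f])
    show "(\<lambda>t. f (z(j := t))) holomorphic_on UNIV" for z j
      unfolding f_def by (intro holomorphic_intros esym_holomorphic)
    fix z assume z: "\<And>j. j \<in> {1..d} \<Longrightarrow> cmod (z j) = 1"
    define u where "u = l * cnj (esym d i z)"
    have "esym d (d - i) z = cnj (esym d i z) * esym d d z"
      using z i by (intro esym_complement) auto
    then have "f z = esym d d z * (1 + (u - cnj u))" by (simp add: f_def u_def algebra_simps)
    moreover have "cmod (esym d d z) = 1"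
      using z by (simp add: esym_last flip: prod_norm)
    ultimately have "cmod (f z) = cmod (1 + (u - cnj u))" by (simp add: norm_mult)
    also have "\<dots> = sqrt (1 + 4 * (Im u)\<^sup>2)"
      by (simp add: cmod_def power2_eq_square)
    also have "\<dots> \<le> sqrt (1 + 4 * (cmod l * 2 ^ d)\<^sup>2)"
    proof -
      have "\<bar>Im u\<bar> \<le> cmod u" by (rule abs_Im_le_cmod)
      also have "\<dots> \<le> cmod l * 2 ^ d"
        unfolding u_def norm_mult using cmod_esym_le[of d z i] z by (simp add: mult_left_mono)
      finally have "\<bar>Im u\<bar> \<le> \<bar>cmod l * 2 ^ d\<bar>" by simp
      then show ?thesis by (simp only: abs_le_square_iff) simp
    qed
    finally show "cmod (f z) \<le> sqrt (1 + 4 * (cmod l * 2 ^ d)\<^sup>2)" .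
  qed (use z in auto)
  moreover have "1 \<le> d - i" "1 \<le> i" "i \<le> d" "1 \<le> d" using i by auto
  ultimately show ?thesis by (simp add: f_def wz)
qed

text \<open>The generating series \<open>1 - w\<^sub>1 t + w\<^sub>2 t\<^sup>2 - \<dots>\<close>; at \<open>w = (e\<^sub>1, \<dots>, e\<^sub>d)\<close> the coefficients
  of its inverse are the complete homogeneous symmetric polynomials.\<close>

definition esym_fps :: "nat \<Rightarrow> (nat \<Rightarrow> complex) \<Rightarrow> complex fps" where
  "esym_fps d w = Abs_fps (\<lambda>i. if i = 0 then 1 else if i \<le> d then (- 1) ^ i * w i else 0)"

text \<open>Comparing coefficients in \<open>E * inverse E = 1\<close> expresses the coefficient at
  \<open>n\<close> by earlier ones; the constant term \<open>1\<close> keeps the recursion free of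
  division.\<close>

lemma is_poly_inverse_esym_fps: "is_poly d (\<lambda>w. fps_nth (inverse (esym_fps d w)) n)"
proof (induction n rule: less_induct)
  case (less n)
  have E0: "fps_nth (esym_fps d w) 0 = 1" for w by (simp add: esym_fps_def)
  show ?case
  proof (cases "n = 0")
    case True
    then show ?thesis using E0 by (simp add: is_poly_const)
  next
    case False
    have rec: "fps_nth (inverse (esym_fps d w)) n =
      (\<Sum>i\<in>{1..n}. (if i \<le> d then - ((- 1) ^ i) * w i else 0) * fps_nth (inverse (esym_fps d w)) (n - i))" for w
    proof -
      have "esym_fps d w * inverse (esym_fps d w) = 1"
        using E0 inverse_mult_eq_1'[of "esym_fps d w"] by simp
      then have "(\<Sum>i=0..n. fps_nth (esym_fps d w) i * fps_nth (inverse (esym_fps d w)) (n - i)) = 0"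
        using False by (simp add: fps_eq_iff fps_mult_nth)
      moreover have "(\<Sum>i=0..n. fps_nth (esym_fps d w) i * fps_nth (inverse (esym_fps d w)) (n - i)) =
        fps_nth (inverse (esym_fps d w)) n +
        (\<Sum>i\<in>{1..n}. fps_nth (esym_fps d w) i * fps_nth (inverse (esym_fps d w)) (n - i))"
        by (simp add: sum.atLeast_Suc_atMost E0)
      ultimately have "fps_nth (inverse (esym_fps d w)) n =
        - (\<Sum>i\<in>{1..n}. fps_nth (esym_fps d w) i * fps_nth (inverse (esym_fps d w)) (n - i))"
        by (simp add: eq_neg_iff_add_eq_0)
      also have "\<dots> = (\<Sum>i\<in>{1..n}. (if i \<le> d then - ((- 1) ^ i) * w i else 0) * fps_nth (inverse (esym_fps d w)) (n - i))"
        unfolding sum_negf[symmetric] by (intro sum.cong) (auto simp: esym_fps_def)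
      finally show ?thesis .
    qed
    show ?thesis unfolding rec
    proof (rule is_poly_sum)
      fix i assume i: "i \<in> {1..n}"
      show "is_poly d (\<lambda>w. (if i \<le> d then - ((- 1) ^ i) * w i else 0) * fps_nth (inverse (esym_fps d w)) (n - i))"
      proof (cases "i \<le> d")
        case True
        then show ?thesis
          using is_poly_term[OF less.IH, of "n - i" i "- ((- 1) ^ i)"] i False by auto
      qed (simp add: is_poly_const)
    qed
  qed
qed

lemma sum_Pow_card:
  fixes g :: "'a set \<Rightarrow> complex"
  assumes "finite A"
  shows "(\<Sum>B\<in>Pow A. if card B = i then g B else 0) = (\<Sum>B | B \<subseteq> A \<and> card B = i. g B)"
  using assms by (subst sum.inter_filter[symmetric]) (auto intro!: sum.cong)

lemma prod_neg_esym:
  "(\<Sum>B | B \<subseteq> {1..d} \<and> card B = i. \<Prod>j\<in>B. - z j) = (- 1) ^ i * esym d i z"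
  unfolding esym_def sum_distrib_left
  by (intro sum.cong refl) (auto simp: prod_uminus)

text \<open>Vieta's formulas, for the reversed polynomial whose zeros are the reciprocals of the
  nonzero \<open>z j\<close>.\<close>

lemma esym_fps_roots:
  assumes w: "\<And>i. i \<in> {1..d} \<Longrightarrow> w i = esym d i z"
  shows "esym_fps d w = fps_of_poly (\<Prod>j\<in>{1..d}. [:1, - z j:])"
proof (rule fps_ext)
  fix i
  have "(\<Prod>j\<in>{1..d}. [:1, - z j:]) = (\<Prod>j\<in>{1..d}. monom (- z j) 1 + 1)"
    by (intro prod.cong) (auto simp: monom_altdef one_pCons)
  also have "\<dots> = (\<Sum>B\<in>Pow {1..d}. (\<Prod>j\<in>B. monom (- z j) 1))"
    by (subst prod_add) auto
  also have "\<dots> = (\<Sum>B\<in>Pow {1..d}. monom (\<Prod>j\<in>B. - z j) (card B))"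
  proof (intro sum.cong refl)
    fix B :: "nat set" assume "B \<in> Pow {1..d}"
    then have "finite B" using finite_subset by blast
    then show "(\<Prod>j\<in>B. monom (- z j) 1) = monom (\<Prod>j\<in>B. - z j) (card B)"
      by (induction B rule: finite_induct) (auto simp: mult_monom)
  qed
  finally have "coeff (\<Prod>j\<in>{1..d}. [:1, - z j:]) i = (\<Sum>B\<in>Pow {1..d}. if card B = i then \<Prod>j\<in>B. - z j else 0)"
    by (simp add: coeff_sum)
  also have "\<dots> = (- 1) ^ i * esym d i z"
    by (simp only: sum_Pow_card[OF finite_atLeastAtMost] prod_neg_esym)
  finally have c: "coeff (\<Prod>j\<in>{1..d}. [:1, - z j:]) i = (- 1) ^ i * esym d i z" .
  have "esym d i z = 0" if "i > d"
  proof -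
    have "card X \<le> d" if "X \<subseteq> {1..d}" for X using card_mono[OF _ that] by simp
    then have "{X. X \<subseteq> {1..d} \<and> card X = i} = {}" using \<open>i > d\<close> by (auto simp: not_less[symmetric])
    then show ?thesis unfolding esym_def by (simp only: sum.empty)
  qed
  then show "fps_nth (esym_fps d w) i = fps_nth (fps_of_poly (\<Prod>j\<in>{1..d}. [:1, - z j:])) i"
    using w[of i] c esym_0[of d z] by (cases "i = 0"; cases "i \<le> d") (simp_all add: esym_fps_def)
qed

lemma inverse_one_minus_fps: "inverse (1 - fps_const c * fps_X) = Abs_fps (\<lambda>n. (c::complex) ^ n)"
proof (rule fps_inverse_unique, rule fps_ext)
  fix n
  show "fps_nth ((1 - fps_const c * fps_X) * Abs_fps (\<lambda>n. c ^ n)) n = fps_nth 1 n"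
    by (cases n) (simp_all add: algebra_simps)
qed

text \<open>Each factor \<open>1 / (1 - z j t)\<close> has coefficients of modulus at most
  \<open>1\<close>, so the product is dominated coefficientwise by \<open>1 / (1 - t)^d\<close>, a
  bound independent of the point of \<open>Gamma d\<close>.\<close>

lemma cmod_inverse_esym_fps_le:
  assumes w: "w \<in> Gamma d"
  shows "cmod (fps_nth (inverse (esym_fps d w)) n) \<le> fps_nth (Abs_fps (\<lambda>n. 1) ^ d) n"
proof -
  obtain z where z: "\<And>j. j \<in> {1..d} \<Longrightarrow> cmod (z j) \<le> 1" and wz: "w = restrict (\<lambda>k. esym d k z) {1..d}"
    using w unfolding Gamma_def by blast
  have inv: "inverse (\<Prod>j\<in>A. 1 - fps_const (z j) * fps_X) = (\<Prod>j\<in>A. Abs_fps (\<lambda>n. z j ^ n))" if "finite A" for A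
    using that by (induction A rule: finite_induct) (simp_all add: fps_inverse_mult inverse_one_minus_fps)
  have lin: "fps_of_poly [:1, - c:] = 1 - fps_const c * fps_X" for c :: complex
    by (rule fps_ext) (auto simp: coeff_pCons split: nat.splits)
  have "esym_fps d w = (\<Prod>j\<in>{1..d}. 1 - fps_const (z j) * fps_X)"
    by (subst esym_fps_roots[where z = z]) (simp_all add: wz fps_of_poly_prod lin)
  then have eq: "inverse (esym_fps d w) = (\<Prod>j\<in>{1..d}. Abs_fps (\<lambda>n. z j ^ n))"
    using inv by simp
  have "cmod (fps_nth (\<Prod>j\<in>A. Abs_fps (\<lambda>n. z j ^ n)) n) \<le> fps_nth (Abs_fps (\<lambda>n. 1) ^ card A) n"
    if "finite A" "A \<subseteq> {1..d}" for A n
    using that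
  proof (induction A arbitrary: n rule: finite_induct)
    case (insert j A)
    have "cmod (fps_nth (\<Prod>j\<in>insert j A. Abs_fps (\<lambda>n. z j ^ n)) n) \<le>
      (\<Sum>i=0..n. cmod (z j ^ i * fps_nth (\<Prod>j\<in>A. Abs_fps (\<lambda>n. z j ^ n)) (n - i)))"
      using insert.hyps by (simp add: fps_mult_nth norm_sum)
    also have "\<dots> \<le> (\<Sum>i=0..n. 1 * fps_nth (Abs_fps (\<lambda>n. 1) ^ card A) (n - i))"
      unfolding norm_mult norm_power using z[of j] insert
      by (intro sum_mono mult_mono power_le_one) auto
    also have "\<dots> = fps_nth (Abs_fps (\<lambda>n. 1) ^ card (insert j A)) n"
      using insert.hyps by (simp add: fps_mult_nth)
    finally show ?case .
  qed auto
  from this[of "{1..d}"] show ?thesis by (simp add: eq)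
qed

text \<open>By the fundamental theorem of algebra: the \<open>z j\<close> are the roots of
  \<open>t^d - w 1 t^(d-1) + ...\<close>. A point of the polynomial hull can therefore be tested
  through its roots.\<close>

lemma esym_surj:
  obtains z where "\<And>i. i \<in> {1..d} \<Longrightarrow> w i = esym d i z"
proof -
  define v where "v i = (if i = 0 then 1 else w i)" for i
  define p where "p = (\<Sum>i\<le>d. monom ((- 1) ^ i * v i) (d - i))"
  have coeff_p: "coeff p (d - i) = (- 1) ^ i * v i" if "i \<le> d" for i
  proof -
    have "coeff p (d - i) = (\<Sum>k\<le>d. if d - k = d - i then (- 1) ^ k * v k else 0)"
      by (simp add: p_def coeff_sum)
    also have "\<dots> = (\<Sum>k\<le>d. if k = i then (- 1) ^ k * v k else 0)"
      using that by (intro sum.cong) auto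
    also have "\<dots> = (- 1) ^ i * v i" using that by simp
    finally show ?thesis .
  qed
  have "degree p \<le> d" unfolding p_def
    by (intro degree_sum_le) (auto intro: order_trans[OF degree_monom_le])
  moreover have cd: "coeff p d = 1" using coeff_p[of 0] by (simp add: v_def)
  ultimately have deg: "degree p = d" by (metis le_antisym le_degree zero_neq_one)
  obtain root where root: "smult (lead_coeff p) (\<Prod>i<degree p. [:- root i, 1:]) = p"
    by (rule complex_poly_decompose')
  define z where "z j = root (j - 1)" for j
  have "p = (\<Prod>i<d. [:- root i, 1:])" using root deg cd by simp
  also have "\<dots> = (\<Prod>j\<in>{1..d}. [:- z j, 1:])"
    by (rule prod.reindex_bij_witness[where i = "\<lambda>j. j - 1" and j = Suc]) (auto simp: z_def)
  also have "\<dots> = (\<Prod>j\<in>{1..d}. [:- z j:] + monom 1 1)"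
    by (intro prod.cong) (auto simp: monom_altdef)
  also have "\<dots> = (\<Sum>B\<in>Pow {1..d}. (\<Prod>j\<in>B. [:- z j:]) * (\<Prod>j\<in>{1..d} - B. monom 1 1))"
    by (rule prod_add) simp
  also have "\<dots> = (\<Sum>B\<in>Pow {1..d}. monom (\<Prod>j\<in>B. - z j) (d - card B))"
  proof (intro sum.cong refl)
    fix B :: "nat set" assume B: "B \<in> Pow {1..d}"
    then have fin: "finite B" using finite_subset by blast
    then have "(\<Prod>j\<in>B. [:- z j:]) = [:\<Prod>j\<in>B. - z j:]"
      by (induction B rule: finite_induct) (auto simp: one_pCons)
    moreover have "card ({1..d} - B) = d - card B" using B fin by (simp add: card_Diff_subset)
    ultimately show "(\<Prod>j\<in>B. [:- z j:]) * (\<Prod>j\<in>{1..d} - B. monom 1 1) = monom (\<Prod>j\<in>B. - z j) (d - card B)"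
      by (simp add: monom_power smult_monom)
  qed
  finally have p: "p = \<dots>" .
  have "w i = esym d i z" if i: "i \<in> {1..d}" for i
  proof -
    have "(- 1) ^ i * w i = coeff p (d - i)" using coeff_p[of i] i by (simp add: v_def)
    also have "\<dots> = (\<Sum>B\<in>Pow {1..d}. if d - card B = d - i then \<Prod>j\<in>B. - z j else 0)"
      by (simp add: p coeff_sum)
    also have "\<dots> = (\<Sum>B\<in>Pow {1..d}. if card B = i then \<Prod>j\<in>B. - z j else 0)"
    proof (intro sum.cong refl)
      fix B :: "nat set" assume "B \<in> Pow {1..d}"
      then have "card B \<le> d" using card_mono[of "{1..d}" B] by simp
      then show "(if d - card B = d - i then \<Prod>j\<in>B. - z j else 0) = (if card B = i then \<Prod>j\<in>B. - z j else 0)"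
        using i by auto
    qed
    also have "\<dots> = (- 1) ^ i * esym d i z" by (simp only: sum_Pow_card[OF finite_atLeastAtMost] prod_neg_esym)
    finally show ?thesis by simp
  qed
  then show thesis by (rule that)
qed

text \<open>If \<open>cmod (z j) > 1\<close>, then \<open>t = 1 / z j\<close> is a zero of the
  generating polynomial inside the unit disc. The coefficient bounds, inherited from
  \<open>Gamma d\<close> through the hypothesis, force the inverse series to converge there,
  although the product of the two values has to be \<open>1\<close>.\<close>

lemma Gamma_polynomially_convex:
  assumes w: "w \<in> extensional {1..d}"
    and le: "\<And>f. f \<in> polys d \<Longrightarrow> cmod (poly_eval d f w) \<le> (SUP z\<in>Gamma d. cmod (poly_eval d f z))"
  shows "w \<in> Gamma d"
proof -
  obtain z where z: "\<And>i. i \<in> {1..d} \<Longrightarrow> w i = esym d i z" using esym_surj[of d w] by metis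
  have coeff_le: "cmod (fps_nth (inverse (esym_fps d w)) n) \<le> fps_nth (Abs_fps (\<lambda>n. 1) ^ d) n" for n
  proof -
    obtain f where f: "f \<in> polys d" "\<And>w. poly_eval d f w = fps_nth (inverse (esym_fps d w)) n"
      using is_poly_inverse_esym_fps[of d n] by (auto simp: is_poly_def)
    have "(SUP z\<in>Gamma d. cmod (poly_eval d f z)) \<le> fps_nth (Abs_fps (\<lambda>n. 1) ^ d) n"
      using cmod_inverse_esym_fps_le by (intro cSUP_least Gamma_nonempty) (simp add: f(2))
    then show ?thesis using le[OF f(1)] by (simp add: f(2))
  qed
  have "cmod (z j) \<le> 1" if j: "j \<in> {1..d}" for j
  proof (rule ccontr)
    assume "\<not> cmod (z j) \<le> 1"
    then have zj: "cmod (z j) > 1" "z j \<noteq> 0" by auto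
    define t where "t = 1 / z j"
    have t: "cmod t < 1" using zj by (simp add: t_def norm_divide)
    \<comment> \<open>An intermediate radius: summability at \<open>r\<close> gives convergence
      radius at least \<open>r\<close>, hence strictly more than \<open>cmod t\<close>.\<close>
    obtain r where r: "cmod t < r" "r < 1" using dense[OF t] by blast
    have r0: "r > 0" using r norm_ge_zero[of t] by linarith
    let ?G = "Abs_fps (\<lambda>n. 1 :: real)"
    have "1 \<le> fps_conv_radius ?G"
      unfolding fps_conv_radius_def
    proof (rule conv_radius_geI_ex)
      fix r :: real assume "0 < r" "ereal r < 1"
      then show "\<exists>z. norm z = r \<and> summable (\<lambda>n. fps_nth ?G n * z ^ n)"
        by (intro exI[of _ r]) (simp add: one_ereal_def summable_geometric)
    qed
    then have "1 \<le> fps_conv_radius (?G ^ d)" using fps_conv_radius_power[of ?G d] by (rule order_trans)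
    then have "summable (\<lambda>n. norm (fps_nth (?G ^ d) n * r ^ n))"
      using r r0 by (intro norm_summable_fps) (auto intro: less_le_trans[of _ 1])
    then have "summable (\<lambda>n. fps_nth (inverse (esym_fps d w)) n * of_real r ^ n)"
    proof (rule summable_comparison_test'[where N = 0])
      fix n :: nat
      have "norm (fps_nth (inverse (esym_fps d w)) n * of_real r ^ n) \<le> fps_nth (?G ^ d) n * r ^ n"
        using r0 coeff_le[of n] by (simp add: norm_mult norm_power mult_right_mono)
      then show "norm (fps_nth (inverse (esym_fps d w)) n * of_real r ^ n) \<le> norm (fps_nth (?G ^ d) n * r ^ n)"
        by simp
    qed
    from conv_radius_geI[OF this] have "ereal r \<le> fps_conv_radius (inverse (esym_fps d w))"
      using r0 by (simp add: fps_conv_radius_def)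
    then have rad: "ereal (cmod t) < fps_conv_radius (inverse (esym_fps d w))"
      using r by (auto intro: less_le_trans[of _ "ereal r"])
    have E: "esym_fps d w = fps_of_poly (\<Prod>j\<in>{1..d}. [:1, - z j:])" by (rule esym_fps_roots[OF z])
    have "1 = eval_fps (esym_fps d w * inverse (esym_fps d w)) t"
      by (subst inverse_mult_eq_1') (auto simp: esym_fps_def)
    also have "\<dots> = eval_fps (esym_fps d w) t * eval_fps (inverse (esym_fps d w)) t"
      using rad by (intro eval_fps_mult) (simp_all add: E)
    also have "eval_fps (esym_fps d w) t = (\<Prod>j\<in>{1..d}. 1 - t * z j)"
      by (simp add: E poly_prod)
    also have "\<dots> = 0" using j zj by (intro prod_zero) (auto simp: t_def intro!: bexI[of _ j])
    finally show False by simp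
  qed
  then show ?thesis unfolding Gamma_def
    using z w by (intro CollectI exI[of _ z]) (auto simp: extensional_def fun_eq_iff)
qed

section \<open>The unitary extension of a contraction\<close>

lemma (in pre_hilbert) Re_ip_eq:
  assumes "x \<in> vecs H" "y \<in> vecs H"
  shows "Re (ip H x y) = ((hnorm H (x + y))\<^sup>2 - (hnorm H x)\<^sup>2 - (hnorm H y)\<^sup>2) / 2"
  using hnorm_add_sq[OF assms] by simp

lemma (in pre_hilbert) Im_ip_eq:
  assumes "x \<in> vecs H" "y \<in> vecs H"
  shows "Im (ip H x y) = Re (ip H x (smul H \<i> y))"
  using assms by (simp add: ip_smul_right)

text \<open>The vector \<open>k\<close> of an abstract unitary extension \<open>(K, U)\<close> with embedding \<open>J\<close> is represented
  by the backward orbit \<open>(J\<^sup>* U\<^sup>n k)\<^sub>n\<close> of \<open>P\<^sup>*\<close>.\<close>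

locale contraction = H: hilbert_space H for H :: "'a::ab_group_add hspace" +
  fixes P Q :: "'a \<Rightarrow> 'a"
  assumes P: "P \<in> bounded_ops H H"
    and P_le: "x \<in> vecs H \<Longrightarrow> hnorm H (P x) \<le> hnorm H x"
    and sot_Q: "sot_limit H (adj_powers H P) Q"
begin

sublocale HH: hilbert_pair H H by (rule H.hilbert_pair_self)

abbreviation Ps :: "'a \<Rightarrow> 'a" where "Ps \<equiv> adj H H P"

lemma Ps: "Ps \<in> bounded_ops H H"
  by (rule HH.adj_bounded_ops[OF P])

lemmas P_vecs [simp] = bounded_ops_vecs[OF P] and Ps_vecs [simp] = bounded_ops_vecs[OF Ps]

lemma Ps_le: "x \<in> vecs H \<Longrightarrow> hnorm H (Ps x) \<le> hnorm H x"
  using HH.hnorm_adj_le[OF P, of x 1] P_le by simp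

lemma P_pow_vecs [simp]: "x \<in> vecs H \<Longrightarrow> (P ^^ n) x \<in> vecs H"
  by (induction n) auto

lemma Ps_pow_vecs [simp]: "x \<in> vecs H \<Longrightarrow> (Ps ^^ n) x \<in> vecs H"
  by (induction n) auto

lemma Ps_pow_diff:
  "\<lbrakk>x \<in> vecs H; y \<in> vecs H\<rbrakk> \<Longrightarrow> (Ps ^^ n) (x - y) = (Ps ^^ n) x - (Ps ^^ n) y"
  by (induction n) (auto simp: HH.bounded_ops_diff[OF Ps])

lemma P_pow_le: "x \<in> vecs H \<Longrightarrow> hnorm H ((P ^^ n) x) \<le> hnorm H x"
  by (induction n) (auto intro: order_trans[OF P_le])

lemma Ps_pow_le: "x \<in> vecs H \<Longrightarrow> hnorm H ((Ps ^^ n) x) \<le> hnorm H x"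
  by (induction n) (auto intro: order_trans[OF Ps_le])

lemma ip_P_pow: "\<lbrakk>x \<in> vecs H; y \<in> vecs H\<rbrakk> \<Longrightarrow> ip H ((P ^^ n) x) y = ip H x ((Ps ^^ n) y)"
proof (induction n arbitrary: y)
  case (Suc n)
  then show ?case by (simp add: HH.ip_adj[OF P] funpow_swap1[of Ps])
qed simp

definition K :: "(nat \<Rightarrow> 'a) hspace" where
  "K = \<lparr>vecs = {k. (\<forall>n. k n \<in> vecs H) \<and> (\<forall>n. Ps (k (Suc n)) = k n) \<and> (\<exists>C. \<forall>n. hnorm H (k n) \<le> C)},
     smul = (\<lambda>c k n. smul H c (k n)), ip = (\<lambda>k l. lim (\<lambda>n. ip H (k n) (l n)))\<rparr>"

lemma K_vecs_iff:
  "k \<in> vecs K \<longleftrightarrow> (\<forall>n. k n \<in> vecs H) \<and> (\<forall>n. Ps (k (Suc n)) = k n) \<and> (\<exists>C. \<forall>n. hnorm H (k n) \<le> C)"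
  by (simp add: K_def)

lemma smul_K: "smul K c k = (\<lambda>n. smul H c (k n))"
  by (simp add: K_def)

lemma ip_K: "ip K k l = lim (\<lambda>n. ip H (k n) (l n))"
  by (simp add: K_def)

lemma K_vecsD [simp]: "k \<in> vecs K \<Longrightarrow> k n \<in> vecs H" "k \<in> vecs K \<Longrightarrow> Ps (k (Suc n)) = k n"
  by (auto simp: K_vecs_iff)

lemma K_bounded:
  assumes "k \<in> vecs K"
  obtains C where "\<And>n. hnorm H (k n) \<le> C"
  using assms unfolding K_vecs_iff by blast

lemma Ps_pow_orbit: "k \<in> vecs K \<Longrightarrow> (Ps ^^ l) (k (m + l)) = k m"
  by (induction l) (auto simp: funpow_swap1)

lemma orbit_norm_mono: "k \<in> vecs K \<Longrightarrow> m \<le> n \<Longrightarrow> hnorm H (k m) \<le> hnorm H (k n)"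
  using Ps_pow_orbit[of k "n - m" m] Ps_pow_le[of "k n" "n - m"] by simp

text \<open>The cross term in the expanded square is exactly \<open>|k m|^2\<close>, because
  \<open>Ps\<close> takes \<open>k (m + l)\<close> back to \<open>k m\<close> in \<open>l\<close>
  steps.\<close>

lemma orbit_defect:
  assumes k: "k \<in> vecs K"
  shows "(hnorm H ((P ^^ l) (k m) - k (m + l)))\<^sup>2 \<le> (hnorm H (k (m + l)))\<^sup>2 - (hnorm H (k m))\<^sup>2"
proof -
  have "ip H ((P ^^ l) (k m)) (k (m + l)) = ip H (k m) (k m)"
    using k by (simp add: ip_P_pow Ps_pow_orbit)
  then have "Re (ip H ((P ^^ l) (k m)) (k (m + l))) = (hnorm H (k m))\<^sup>2"
    using k by (simp add: H.hnorm_sq)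
  moreover have "(hnorm H ((P ^^ l) (k m)))\<^sup>2 \<le> (hnorm H (k m))\<^sup>2"
    using k P_pow_le by (simp add: power_mono)
  ultimately show ?thesis using k H.hnorm_diff_sq[of "(P ^^ l) (k m)" "k (m + l)"] by simp
qed

lemma K_add: assumes "k \<in> vecs K" "l \<in> vecs K" shows "k + l \<in> vecs K"
proof -
  obtain C where "\<And>n. hnorm H (k n) \<le> C" using K_bounded[OF assms(1)] by blast
  moreover obtain D where "\<And>n. hnorm H (l n) \<le> D" using K_bounded[OF assms(2)] by blast
  ultimately have "hnorm H (k n + l n) \<le> C + D" for n
    using H.hnorm_triangle[of "k n" "l n"] assms K_vecsD(1) add_mono order_trans by meson
  then show ?thesis using assms
    unfolding K_vecs_iff[of "k + l"] by (auto simp: bounded_ops_add[OF Ps])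
qed

lemma K_smul: assumes "k \<in> vecs K" shows "smul K c k \<in> vecs K"
proof -
  obtain C where "\<And>n. hnorm H (k n) \<le> C" using K_bounded[OF assms] by blast
  then have "hnorm H (smul H c (k n)) \<le> cmod c * C" for n
    using assms by (simp add: H.hnorm_smul mult_left_mono)
  then show ?thesis using assms
    unfolding K_vecs_iff[of "smul K c k"] by (auto simp: smul_K bounded_ops_smul[OF Ps])
qed

lemma K_0: "0 \<in> vecs K"
  by (auto simp: K_vecs_iff HH.bounded_ops_0[OF Ps])

lemma convergent_norm_sq: assumes k: "k \<in> vecs K" shows "convergent (\<lambda>n. (hnorm H (k n))\<^sup>2)"
proof (rule Bseq_monoseq_convergent)
  obtain C where C: "\<And>n. hnorm H (k n) \<le> C" using K_bounded[OF k] by blast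
  have "norm ((hnorm H (k n))\<^sup>2) \<le> C\<^sup>2" for n
    using C[of n] k by (simp add: power_mono)
  then show "Bseq (\<lambda>n. (hnorm H (k n))\<^sup>2)" by (rule BseqI')
  show "monoseq (\<lambda>n. (hnorm H (k n))\<^sup>2)"
    using orbit_norm_mono[OF k] k by (auto simp: monoseq_def intro!: power_mono)
qed

text \<open>Squared norms along an orbit are increasing and bounded. Inner products then converge
  because their real and imaginary parts are combinations of such squared norms.\<close>

lemma ip_K_tendsto:
  assumes "k \<in> vecs K" "l \<in> vecs K"
  shows "(\<lambda>n. ip H (k n) (l n)) \<longlonglongrightarrow> ip K k l"
proof -
  have re: "convergent (\<lambda>n. Re (ip H (k n) (l n)))" if "l \<in> vecs K" for l
  proof -
    have *: "Re (ip H (k n) (l n)) = ((hnorm H ((k + l) n))\<^sup>2 - (hnorm H (k n))\<^sup>2 - (hnorm H (l n))\<^sup>2) / 2" for n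
      using H.Re_ip_eq[of "k n" "l n"] assms(1) that by simp
    have "convergent (\<lambda>n. ((hnorm H ((k + l) n))\<^sup>2 - (hnorm H (k n))\<^sup>2 - (hnorm H (l n))\<^sup>2) / 2)"
      unfolding divide_inverse
      by (intro convergent_mult convergent_diff convergent_norm_sq K_add assms(1) that convergent_const)
    then show ?thesis by (simp only: *)
  qed
  have "convergent (\<lambda>n. Im (ip H (k n) (l n)))"
  proof -
    have *: "Im (ip H (k n) (l n)) = Re (ip H (k n) (smul K \<i> l n))" for n
      unfolding smul_K by (rule H.Im_ip_eq) (use assms in simp_all)
    show ?thesis unfolding * by (rule re[OF K_smul[OF assms(2)]])
  qed
  then obtain a b where "(\<lambda>n. Re (ip H (k n) (l n))) \<longlonglongrightarrow> a" "(\<lambda>n. Im (ip H (k n) (l n))) \<longlonglongrightarrow> b"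
    using re[OF assms(2)] unfolding convergent_def by blast
  from tendsto_Complex[OF this] have lim: "(\<lambda>n. ip H (k n) (l n)) \<longlonglongrightarrow> Complex a b"
    by simp
  then show ?thesis using limI[OF lim] by (simp add: ip_K)
qed

lemma pre_hilbert_K: "pre_hilbert K"
proof -
  have vs: "vector_space (smul K)"
    by unfold_locales (auto simp: smul_K fun_eq_iff H.scale_right_distrib H.scale_left_distrib)
  interpret vector_space "smul K" by (rule vs)
  show ?thesis
  proof
    show "subspace (vecs K)" by (auto simp: subspace_def intro: K_add K_smul K_0)
    show "ip K y x = cnj (ip K x y)" if xy: "x \<in> vecs K" "y \<in> vecs K" for x y
    proof (rule LIMSEQ_unique[OF ip_K_tendsto[OF xy(2,1)]])
      have "(\<lambda>n. cnj (ip H (x n) (y n))) \<longlonglongrightarrow> cnj (ip K x y)"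
        by (intro tendsto_cnj ip_K_tendsto xy)
      moreover have "cnj (ip H (x n) (y n)) = ip H (y n) (x n)" for n
        using xy by (intro H.ip_cnj[symmetric]) auto
      ultimately show "(\<lambda>n. ip H (y n) (x n)) \<longlonglongrightarrow> cnj (ip K x y)" by simp
    qed
    show "ip K (x + y) z = ip K x z + ip K y z" if xyz: "x \<in> vecs K" "y \<in> vecs K" "z \<in> vecs K" for x y z
    proof (rule LIMSEQ_unique[OF ip_K_tendsto[OF K_add[OF xyz(1,2)] xyz(3)]])
      have "(\<lambda>n. ip H (x n) (z n) + ip H (y n) (z n)) \<longlonglongrightarrow> ip K x z + ip K y z"
        by (intro tendsto_add ip_K_tendsto xyz)
      then show "(\<lambda>n. ip H ((x + y) n) (z n)) \<longlonglongrightarrow> ip K x z + ip K y z"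
        using xyz by (simp add: H.ip_add)
    qed
    show "ip K (smul K c x) y = c * ip K x y" if xy: "x \<in> vecs K" "y \<in> vecs K" for x y c
    proof (rule LIMSEQ_unique[OF ip_K_tendsto[OF K_smul[OF xy(1)] xy(2)]])
      have "(\<lambda>n. c * ip H (x n) (y n)) \<longlonglongrightarrow> c * ip K x y"
        by (intro tendsto_mult_left ip_K_tendsto xy)
      then show "(\<lambda>n. ip H (smul K c x n) (y n)) \<longlonglongrightarrow> c * ip K x y"
        using xy by (simp add: H.ip_smul smul_K)
    qed
    have re: "(\<lambda>n. Re (ip H (x n) (x n))) \<longlonglongrightarrow> Re (ip K x x)" if x: "x \<in> vecs K" for x
      by (intro tendsto_Re ip_K_tendsto x)
    show "0 \<le> Re (ip K x x)" if x: "x \<in> vecs K" for x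
      using re[OF x] by (rule LIMSEQ_le_const) (use H.ip_nonneg x in auto)
    show "x = 0" if x: "x \<in> vecs K" and "ip K x x = 0" for x
    proof
      fix n
      \<comment> \<open>The norms along an orbit increase, so a vanishing limit forces every member
        to vanish.\<close>
      have "incseq (\<lambda>n. (hnorm H (x n))\<^sup>2)"
        using orbit_norm_mono[OF x] x by (auto simp: incseq_def intro!: power_mono)
      moreover have "(\<lambda>n. (hnorm H (x n))\<^sup>2) \<longlonglongrightarrow> 0"
        using re[OF x] that(2) x by (simp add: H.hnorm_sq)
      ultimately have "(hnorm H (x n))\<^sup>2 \<le> 0" by (rule incseq_le)
      then show "x n = 0 n" using x by simp
    qed
  qed
qed

lemma hnorm_K_tendsto:
  assumes "k \<in> vecs K"
  shows "(\<lambda>n. hnorm H (k n)) \<longlonglongrightarrow> hnorm K k"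
  unfolding hnorm_def by (intro tendsto_intros ip_K_tendsto assms)

lemma hnorm_le_K:
  assumes "k \<in> vecs K"
  shows "hnorm H (k n) \<le> hnorm K k"
  by (rule incseq_le[OF _ hnorm_K_tendsto[OF assms]]) (use orbit_norm_mono[OF assms] in \<open>auto simp: incseq_def\<close>)

lemma hnorm_K_le:
  assumes "k \<in> vecs K" "\<And>n. hnorm H (k n) \<le> C"
  shows "hnorm K k \<le> C"
  using hnorm_K_tendsto[OF assms(1)] by (rule LIMSEQ_le_const2) (use assms(2) in auto)

text \<open>The coordinate maps are contractions, so a Cauchy sequence converges in each coordinate;
  the estimate \<open>near\<close> is uniform in the coordinate and therefore passes to the norm of
  \<open>K\<close>.\<close>

lemma hilbert_space_K: "hilbert_space K"
proof -
  interpret KP: pre_hilbert K by (rule pre_hilbert_K)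
  have "Metric_space.mcomplete (vecs K) (hdist K)"
    unfolding KP.metric.mcomplete_def
  proof (intro allI impI)
    fix X assume "Metric_space.MCauchy (vecs K) (hdist K) X"
    then have X: "\<And>m. X m \<in> vecs K"
      and Cau: "\<And>e. 0 < e \<Longrightarrow> \<exists>N. \<forall>m\<ge>N. \<forall>n\<ge>N. hnorm K (X m - X n) < e"
      unfolding KP.MCauchy_iff by auto
    have pt: "hnorm H (X m j - X n j) \<le> hnorm K (X m - X n)" for m n j
      using hnorm_le_K[of "X m - X n" j] X by simp
    have "\<exists>y. y \<in> vecs H \<and> (\<lambda>m. hnorm H (X m j - y)) \<longlonglongrightarrow> 0" for j
    proof (rule H.Cauchy_converges)
      show "X m j \<in> vecs H" for m using X by simp
      show "\<exists>N. \<forall>m\<ge>N. \<forall>n\<ge>N. hnorm H (X m j - X n j) < e" if "0 < e" for e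
        using Cau[OF that] pt by (meson le_less_trans)
    qed blast
    then obtain l where l: "\<And>j. l j \<in> vecs H" "\<And>j. (\<lambda>m. hnorm H (X m j - l j)) \<longlonglongrightarrow> 0" by metis
    have near: "hnorm H (X m j - l j) \<le> e" if "\<And>n. n \<ge> N \<Longrightarrow> hnorm K (X m - X n) \<le> e" for m j e N
    proof -
      have "(\<lambda>n. hnorm H (X m j - X n j - (X m j - l j))) \<longlonglongrightarrow> 0"
        by (rule H.tendsto_diff_vecs) (use X l in auto)
      then have "(\<lambda>n. hnorm H (X m j - X n j)) \<longlonglongrightarrow> hnorm H (X m j - l j)"
        using X l by (intro H.tendsto_norm) auto
      then show ?thesis by (rule LIMSEQ_le_const2) (use pt that order_trans in blast)
    qed
    have lK: "l \<in> vecs K"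
    proof -
      have "Ps (l (Suc j)) = l j" for j
      proof (rule H.limit_unique[of "\<lambda>m. X m j"])
        have "(\<lambda>m. hnorm H (Ps (X m (Suc j)) - Ps (l (Suc j)))) \<longlonglongrightarrow> 0"
          by (rule HH.tendsto_op[OF Ps]) (use X l in auto)
        then show "(\<lambda>m. hnorm H (X m j - Ps (l (Suc j)))) \<longlonglongrightarrow> 0" using X by simp
      qed (use X l in auto)
      moreover have "\<exists>C. \<forall>j. hnorm H (l j) \<le> C"
      proof -
        obtain N where N: "\<And>n. n \<ge> N \<Longrightarrow> hnorm K (X N - X n) \<le> 1" using Cau[of 1] by force
        have "hnorm H (l j) \<le> hnorm K (X N) + 1" for j
          using near[of N N 1 j, OF N] H.hnorm_reverse_triangle[of "X N j" "l j"] X[of N] l(1)[of j]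
            hnorm_le_K[OF X[of N], of j] by simp
        then show ?thesis by blast
      qed
      ultimately show ?thesis using l(1) unfolding K_vecs_iff[of l] by blast
    qed
    have "(\<lambda>m. hnorm K (X m - l)) \<longlonglongrightarrow> 0"
    proof (rule LIMSEQ_I)
      fix r :: real assume r: "0 < r"
      obtain N where N: "\<And>m n. m \<ge> N \<Longrightarrow> n \<ge> N \<Longrightarrow> hnorm K (X m - X n) < r / 2"
        using Cau[of "r / 2"] r by auto
      have "hnorm K (X m - l) \<le> r / 2" if "m \<ge> N" for m
        using near[of N m "r / 2"] N[OF that] X lK by (intro hnorm_K_le) (auto intro: less_imp_le)
      then show "\<exists>N. \<forall>m\<ge>N. norm (hnorm K (X m - l) - 0) < r"
        using r X lK by (intro exI[of _ N]) (force intro: le_less_trans)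
    qed
    then show "\<exists>l. limitin (Metric_space.mtopology (vecs K) (hdist K)) X l sequentially"
      using KP.limitin_iff[of X l] X lK by (auto simp: htopology_def)
  qed
  then show ?thesis
    by (intro hilbert_space.intro hilbert_space_axioms.intro KP.vector_space_axioms)
      (assumption | rule KP.vecs_subspace KP.ip_cnj KP.ip_add KP.ip_smul KP.ip_nonneg KP.ip_definite)+
qed

sublocale K: hilbert_space K
  by (rule hilbert_space_K)

sublocale KK: hilbert_pair K K
  by (rule K.hilbert_pair_self)

sublocale HK: hilbert_pair H K ..

sublocale KH: hilbert_pair K H ..

text \<open>The common error term of the approximations: the root is the bound of
  \<open>orbit_defect_le\<close>, and \<open>c\<close> leaves room for an operator norm.\<close>

lemma orbit_gap_tendsto:
  assumes "k \<in> vecs K"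
  shows "(\<lambda>m. c * sqrt ((hnorm K k)\<^sup>2 - (hnorm H (k m))\<^sup>2)) \<longlonglongrightarrow> 0"
proof -
  have "(\<lambda>m. c * sqrt ((hnorm K k)\<^sup>2 - (hnorm H (k m))\<^sup>2)) \<longlonglongrightarrow> c * sqrt ((hnorm K k)\<^sup>2 - (hnorm K k)\<^sup>2)"
    by (intro tendsto_intros hnorm_K_tendsto assms)
  then show ?thesis by simp
qed

lemma orbit_defect_le:
  assumes k: "k \<in> vecs K"
  shows "hnorm H ((P ^^ l) (k m) - k (m + l)) \<le> sqrt ((hnorm K k)\<^sup>2 - (hnorm H (k m))\<^sup>2)"
proof (rule real_le_rsqrt)
  have "(hnorm H (k (m + l)))\<^sup>2 \<le> (hnorm K k)\<^sup>2"
    using k hnorm_le_K by (simp add: power_mono)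
  then show "(hnorm H ((P ^^ l) (k m) - k (m + l)))\<^sup>2 \<le> (hnorm K k)\<^sup>2 - (hnorm H (k m))\<^sup>2"
    using orbit_defect[OF k, of l m] by linarith
qed

subsection \<open>The limit of \<open>P\<^sup>*\<^sup>nP\<^sup>n\<close>\<close>

lemma Q: "Q \<in> bounded_ops H H"
  using sot_Q by (simp add: sot_limit_def)

lemmas Q_vecs [simp] = bounded_ops_vecs[OF Q]

lemma adj_powers_vecs [simp]: "x \<in> vecs H \<Longrightarrow> adj_powers H P n x \<in> vecs H"
  by (simp add: adj_powers_def)

lemma Q_lim: "x \<in> vecs H \<Longrightarrow> (\<lambda>n. hnorm H (adj_powers H P n x - Q x)) \<longlonglongrightarrow> 0"
  using sot_Q H.limitin_iff[of "\<lambda>n. adj_powers H P n x" "Q x"] by (simp add: sot_limit_def)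

lemma Q_le: "x \<in> vecs H \<Longrightarrow> hnorm H (Q x) \<le> hnorm H x"
proof -
  assume x: "x \<in> vecs H"
  have "(\<lambda>n. hnorm H (adj_powers H P n x)) \<longlonglongrightarrow> hnorm H (Q x)"
    using x Q_lim[OF x] by (intro H.tendsto_norm) auto
  moreover have "hnorm H (adj_powers H P n x) \<le> hnorm H x" for n
    using Ps_pow_le[of "(P ^^ n) x" n] P_pow_le[OF x, of n] x by (simp add: adj_powers_def)
  ultimately show ?thesis by (intro LIMSEQ_le_const2) auto
qed

lemma Ps_Q_P: "x \<in> vecs H \<Longrightarrow> Ps (Q (P x)) = Q x"
proof -
  assume x: "x \<in> vecs H"
  have "(\<lambda>n. hnorm H (Ps (adj_powers H P n (P x)) - Ps (Q (P x)))) \<longlonglongrightarrow> 0"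
    using x Q_lim[of "P x"] by (intro HH.tendsto_op[OF Ps]) auto
  moreover have "Ps (adj_powers H P n (P x)) = adj_powers H P (Suc n) x" for n
    by (simp add: adj_powers_def funpow_swap1)
  ultimately have "(\<lambda>n. hnorm H (adj_powers H P (Suc n) x - Ps (Q (P x)))) \<longlonglongrightarrow> 0" by simp
  then show ?thesis
    using x LIMSEQ_Suc[OF Q_lim[OF x]] by (intro H.limit_unique[of "\<lambda>n. adj_powers H P (Suc n) x"]) auto
qed

lemma ip_Q_tendsto: "x \<in> vecs H \<Longrightarrow> (\<lambda>n. (hnorm H ((P ^^ n) x))\<^sup>2) \<longlonglongrightarrow> Re (ip H (Q x) x)"
proof -
  assume x: "x \<in> vecs H"
  have "(\<lambda>n. ip H (adj_powers H P n x) x) \<longlonglongrightarrow> ip H (Q x) x"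
    using x Q_lim[OF x] by (intro H.tendsto_ip) auto
  moreover have "Re (ip H (adj_powers H P n x) x) = (hnorm H ((P ^^ n) x))\<^sup>2" for n
  proof -
    have "ip H x (adj_powers H P n x) = ip H ((P ^^ n) x) ((P ^^ n) x)"
      using x by (simp add: adj_powers_def ip_P_pow)
    then show ?thesis using x H.ip_cnj[of x "adj_powers H P n x"] by (simp add: H.hnorm_sq)
  qed
  ultimately show ?thesis using tendsto_Re by fastforce
qed

text \<open>With \<open>y = P^m x\<close> one has
  \<open>|y - Ps^l P^l y|^2 <= |y|^2 - |P^l y|^2\<close>. As \<open>l\<close> grows, the right side
  tends to \<open>|P^m x|^2 - lim |P^n x|^2\<close>, which is small for large
  \<open>m\<close>.\<close>

lemma P_pow_sub_Q_tendsto: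
  assumes x: "x \<in> vecs H"
  shows "(\<lambda>m. hnorm H ((P ^^ m) x - Q ((P ^^ m) x))) \<longlonglongrightarrow> 0"
proof -
  define q where "q = Re (ip H (Q x) x)"
  have lim: "(\<lambda>n. (hnorm H ((P ^^ n) x))\<^sup>2) \<longlonglongrightarrow> q" unfolding q_def by (rule ip_Q_tendsto[OF x])
  have le: "(hnorm H ((P ^^ m) x - Q ((P ^^ m) x)))\<^sup>2 \<le> (hnorm H ((P ^^ m) x))\<^sup>2 - q" for m
  proof (rule LIMSEQ_le)
    define y where "y = (P ^^ m) x"
    have y: "y \<in> vecs H" using x by (simp add: y_def)
    have "(\<lambda>l. hnorm H (y - adj_powers H P l y - (y - Q y))) \<longlonglongrightarrow> 0"
      using y Q_lim[OF y] by (intro H.tendsto_diff_vecs) auto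
    then show "(\<lambda>l. (hnorm H (y - adj_powers H P l y))\<^sup>2) \<longlonglongrightarrow> (hnorm H ((P ^^ m) x - Q ((P ^^ m) x)))\<^sup>2"
      unfolding y_def[symmetric] using y by (intro tendsto_power H.tendsto_norm) auto
    show "(\<lambda>l. (hnorm H ((P ^^ m) x))\<^sup>2 - (hnorm H ((P ^^ (l + m)) x))\<^sup>2) \<longlonglongrightarrow> (hnorm H ((P ^^ m) x))\<^sup>2 - q"
      by (intro tendsto_intros LIMSEQ_ignore_initial_segment[OF lim])
    have "(hnorm H (y - adj_powers H P l y))\<^sup>2 \<le> (hnorm H y)\<^sup>2 - (hnorm H ((P ^^ l) y))\<^sup>2" for l
    proof -
      have "ip H y (adj_powers H P l y) = ip H ((P ^^ l) y) ((P ^^ l) y)"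
        using y by (simp add: adj_powers_def ip_P_pow)
      moreover have "(hnorm H (adj_powers H P l y))\<^sup>2 \<le> (hnorm H ((P ^^ l) y))\<^sup>2"
        using y Ps_pow_le by (simp add: adj_powers_def power_mono)
      ultimately show ?thesis
        using y H.hnorm_diff_sq[of y "adj_powers H P l y"] by (simp add: H.hnorm_sq)
    qed
    then show "\<exists>N. \<forall>l\<ge>N. (hnorm H (y - adj_powers H P l y))\<^sup>2 \<le> (hnorm H ((P ^^ m) x))\<^sup>2 - (hnorm H ((P ^^ (l + m)) x))\<^sup>2"
      by (simp add: y_def funpow_add)
  qed
  have "(\<lambda>m. (hnorm H ((P ^^ m) x - Q ((P ^^ m) x)))\<^sup>2) \<longlonglongrightarrow> 0"
  proof (rule Lim_null_comparison)
    show "\<forall>\<^sub>F m in sequentially. norm ((hnorm H ((P ^^ m) x - Q ((P ^^ m) x)))\<^sup>2) \<le> (hnorm H ((P ^^ m) x))\<^sup>2 - q"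
      using le by simp
    show "(\<lambda>m. (hnorm H ((P ^^ m) x))\<^sup>2 - q) \<longlonglongrightarrow> 0"
      using tendsto_diff[OF lim tendsto_const[of q]] by simp
  qed
  from tendsto_real_sqrt[OF this] show ?thesis using x by simp
qed

subsection \<open>Asymptotic representation of vectors and operators\<close>

text \<open>Sequences such as \<open>P^m h\<close> or \<open>T (k m)\<close> are in general not
  backward orbits of \<open>Ps\<close>; this relation names the vector of \<open>K\<close> that they
  stand for, coordinate \<open>m\<close> being compared with \<open>k m = J* U^m k\<close>.\<close>

definition approx :: "(nat \<Rightarrow> 'a) \<Rightarrow> (nat \<Rightarrow> 'a) \<Rightarrow> bool" where
  "approx x k \<longleftrightarrow> (\<forall>m. x m \<in> vecs H) \<and> k \<in> vecs K \<and> (\<lambda>m. hnorm H (x m - k m)) \<longlonglongrightarrow> 0"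

lemma approxD:
  assumes "approx x k"
  shows "x m \<in> vecs H" "k \<in> vecs K" "(\<lambda>m. hnorm H (x m - k m)) \<longlonglongrightarrow> 0"
  using assms by (auto simp: approx_def)

lemma approx_self: "k \<in> vecs K \<Longrightarrow> approx k k"
  by (auto simp: approx_def)

lemma approx_cong_tendsto:
  assumes "approx x k" "\<And>m. y m \<in> vecs H" "(\<lambda>m. hnorm H (y m - x m)) \<longlonglongrightarrow> 0"
  shows "approx y k"
  unfolding approx_def
proof (intro conjI allI)
  note x = approxD[OF assms(1)]
  show "(\<lambda>m. hnorm H (y m - k m)) \<longlonglongrightarrow> 0"
  proof (rule Lim_null_comparison)
    show "\<forall>\<^sub>F m in sequentially. norm (hnorm H (y m - k m)) \<le> hnorm H (y m - x m) + hnorm H (x m - k m)"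
      using x assms(2) H.hnorm_diff_triangle by simp
    show "(\<lambda>m. hnorm H (y m - x m) + hnorm H (x m - k m)) \<longlonglongrightarrow> 0"
      using tendsto_add[OF assms(3) x(3)] by simp
  qed
qed (use assms approxD(2) in auto)

lemma approx_add:
  assumes "approx x k" "approx y l"
  shows "approx (\<lambda>m. x m + y m) (k + l)"
  unfolding approx_def
proof (intro conjI allI)
  note x = approxD[OF assms(1)] and y = approxD[OF assms(2)]
  show "(\<lambda>m. hnorm H (x m + y m - (k + l) m)) \<longlonglongrightarrow> 0"
  proof (rule Lim_null_comparison)
    show "\<forall>\<^sub>F m in sequentially. norm (hnorm H (x m + y m - (k + l) m)) \<le> hnorm H (x m - k m) + hnorm H (y m - l m)"
      using x y H.hnorm_triangle[of "x _ - k _" "y _ - l _"] by (simp add: algebra_simps)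
    show "(\<lambda>m. hnorm H (x m - k m) + hnorm H (y m - l m)) \<longlonglongrightarrow> 0"
      using tendsto_add[OF x(3) y(3)] by simp
  qed
qed (use assms approxD in auto)

lemma approx_smul:
  assumes "approx x k"
  shows "approx (\<lambda>m. smul H c (x m)) (smul K c k)"
  unfolding approx_def
proof (intro conjI allI)
  note x = approxD[OF assms(1)]
  have "hnorm H (smul H c (x m) - smul K c k m) = cmod c * hnorm H (x m - k m)" for m
    using x by (simp add: smul_K H.hnorm_smul flip: H.scale_right_diff_distrib)
  then show "(\<lambda>m. hnorm H (smul H c (x m) - smul K c k m)) \<longlonglongrightarrow> 0"
    using tendsto_mult_left[OF x(3), of "cmod c"] by simp
qed (use assms approxD in auto)

lemma approx_0: "approx (\<lambda>m. 0) 0"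
  by (simp add: approx_def)

lemma approx_sum:
  "(\<And>i. i \<in> I \<Longrightarrow> approx (x i) (k i)) \<Longrightarrow> approx (\<lambda>m. \<Sum>i\<in>I. x i m) (\<Sum>i\<in>I. k i)"
  by (induction I rule: infinite_finite_induct) (auto simp: approx_0 approx_add)

lemma approx_diff:
  assumes "approx x k" "approx y l"
  shows "approx (\<lambda>m. x m - y m) (k - l)"
  using approx_add[OF assms(1) approx_smul[OF assms(2), of "-1"]] by simp

lemma approx_norm:
  assumes "approx x k"
  shows "(\<lambda>m. hnorm H (x m)) \<longlonglongrightarrow> hnorm K k"
proof -
  note x = approxD[OF assms]
  have "(\<lambda>m. hnorm H (x m) - hnorm H (k m)) \<longlonglongrightarrow> 0"
  proof (rule Lim_null_comparison[OF _ x(3)])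
    show "\<forall>\<^sub>F m in sequentially. norm (hnorm H (x m) - hnorm H (k m)) \<le> hnorm H (x m - k m)"
      using x H.hnorm_reverse_triangle by simp
  qed
  from tendsto_add[OF this hnorm_K_tendsto[OF x(2)]] show ?thesis by simp
qed

lemma approx_unique:
  assumes "approx x k" "approx x k'"
  shows "k = k'"
proof -
  have "(\<lambda>m. hnorm H (x m - x m)) \<longlonglongrightarrow> hnorm K (k - k')"
    by (rule approx_norm[OF approx_diff[OF assms]])
  then have "(\<lambda>m::nat. 0) \<longlonglongrightarrow> hnorm K (k - k')"
    using approxD(1)[OF assms(1)] by simp
  then have "hnorm K (k - k') = 0" using LIMSEQ_unique[OF _ tendsto_const] by blast
  then show ?thesis using approxD(2)[OF assms(1)] approxD(2)[OF assms(2)] by simp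
qed

lemma approx_norm_le:
  assumes "approx x k" "approx y l" "0 \<le> C" "\<And>m. hnorm H (x m) \<le> C * hnorm H (y m)"
  shows "hnorm K k \<le> C * hnorm K l"
  using approx_norm[OF assms(1)] tendsto_mult_left[OF approx_norm[OF assms(2)], of C]
  by (rule LIMSEQ_le) (use assms(4) in auto)

lemma approx_ip:
  assumes "approx x k" "approx y l"
  shows "(\<lambda>m. ip H (x m) (y m)) \<longlonglongrightarrow> ip K k l"
proof -
  note x = approxD[OF assms(1)] and y = approxD[OF assms(2)]
  have "(\<lambda>m. ip H (x m) (y m) - ip H (k m) (l m)) \<longlonglongrightarrow> 0"
  proof (rule Lim_null_comparison)
    have "cmod (ip H (x m) (y m) - ip H (k m) (l m)) \<le>
      hnorm H (x m - k m) * hnorm H (y m) + hnorm H (k m) * hnorm H (y m - l m)" for m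
    proof -
      have "ip H (x m) (y m) - ip H (k m) (l m) = ip H (x m - k m) (y m) + ip H (k m) (y m - l m)"
        using x y by (simp add: H.ip_diff H.ip_diff_right)
      then have "cmod (ip H (x m) (y m) - ip H (k m) (l m)) \<le>
        cmod (ip H (x m - k m) (y m)) + cmod (ip H (k m) (y m - l m))"
        using norm_triangle_ineq by metis
      then show ?thesis
        using H.Cauchy_Schwarz[of "x m - k m" "y m"] H.Cauchy_Schwarz[of "k m" "y m - l m"] x y
        by simp
    qed
    then show "\<forall>\<^sub>F m in sequentially. norm (ip H (x m) (y m) - ip H (k m) (l m)) \<le>
      hnorm H (x m - k m) * hnorm H (y m) + hnorm H (k m) * hnorm H (y m - l m)" by simp
    have "(\<lambda>m. hnorm H (x m - k m) * hnorm H (y m) + hnorm H (k m) * hnorm H (y m - l m))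
      \<longlonglongrightarrow> 0 * hnorm K l + hnorm K k * 0"
      by (intro tendsto_intros x y approx_norm[OF assms(2)] hnorm_K_tendsto)
    then show "(\<lambda>m. hnorm H (x m - k m) * hnorm H (y m) + hnorm H (k m) * hnorm H (y m - l m)) \<longlonglongrightarrow> 0"
      by simp
  qed
  from tendsto_add[OF this ip_K_tendsto[OF x(2) y(2)]] show ?thesis by simp
qed

text \<open>\<open>asym T Y\<close> says that \<open>T J\<^sup>* U\<^sup>m - J\<^sup>* U\<^sup>m Y\<close> tends to \<open>0\<close> strongly.\<close>

definition asym :: "('a \<Rightarrow> 'a) \<Rightarrow> ((nat \<Rightarrow> 'a) \<Rightarrow> nat \<Rightarrow> 'a) \<Rightarrow> bool" where
  "asym T Y \<longleftrightarrow> T \<in> bounded_ops H H \<and> Y \<in> bounded_ops K K \<and> (\<forall>k\<in>vecs K. approx (\<lambda>m. T (k m)) (Y k))"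

lemma asymD:
  assumes "asym T Y"
  shows "T \<in> bounded_ops H H" "Y \<in> bounded_ops K K" "k \<in> vecs K \<Longrightarrow> approx (\<lambda>m. T (k m)) (Y k)"
  using assms by (auto simp: asym_def)

lemma approx_apply:
  assumes "asym T Y" "approx x k"
  shows "approx (\<lambda>m. T (x m)) (Y k)"
proof (rule approx_cong_tendsto[OF asymD(3)[OF assms(1) approxD(2)[OF assms(2)]]])
  note T = asymD(1)[OF assms(1)] and x = approxD[OF assms(2)]
  show "T (x m) \<in> vecs H" for m using x bounded_ops_vecs[OF T] by blast
  show "(\<lambda>m. hnorm H (T (x m) - T (k m))) \<longlonglongrightarrow> 0"
  proof (rule Lim_null_comparison)
    show "\<forall>\<^sub>F m in sequentially. norm (hnorm H (T (x m) - T (k m))) \<le> opnorm H H T * hnorm H (x m - k m)"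
      using HH.opnorm_bound[OF T, of "x _ - k _"] x bounded_ops_vecs[OF T]
      by (simp add: HH.bounded_ops_diff[OF T])
    show "(\<lambda>m. opnorm H H T * hnorm H (x m - k m)) \<longlonglongrightarrow> 0"
      using tendsto_mult_left[OF x(3), of "opnorm H H T"] by simp
  qed
qed

lemma asym_unique:
  assumes "asym T Y" "asym T Y'"
  shows "Y = Y'"
  using asymD(2)[OF assms(1)] asymD(2)[OF assms(2)]
  by (rule bounded_ops_ext) (use approx_unique asymD(3)[OF assms(1)] asymD(3)[OF assms(2)] in blast)

lemma asym_comp:
  assumes "asym S Y" "asym T Z"
  shows "asym (S \<circ> T) (Y \<circ> Z)"
  unfolding asym_def
proof (intro conjI ballI)
  show "S \<circ> T \<in> bounded_ops H H" "Y \<circ> Z \<in> bounded_ops K K"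
    using asymD[OF assms(1)] asymD[OF assms(2)]
      H.ops_comp
      K.ops_comp by blast+
  show "approx (\<lambda>m. (S \<circ> T) (k m)) ((Y \<circ> Z) k)" if "k \<in> vecs K" for k
    using approx_apply[OF assms(1) asymD(3)[OF assms(2) that]] by simp
qed

lemma asym_add:
  assumes "asym S Y" "asym T Z"
  shows "asym (S + T) (Y + Z)"
  using asymD[OF assms(1)] asymD[OF assms(2)] HH.bounded_ops_plus KK.bounded_ops_plus approx_add
  by (auto simp: asym_def)

lemma asym_opscale:
  assumes "asym T Y"
  shows "asym (opscale H c T) (opscale K c Y)"
  using asymD[OF assms] HH.bounded_ops_opscale KK.bounded_ops_opscale approx_smul
  by (auto simp: asym_def opscale_def[abs_def])

lemma asym_idop: "asym (idop H) (idop K)"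
  using H.bounded_ops_idop K.bounded_ops_idop by (auto simp: asym_def idop_def approx_self)

text \<open>Strong limits do not pass to adjoints, so a partner of the adjoint is assumed; the limit
  of the adjoint identity along orbits then identifies it.\<close>

lemma asym_adj:
  assumes "asym T Y" "asym (adj H H T) Z"
  shows "adj K K Y = Z"
proof (rule KK.adj_eqI[OF asymD(2)[OF assms(2)]])
  fix x y assume x: "x \<in> vecs K" and y: "y \<in> vecs K"
  have "(\<lambda>m. ip H (T (x m)) (y m)) \<longlonglongrightarrow> ip K (Y x) y"
    by (intro approx_ip asymD(3)[OF assms(1)] approx_self x y)
  moreover have "(\<lambda>m. ip H (x m) (adj H H T (y m))) \<longlonglongrightarrow> ip K x (Z y)"
    by (intro approx_ip asymD(3)[OF assms(2)] approx_self x y)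
  moreover have "ip H (T (x m)) (y m) = ip H (x m) (adj H H T (y m))" for m
    using x y by (intro HH.ip_adj asymD(1)[OF assms(1)]) auto
  ultimately show "ip K (Y x) y = ip K x (Z y)" using LIMSEQ_unique by simp
qed

text \<open>All vectors are taken at the same coordinate \<open>m\<close>, where the bound for
  \<open>T\<close> applies, and norms of finite sums of approximating sequences converge.\<close>

lemma matrix_opnorm_asym_le:
  assumes TY: "\<And>i j. \<lbrakk>i < n; j < n\<rbrakk> \<Longrightarrow> asym (T i j) (Y i j)"
  shows "matrix_opnorm K n Y \<le> matrix_opnorm H n T"
proof (rule K.matrix_opnorm_le)
  have T: "T i j \<in> bounded_ops H H" if "i < n" "j < n" for i j using asymD(1)[OF TY[OF that]] .
  show "0 \<le> matrix_opnorm H n T" using T by (rule H.matrix_opnorm_nonneg)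
  fix x assume x: "\<And>j. j < n \<Longrightarrow> x j \<in> vecs K"
  have "(\<lambda>m. sqrt (\<Sum>i<n. (hnorm H (\<Sum>j<n. T i j (x j m)))\<^sup>2)) \<longlonglongrightarrow>
    sqrt (\<Sum>i<n. (hnorm K (\<Sum>j<n. Y i j (x j)))\<^sup>2)"
    using asymD(3)[OF TY] x by (intro tendsto_intros approx_norm approx_sum) auto
  moreover have "(\<lambda>m. matrix_opnorm H n T * sqrt (\<Sum>j<n. (hnorm H (x j m))\<^sup>2)) \<longlonglongrightarrow>
    matrix_opnorm H n T * sqrt (\<Sum>j<n. (hnorm K (x j))\<^sup>2)"
    using x by (intro tendsto_intros hnorm_K_tendsto) auto
  ultimately show "sqrt (\<Sum>i<n. (hnorm K (\<Sum>j<n. Y i j (x j)))\<^sup>2) \<le>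
    matrix_opnorm H n T * sqrt (\<Sum>j<n. (hnorm K (x j))\<^sup>2)"
  proof (rule LIMSEQ_le)
    have "sqrt (\<Sum>i<n. (hnorm H (\<Sum>j<n. T i j (x j m)))\<^sup>2) \<le>
      matrix_opnorm H n T * sqrt (\<Sum>j<n. (hnorm H (x j m))\<^sup>2)" for m
      by (rule H.hnorm_matrix_le[where x = "\<lambda>j. x j m", OF T]) (use x in auto)
    then show "\<exists>N. \<forall>m\<ge>N. sqrt (\<Sum>i<n. (hnorm H (\<Sum>j<n. T i j (x j m)))\<^sup>2) \<le>
      matrix_opnorm H n T * sqrt (\<Sum>j<n. (hnorm H (x j m))\<^sup>2)" by blast
  qed
qed

text \<open>Convergence for each single vector suffices: linearity follows from uniqueness of the
  limit vector, and the bound \<open>opnorm H H T\<close> survives the limit.\<close>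

lemma asym_exists:
  assumes T: "T \<in> bounded_ops H H"
    and ex: "\<And>k. k \<in> vecs K \<Longrightarrow> \<exists>y. approx (\<lambda>m. T (k m)) y"
  obtains Y where "asym T Y"
proof -
  define Y where "Y k = (if k \<in> vecs K then SOME y. approx (\<lambda>m. T (k m)) y else 0)" for k
  have Y: "approx (\<lambda>m. T (k m)) (Y k)" if "k \<in> vecs K" for k
    using someI_ex[OF ex[OF that]] that by (simp add: Y_def)
  have "Y \<in> bounded_ops K K"
  proof (rule KK.bounded_opsI)
    show "Y x \<in> vecs K" if "x \<in> vecs K" for x using approxD(2)[OF Y[OF that]] .
    show "Y (x + y) = Y x + Y y" if "x \<in> vecs K" "y \<in> vecs K" for x y
    proof (rule approx_unique)
      show "approx (\<lambda>m. T ((x + y) m)) (Y (x + y))" by (rule Y[OF K.vecs_add[OF that]])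
      show "approx (\<lambda>m. T ((x + y) m)) (Y x + Y y)"
        using approx_add[OF Y[OF that(1)] Y[OF that(2)]] that by (simp add: bounded_ops_add[OF T])
    qed
    show "Y (smul K c x) = smul K c (Y x)" if "x \<in> vecs K" for x c
    proof (rule approx_unique)
      show "approx (\<lambda>m. T (smul K c x m)) (Y (smul K c x))" by (rule Y[OF K.vecs_scale[OF that]])
      show "approx (\<lambda>m. T (smul K c x m)) (smul K c (Y x))"
        using approx_smul[OF Y[OF that]] that by (simp add: bounded_ops_smul[OF T] smul_K)
    qed
    show "hnorm K (Y x) \<le> opnorm H H T * hnorm K x" if "x \<in> vecs K" for x
      using that by (intro approx_norm_le[OF Y approx_self] HH.opnorm_nonneg HH.opnorm_bound T) auto
    show "Y x = 0" if "x \<notin> vecs K" for x using that by (simp add: Y_def)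
  qed
  then show thesis using that T Y by (auto simp: asym_def)
qed

text \<open>Such a \<open>T\<close> maps backward orbits of \<open>Ps\<close> to backward orbits, so
  it acts on \<open>K\<close> coordinatewise and without error.\<close>

lemma asym_orbitwise:
  assumes T: "T \<in> bounded_ops H H" and comm: "\<And>x. x \<in> vecs H \<Longrightarrow> Ps (T x) = T (Ps x)"
    and Y: "\<And>k. k \<in> vecs K \<Longrightarrow> Y k = (\<lambda>m. T (k m))" "\<And>k. k \<notin> vecs K \<Longrightarrow> Y k = 0"
  shows "asym T Y"
proof -
  have "approx (\<lambda>m. T (k m)) (\<lambda>m. T (k m))" if k: "k \<in> vecs K" for k
  proof (rule approx_self)
    obtain C where C: "\<And>n. hnorm H (k n) \<le> C" using K_bounded[OF k] by blast
    have "hnorm H (T (k n)) \<le> opnorm H H T * C" for n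
      using HH.opnorm_bound[OF T, of "k n"] mult_left_mono[OF C HH.opnorm_nonneg[OF T], of n] k by simp
    then show "(\<lambda>m. T (k m)) \<in> vecs K"
      using k bounded_ops_vecs[OF T] comm unfolding K_vecs_iff[of "\<lambda>m. T (k m)"] by auto
  qed
  then obtain Z where Z: "asym T Z" and "\<And>k. k \<in> vecs K \<Longrightarrow> approx (\<lambda>m. T (k m)) (\<lambda>m. T (k m))"
    using asym_exists[OF T] by blast
  then have "Z k = (\<lambda>m. T (k m))" if "k \<in> vecs K" for k
    using approx_unique[OF asymD(3)[OF Z that]] that by blast
  then have "Y = Z"
    using Y bounded_ops_outside[OF asymD(2)[OF Z]] by (intro ext) metis
  then show ?thesis using Z by simp
qed

text \<open>Coordinate \<open>n\<close> of the partner is the limit of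
  \<open>Ps^m A k (n + m)\<close>. The fixed point equation rewrites this term as
  \<open>Ps^(m + l) A\<close> applied to \<open>P^l k (n + m)\<close>; the later term has
  \<open>k (n + m + l)\<close> in its place, and the orbit estimate controls the difference.\<close>

lemma asym_fixed_exists:
  assumes A: "A \<in> bounded_ops H H" and fixed: "\<And>x. x \<in> vecs H \<Longrightarrow> Ps (A (P x)) = A x"
  obtains Y where "asym A Y"
proof (rule asym_exists[OF A])
  fix k assume k: "k \<in> vecs K"
  note A_vecs [simp] = bounded_ops_vecs[OF A]
  have fixn: "(Ps ^^ l) (A ((P ^^ l) x)) = A x" if "x \<in> vecs H" for x l
    using that by (induction l arbitrary: x) (auto simp: funpow_swap1[of P] fixed)
  define E where "E m = opnorm H H A * sqrt ((hnorm K k)\<^sup>2 - (hnorm H (k m))\<^sup>2)" for m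
  have E: "E \<longlonglongrightarrow> 0" unfolding E_def[abs_def] by (rule orbit_gap_tendsto[OF k])
  define z where "z n m = (Ps ^^ m) (A (k (n + m)))" for n m
  have z: "z n m \<in> vecs H" for n m using k by (simp add: z_def)
  have step: "hnorm H (z n m - z n (m + l)) \<le> E (n + m)" for n m l
  proof -
    define u where "u = (P ^^ l) (k (n + m)) - k (n + m + l)"
    have u: "u \<in> vecs H" using k by (simp add: u_def)
    have "z n m = (Ps ^^ (m + l)) (A ((P ^^ l) (k (n + m))))"
      using fixn[of "k (n + m)" l] k by (simp add: z_def funpow_add)
    then have "z n m - z n (m + l) = (Ps ^^ (m + l)) (A u)"
      using k by (simp add: z_def u_def HH.bounded_ops_diff[OF A] Ps_pow_diff add.assoc)
    then have "hnorm H (z n m - z n (m + l)) \<le> opnorm H H A * hnorm H u"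
      using Ps_pow_le[of "A u" "m + l"] HH.opnorm_bound[OF A u] u by simp
    also have "\<dots> \<le> E (n + m)"
      unfolding E_def u_def by (intro mult_left_mono orbit_defect_le k HH.opnorm_nonneg A)
    finally show ?thesis .
  qed
  have "\<exists>y. y \<in> vecs H \<and> (\<lambda>m. hnorm H (z n m - y)) \<longlonglongrightarrow> 0" for n
  proof (rule H.Cauchy_converges[of "z n"])
    fix e :: real assume e: "0 < e"
    then obtain N where N: "\<And>m. m \<ge> N \<Longrightarrow> E m < e" using LIMSEQ_D[OF E e] by fastforce
    have *: "hnorm H (z n m - z n m') < e" if "m \<ge> N" "m' \<ge> m" for m m'
      using step[of n m "m' - m"] N[of "n + m"] that by simp
    have "hnorm H (z n m - z n m') < e" if "m \<ge> N" "m' \<ge> N" for m m'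
      using *[of m m'] *[of m' m] that H.hnorm_minus_commute[OF z z] by (metis nle_le)
    then show "\<exists>N. \<forall>m\<ge>N. \<forall>n'\<ge>N. hnorm H (z n m - z n n') < e" by blast
  qed (use z in auto)
  then obtain y where y: "\<And>n. y n \<in> vecs H" "\<And>n. (\<lambda>m. hnorm H (z n m - y n)) \<longlonglongrightarrow> 0" by metis
  have "y \<in> vecs K"
  proof -
    have "Ps (y (Suc n)) = y n" for n
    proof (rule H.limit_unique[of "\<lambda>m. z n (Suc m)"])
      have "(\<lambda>m. hnorm H (Ps (z (Suc n) m) - Ps (y (Suc n)))) \<longlonglongrightarrow> 0"
        using y z by (intro HH.tendsto_op[OF Ps]) auto
      then show "(\<lambda>m. hnorm H (z n (Suc m) - Ps (y (Suc n)))) \<longlonglongrightarrow> 0"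
        by (simp add: z_def)
      show "(\<lambda>m. hnorm H (z n (Suc m) - y n)) \<longlonglongrightarrow> 0" by (rule LIMSEQ_Suc[OF y(2)])
    qed (use y z in auto)
    moreover have "hnorm H (y n) \<le> opnorm H H A * hnorm K k" for n
    proof -
      have "hnorm H (z n m) \<le> opnorm H H A * hnorm K k" for m
      proof -
        have "hnorm H (z n m) \<le> opnorm H H A * hnorm H (k (n + m))"
          unfolding z_def using Ps_pow_le[of "A (k (n + m))" m] HH.opnorm_bound[OF A, of "k (n + m)"] k by simp
        also have "\<dots> \<le> opnorm H H A * hnorm K k"
          using hnorm_le_K[OF k] HH.opnorm_nonneg[OF A] by (rule mult_left_mono)
        finally show ?thesis .
      qed
      then show ?thesis
        using H.tendsto_norm[OF z y(1) y(2)] by (intro LIMSEQ_le_const2[of "\<lambda>m. hnorm H (z n m)"]) blast+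
    qed
    ultimately show ?thesis using y(1) unfolding K_vecs_iff[of y] by blast
  qed
  moreover have "(\<lambda>n. hnorm H (A (k n) - y n)) \<longlonglongrightarrow> 0"
  proof (rule Lim_null_comparison[OF _ E])
    \<comment> \<open>\<open>z n 0\<close> is \<open>A (k n)\<close>, so the Cauchy estimate from
      index \<open>0\<close> is already the approximation error.\<close>
    have "hnorm H (z n 0 - y n) \<le> E n" for n
    proof (rule LIMSEQ_le_const2)
      have "(\<lambda>l. hnorm H (z n 0 - z n l - (z n 0 - y n))) \<longlonglongrightarrow> 0"
        using y z by (intro H.tendsto_diff_vecs) auto
      then show "(\<lambda>l. hnorm H (z n 0 - z n l)) \<longlonglongrightarrow> hnorm H (z n 0 - y n)"
        using y z by (intro H.tendsto_norm) auto
      show "\<exists>N. \<forall>l\<ge>N. hnorm H (z n 0 - z n l) \<le> E n" using step[of n 0] by simp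
    qed
    then show "\<forall>\<^sub>F n in sequentially. norm (hnorm H (A (k n) - y n)) \<le> E n"
      using k y by (simp add: z_def)
  qed
  ultimately show "\<exists>y. approx (\<lambda>m. A (k m)) y" using k by (auto simp: approx_def)
qed

text \<open>The orbit vector \<open>k\<^bsub>n+l\<^esub>\<close> is close to \<open>P\<^sup>l k\<^sub>n\<close> uniformly in \<open>l\<close> once \<open>n\<close> is large, and \<open>1 - Q\<close> tends to \<open>0\<close>
  along \<open>X P\<^sup>l k\<^sub>n = P\<^sup>l X k\<^sub>n\<close>.\<close>

lemma approx_P_pow_sub_Q:
  assumes X: "X \<in> bounded_ops H H" and comm: "X \<circ> P = P \<circ> X" and k: "k \<in> vecs K"
  shows "(\<lambda>m. hnorm H (X (k m) - Q (X (k m)))) \<longlonglongrightarrow> 0"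
proof (rule LIMSEQ_I)
  fix r :: real assume r: "0 < r"
  note X_vecs [simp] = bounded_ops_vecs[OF X]
  have X_pow: "X ((P ^^ l) x) = (P ^^ l) (X x)" for l x
    using comm by (induction l) (auto simp: fun_eq_iff)
  \<comment> \<open>The factor \<open>2\<close> bounds \<open>1 - Q\<close>, since \<open>Q\<close>
    is a contraction.\<close>
  define E where "E m = (2 * opnorm H H X) * sqrt ((hnorm K k)\<^sup>2 - (hnorm H (k m))\<^sup>2)" for m
  have "E \<longlonglongrightarrow> 0" unfolding E_def[abs_def] by (rule orbit_gap_tendsto[OF k])
  from LIMSEQ_D[OF this, of "r / 2"] r obtain n where "\<bar>E n\<bar> < r / 2" by auto
  then have n: "E n < r / 2" by simp
  define x where "x = X (k n)"
  have x: "x \<in> vecs H" using k by (simp add: x_def)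
  have "0 < r / 2" using r by simp
  from LIMSEQ_D[OF P_pow_sub_Q_tendsto[OF x] this] obtain L where
    L: "\<And>l. l \<ge> L \<Longrightarrow> hnorm H ((P ^^ l) x - Q ((P ^^ l) x)) < r / 2" using x by force
  have "hnorm H (X (k m) - Q (X (k m))) < r" if m: "m \<ge> n + L" for m
  proof -
    obtain l where l: "m = n + l" "l \<ge> L" using m by (metis add_le_cancel_left le_Suc_ex le_add1 order_trans)
    define v where "v = k (n + l) - (P ^^ l) (k n)"
    have v: "v \<in> vecs H" using k by (simp add: v_def)
    have "k (n + l) = (P ^^ l) (k n) + v" by (simp add: v_def)
    then have "X (k (n + l)) = (P ^^ l) x + X v"
      using k v bounded_ops_add[OF X, of "(P ^^ l) (k n)" v] by (simp add: x_def X_pow)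
    then have "X (k m) - Q (X (k m)) = ((P ^^ l) x - Q ((P ^^ l) x)) + (X v - Q (X v))"
      using l x v by (simp add: bounded_ops_add[OF Q])
    then have "hnorm H (X (k m) - Q (X (k m))) \<le>
      hnorm H ((P ^^ l) x - Q ((P ^^ l) x)) + hnorm H (X v - Q (X v))"
      using H.hnorm_triangle[of "(P ^^ l) x - Q ((P ^^ l) x)" "X v - Q (X v)"] x v by simp
    also have "hnorm H (X v - Q (X v)) \<le> 2 * hnorm H (X v)"
      using H.hnorm_triangle_diff[of "X v" "Q (X v)"] Q_le[of "X v"] v by simp
    also have "\<dots> \<le> 2 * (opnorm H H X * hnorm H v)"
      using HH.opnorm_bound[OF X v] by simp
    also have "\<dots> \<le> E n"
      unfolding E_def v_def using orbit_defect_le[OF k, of l n] k HH.opnorm_nonneg[OF X]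
        H.hnorm_minus_commute[of "k (n + l)" "(P ^^ l) (k n)"] by (simp add: mult_left_mono)
    finally show ?thesis using n L[OF l(2)] by linarith
  qed
  then show "\<exists>N. \<forall>m\<ge>N. norm (hnorm H (X (k m) - Q (X (k m))) - 0) < r"
    using k by (intro exI[of _ "n + L"]) simp
qed

text \<open>\<open>Ps Q X P = Ps Q P X = Q X\<close>, so \<open>Q X\<close> has a partner;
  \<open>X\<close> differs from it by a term vanishing along orbits and has the same one. This later
  makes \<open>pi\<close> of \<open>J* J X\<close> the partner of \<open>X\<close>.\<close>

lemma asym_commuting:
  assumes X: "X \<in> bounded_ops H H" and comm: "X \<circ> P = P \<circ> X"
  obtains Y where "asym X Y" "asym (Q \<circ> X) Y"
proof -
  note X_vecs [simp] = bounded_ops_vecs[OF X]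
  have QX: "Q \<circ> X \<in> bounded_ops H H"
    by (rule H.ops_comp[OF Q X])
  have "Ps ((Q \<circ> X) (P x)) = (Q \<circ> X) x" if "x \<in> vecs H" for x
    using that comm Ps_Q_P[of "X x"] by (simp add: fun_eq_iff)
  then obtain Y where Y: "asym (Q \<circ> X) Y" using asym_fixed_exists[OF QX] by blast
  have "approx (\<lambda>m. X (k m)) (Y k)" if k: "k \<in> vecs K" for k
    by (rule approx_cong_tendsto[OF asymD(3)[OF Y k]])
      (use k approx_P_pow_sub_Q[OF X comm k] in auto)
  then have "asym X Y" using X asymD(2)[OF Y] by (auto simp: asym_def)
  then show thesis using that Y by blast
qed

text \<open>The adjoint of \<open>X\<close> commutes with \<open>Ps\<close> and so acts
  coordinatewise; in this case the partner of an adjoint comes for free.\<close>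

lemma asym_adj_commuting:
  assumes X: "X \<in> bounded_ops H H" and comm: "X \<circ> P = P \<circ> X" and Y: "asym X Y"
  shows "asym (adj H H X) (adj K K Y)" and "k \<in> vecs K \<Longrightarrow> adj K K Y k = (\<lambda>m. adj H H X (k m))"
proof -
  define Z where "Z k = (if k \<in> vecs K then (\<lambda>m. adj H H X (k m)) else 0)" for k
  have "adj H H P \<circ> adj H H X = adj H H X \<circ> adj H H P"
    using H.adj_comp[OF X P] H.adj_comp[OF P X] comm by simp
  then have "asym (adj H H X) Z"
    by (intro asym_orbitwise HH.adj_bounded_ops X) (auto simp: fun_eq_iff Z_def)
  moreover have "adj K K Y = Z" by (rule asym_adj[OF Y calculation])
  ultimately show "asym (adj H H X) (adj K K Y)"
    and "k \<in> vecs K \<Longrightarrow> adj K K Y k = (\<lambda>m. adj H H X (k m))" by (auto simp: Z_def)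
qed

section \<open>The unitary shift and its inverse\<close>

definition U :: "(nat \<Rightarrow> 'a) \<Rightarrow> nat \<Rightarrow> 'a" where
  "U k = (if k \<in> vecs K then (\<lambda>n. k (Suc n)) else 0)"

text \<open>Applying \<open>Ps\<close> to each coordinate moves the orbit back one place and
  prepends \<open>Ps (k 0)\<close>, so this is the inverse of \<open>U\<close>.\<close>

definition V :: "(nat \<Rightarrow> 'a) \<Rightarrow> nat \<Rightarrow> 'a" where
  "V k = (if k \<in> vecs K then (\<lambda>n. Ps (k n)) else 0)"

definition J :: "'a \<Rightarrow> nat \<Rightarrow> 'a" where
  "J h = (if h \<in> vecs H then (\<lambda>n. Q ((P ^^ n) h)) else 0)"

definition ev :: "(nat \<Rightarrow> 'a) \<Rightarrow> 'a" where
  "ev k = (if k \<in> vecs K then k 0 else 0)"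

lemma U_vecs [simp]: "k \<in> vecs K \<Longrightarrow> U k \<in> vecs K"
proof -
  assume k: "k \<in> vecs K"
  obtain C where C: "\<And>n. hnorm H (k n) \<le> C" using K_bounded[OF k] by blast
  then show ?thesis using k unfolding K_vecs_iff[of "U k"] by (auto simp: U_def)
qed

lemma U: "U \<in> bounded_ops K K"
proof (rule KK.bounded_opsI)
  show "hnorm K (U k) \<le> 1 * hnorm K k" if "k \<in> vecs K" for k
    using hnorm_K_le[OF U_vecs[OF that], of "hnorm K k"] hnorm_le_K[OF that] that by (simp add: U_def)
  show "U x \<in> vecs K" if "x \<in> vecs K" for x by (rule U_vecs[OF that])
  show "U (smul K c x) = smul K c (U x)" if "x \<in> vecs K" for x c
    using K.vecs_scale[OF that, of c] that by (simp add: U_def smul_K)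
qed (auto simp: U_def)

lemma U_le: "k \<in> vecs K \<Longrightarrow> hnorm K (U k) \<le> hnorm K k"
  using hnorm_K_le[OF U_vecs, of k "hnorm K k"] hnorm_le_K[of k] by (simp add: U_def)

lemma asym_U: "asym P U"
  unfolding asym_def
proof (intro conjI ballI P U)
  fix k assume k: "k \<in> vecs K"
  have "(\<lambda>m. hnorm H (P (k m) - U k m)) \<longlonglongrightarrow> 0"
  proof (rule Lim_null_comparison)
    show "(\<lambda>m. 1 * sqrt ((hnorm K k)\<^sup>2 - (hnorm H (k m))\<^sup>2)) \<longlonglongrightarrow> 0"
      by (rule orbit_gap_tendsto[OF k])
    show "\<forall>\<^sub>F m in sequentially. norm (hnorm H (P (k m) - U k m)) \<le> 1 * sqrt ((hnorm K k)\<^sup>2 - (hnorm H (k m))\<^sup>2)"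
      using orbit_defect_le[OF k, of 1] k by (simp add: U_def)
  qed
  then show "approx (\<lambda>m. P (k m)) (U k)" using k by (simp add: approx_def)
qed

lemma asym_V: "asym Ps V"
  by (rule asym_orbitwise[OF Ps]) (auto simp: V_def)

lemma V: "V \<in> bounded_ops K K"
  using asymD(2)[OF asym_V] .

lemmas V_vecs [simp] = bounded_ops_vecs[OF V]

lemma adj_U: "adj K K U = V"
  by (rule asym_adj[OF asym_U asym_V])

lemma V_U [simp]: "k \<in> vecs K \<Longrightarrow> V (U k) = k"
  using U_vecs[of k] by (simp add: V_def) (simp add: U_def)

lemma U_V [simp]: "k \<in> vecs K \<Longrightarrow> U (V k) = k"
  using V_vecs[of k] by (simp add: U_def) (simp add: V_def)

lemma V_le: "k \<in> vecs K \<Longrightarrow> hnorm K (V k) \<le> hnorm K k"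
proof -
  assume k: "k \<in> vecs K"
  have "hnorm H (V k n) \<le> hnorm K k" for n
    using order_trans[OF Ps_le[OF K_vecsD(1)[OF k]] hnorm_le_K[OF k]] k by (simp add: V_def)
  then show ?thesis by (rule hnorm_K_le[OF V_vecs[OF k]])
qed

lemma U_isometric: "k \<in> vecs K \<Longrightarrow> hnorm K (U k) = hnorm K k"
  using U_le[of k] V_le[of "U k"] by simp

lemma ip_U_U: "\<lbrakk>k \<in> vecs K; l \<in> vecs K\<rbrakk> \<Longrightarrow> ip K (U k) (U l) = ip K k l"
  using KK.ip_adj[OF U, of k "U l"] by (simp add: adj_U)

lemma ip_V: "\<lbrakk>k \<in> vecs K; l \<in> vecs K\<rbrakk> \<Longrightarrow> ip K (V k) l = ip K k (U l)"
  using ip_U_U[of "V k" l] by simp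

lemma U_pow: "k \<in> vecs K \<Longrightarrow> (U ^^ m) k = (\<lambda>n. k (n + m))" "k \<in> vecs K \<Longrightarrow> (U ^^ m) k \<in> vecs K"
proof (induction m)
  case (Suc m)
  case 1
  show ?case using Suc(1,2)[OF 1] by (simp add: U_def)
next
  case (Suc m)
  case 2
  show ?case using Suc(2)[OF 2] by simp
qed auto

lemma U_pow_le: "k \<in> vecs K \<Longrightarrow> hnorm K ((U ^^ m) k) \<le> hnorm K k"
  by (induction m) (auto simp: U_isometric U_pow(2))

lemma V_pow_vecs [simp]: "k \<in> vecs K \<Longrightarrow> (V ^^ m) k \<in> vecs K"
  by (induction m) auto

lemma V_pow_le: "k \<in> vecs K \<Longrightarrow> hnorm K ((V ^^ m) k) \<le> hnorm K k"
  by (induction m) (auto intro: order_trans[OF V_le])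

lemma V_pow_U_pow: "k \<in> vecs K \<Longrightarrow> (V ^^ m) ((U ^^ m) k) = k"
  by (induction m) (auto simp: funpow_swap1[of V] U_pow(2))

lemma V_pow_diff: "\<lbrakk>k \<in> vecs K; l \<in> vecs K\<rbrakk> \<Longrightarrow> (V ^^ m) (k - l) = (V ^^ m) k - (V ^^ m) l"
  by (induction m) (auto simp: KK.bounded_ops_diff[OF V])

lemma commutes_V:
  assumes Y: "Y \<in> bounded_ops K K" and comm: "Y \<circ> U = U \<circ> Y" and k: "k \<in> vecs K"
  shows "Y (V k) = V (Y k)"
proof -
  have "U (Y (V k)) = Y (U (V k))" using comm by (simp add: fun_eq_iff)
  then have "V (U (Y (V k))) = V (Y k)" using k by simp
  then show ?thesis using k bounded_ops_vecs[OF Y, of "V k"] by simp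
qed

subsection \<open>The embedding\<close>

lemma J_vecs [simp]: "h \<in> vecs H \<Longrightarrow> J h \<in> vecs K"
  and J_le: "h \<in> vecs H \<Longrightarrow> hnorm K (J h) \<le> hnorm H h"
proof -
  assume h: "h \<in> vecs H"
  have b: "hnorm H (Q ((P ^^ n) h)) \<le> hnorm H h" for n
    using Q_le[of "(P ^^ n) h"] P_pow_le[OF h, of n] h by simp
  then show J: "J h \<in> vecs K"
    using h Ps_Q_P unfolding K_vecs_iff[of "J h"] by (auto simp: J_def)
  show "hnorm K (J h) \<le> hnorm H h"
    using b h by (intro hnorm_K_le[OF J]) (simp add: J_def)
qed

lemma P_pow_add: "\<lbrakk>x \<in> vecs H; y \<in> vecs H\<rbrakk> \<Longrightarrow> (P ^^ n) (x + y) = (P ^^ n) x + (P ^^ n) y"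
  by (induction n) (auto simp: bounded_ops_add[OF P])

lemma P_pow_smul: "x \<in> vecs H \<Longrightarrow> (P ^^ n) (smul H c x) = smul H c ((P ^^ n) x)"
  by (induction n) (auto simp: bounded_ops_smul[OF P])

lemma J: "J \<in> bounded_ops H K"
proof (rule HK.bounded_opsI)
  show "hnorm K (J h) \<le> 1 * hnorm H h" if "h \<in> vecs H" for h using J_le[OF that] by simp
  show "J (x + y) = J x + J y" if "x \<in> vecs H" "y \<in> vecs H" for x y
    using that by (simp add: J_def fun_eq_iff P_pow_add bounded_ops_add[OF Q])
  show "J (smul H c x) = smul K c (J x)" if "x \<in> vecs H" for x c
    using that by (simp add: J_def smul_K fun_eq_iff P_pow_smul bounded_ops_smul[OF Q])
  show "J x \<in> vecs K" if "x \<in> vecs H" for x by (rule J_vecs[OF that])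
  show "J x = 0" if "x \<notin> vecs H" for x using that by (simp add: J_def)
qed

lemma approx_J:
  assumes h: "h \<in> vecs H"
  shows "approx (\<lambda>m. (P ^^ m) h) (J h)"
  using h P_pow_sub_Q_tendsto[OF h] J_vecs[OF h] unfolding approx_def by (simp add: J_def)

lemma ev_vecs [simp]: "k \<in> vecs K \<Longrightarrow> ev k \<in> vecs H"
  by (simp add: ev_def)

lemma ev: "ev \<in> bounded_ops K H"
proof (rule KH.bounded_opsI)
  show "hnorm H (ev k) \<le> 1 * hnorm K k" if "k \<in> vecs K" for k
    using hnorm_le_K[OF that] that by (simp add: ev_def)
  show "ev (smul K c x) = smul H c (ev x)" if "x \<in> vecs K" for x c
    using K.vecs_scale[OF that, of c] that by (simp add: ev_def smul_K)
  show "ev (x + y) = ev x + ev y" if "x \<in> vecs K" "y \<in> vecs K" for x y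
    using K.vecs_add[OF that] that unfolding ev_def by (simp only: if_True plus_fun_apply)
qed (auto simp: ev_def)

lemma ev_le: "k \<in> vecs K \<Longrightarrow> hnorm H (ev k) \<le> hnorm K k"
  using hnorm_le_K by (simp add: ev_def)

text \<open>\<open><P^m h, k m> = <h, Ps^m (k m)> = <h, k 0>\<close> for every \<open>m\<close>, so
  the sequence computing the inner product with \<open>J h\<close> is constant.\<close>

lemma adj_J: "adj H K J = ev"
proof (rule HK.adj_eqI[OF ev])
  fix h k assume h: "h \<in> vecs H" and k: "k \<in> vecs K"
  have "(\<lambda>m. ip H ((P ^^ m) h) (k m)) \<longlonglongrightarrow> ip K (J h) k"
    by (rule approx_ip[OF approx_J[OF h] approx_self[OF k]])
  moreover have "ip H ((P ^^ m) h) (k m) = ip H h (ev k)" for m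
    using h k Ps_pow_orbit[OF k, of m 0] by (simp add: ip_P_pow ev_def)
  ultimately have "(\<lambda>m::nat. ip H h (ev k)) \<longlonglongrightarrow> ip K (J h) k" by simp
  then show "ip K (J h) k = ip H h (ev k)" using LIMSEQ_unique[OF _ tendsto_const] by blast
qed

lemma adj_J_J: "adj H K J \<circ> J = Q"
proof
  show "(adj H K J \<circ> J) h = Q h" for h
  proof (cases "h \<in> vecs H")
    case True
    then show ?thesis using J_vecs[OF True] by (simp add: adj_J ev_def) (simp add: J_def)
  next
    case False
    then show ?thesis using bounded_ops_outside[OF Q False] by (simp add: J_def adj_J ev_def)
  qed
qed

text \<open>The sequence \<open>P^m (X h) = X (P^m h)\<close> approximates both
  \<open>J (X h)\<close> and \<open>Y (J h)\<close>.\<close>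

lemma J_intertwines:
  assumes XY: "asym X Y" and comm: "X \<circ> P = P \<circ> X"
  shows "Y \<circ> J = J \<circ> X"
proof
  fix h
  note X = asymD(1)[OF XY] and Y = asymD(2)[OF XY]
  show "(Y \<circ> J) h = (J \<circ> X) h"
  proof (cases "h \<in> vecs H")
    case True
    have "X ((P ^^ l) x) = (P ^^ l) (X x)" for l x
      using comm by (induction l) (auto simp: fun_eq_iff)
    then have "approx (\<lambda>m. (P ^^ m) (X h)) (Y (J h))"
      using approx_apply[OF XY approx_J[OF True]] by simp
    then show ?thesis using approx_unique approx_J[OF bounded_ops_vecs[OF X True]] by simp
  next
    case False
    then show ?thesis
      using bounded_ops_outside[OF X False] HK.bounded_ops_0[OF J] KK.bounded_ops_0[OF Y]
      by (simp add: J_def)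
  qed
qed

text \<open>The expansion of \<open>orbit_defect\<close>, now in \<open>K\<close>: the cross term
  \<open><J (k m), U^m k>\<close> is \<open>|k m|^2\<close> because the adjoint of \<open>J\<close>
  reads off coordinate \<open>0\<close>.\<close>

lemma J_orbit_le:
  assumes k: "k \<in> vecs K"
  shows "hnorm K (J (k m) - (U ^^ m) k) \<le> sqrt ((hnorm K k)\<^sup>2 - (hnorm H (k m))\<^sup>2)"
proof (rule real_le_rsqrt)
  have u: "(U ^^ m) k \<in> vecs K" using U_pow(2)[OF k] .
  have j: "J (k m) \<in> vecs K" using k by simp
  have "ip K (J (k m)) ((U ^^ m) k) = ip H (k m) (k m)"
    using HK.ip_adj[OF J K_vecsD(1)[OF k] u, of m] u by (simp add: adj_J ev_def) (simp add: U_pow(1)[OF k])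
  then have "Re (ip K (J (k m)) ((U ^^ m) k)) = (hnorm H (k m))\<^sup>2"
    using k by (simp add: H.hnorm_sq)
  moreover have "(hnorm K (J (k m)))\<^sup>2 \<le> (hnorm H (k m))\<^sup>2"
    using J_le[of "k m"] k by (intro power_mono) auto
  moreover have "(hnorm K ((U ^^ m) k))\<^sup>2 \<le> (hnorm K k)\<^sup>2"
    using U_pow_le[OF k] u by (intro power_mono) auto
  ultimately show "(hnorm K (J (k m) - (U ^^ m) k))\<^sup>2 \<le> (hnorm K k)\<^sup>2 - (hnorm H (k m))\<^sup>2"
    using K.hnorm_diff_sq[OF j u] by linarith
qed

text \<open>The source of minimality: a closed subspace that contains the range of \<open>J\<close>
  and is invariant under \<open>V\<close> contains every \<open>k\<close>.\<close>

lemma orbit_dense: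
  assumes k: "k \<in> vecs K"
  shows "(\<lambda>m. hnorm K ((V ^^ m) (J (k m)) - k)) \<longlonglongrightarrow> 0"
proof (rule Lim_null_comparison)
  show "(\<lambda>m. 1 * sqrt ((hnorm K k)\<^sup>2 - (hnorm H (k m))\<^sup>2)) \<longlonglongrightarrow> 0"
    by (rule orbit_gap_tendsto[OF k])
  have "hnorm K ((V ^^ m) (J (k m)) - k) \<le> sqrt ((hnorm K k)\<^sup>2 - (hnorm H (k m))\<^sup>2)" for m
  proof -
    have u: "(U ^^ m) k \<in> vecs K" and j: "J (k m) \<in> vecs K" using U_pow(2)[OF k] k by auto
    have "(V ^^ m) (J (k m)) - k = (V ^^ m) (J (k m) - (U ^^ m) k)"
      using V_pow_diff[OF j u] V_pow_U_pow[OF k] by simp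
    then show ?thesis
      using V_pow_le[of "J (k m) - (U ^^ m) k" m] J_orbit_le[OF k, of m] u j by simp
  qed
  then show "\<forall>\<^sub>F m in sequentially. norm (hnorm K ((V ^^ m) (J (k m)) - k)) \<le>
    1 * sqrt ((hnorm K k)\<^sup>2 - (hnorm H (k m))\<^sup>2)" using k by simp
qed

lemma compression_bounded_ops:
  assumes "Y \<in> bounded_ops K K"
  shows "adj H K J \<circ> Y \<circ> J \<in> bounded_ops H H"
  unfolding adj_J
  by (intro bounded_ops_comp[OF HK.pre_hilbert_pair_axioms KH.pre_hilbert_pair_axioms]
      bounded_ops_comp[OF KK.pre_hilbert_pair_axioms KH.pre_hilbert_pair_axioms] J ev assms)

text \<open>For large \<open>m\<close>, \<open>J (k m)\<close> is close to \<open>U^m k\<close>; as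
  \<open>Y\<close> commutes with \<open>U\<close>, coordinate \<open>0\<close> of
  \<open>Y (U^m k)\<close> is coordinate \<open>m\<close> of \<open>Y k\<close>.\<close>

lemma asym_compression:
  assumes Y: "Y \<in> bounded_ops K K" and comm: "Y \<circ> U = U \<circ> Y"
  shows "asym (adj H K J \<circ> Y \<circ> J) Y"
  unfolding asym_def
proof (intro conjI ballI Y compression_bounded_ops)
  fix k assume k: "k \<in> vecs K"
  note Y_vecs [simp] = bounded_ops_vecs[OF Y]
  have YU: "Y (U x) = U (Y x)" for x using fun_cong[OF comm, of x] by simp
  have Y_pow: "Y ((U ^^ m) x) = (U ^^ m) (Y x)" for m x
    by (induction m) (simp_all add: YU)
  have eq: "(adj H K J \<circ> Y \<circ> J) (k m) - Y k m = ev (Y (J (k m) - (U ^^ m) k))" for m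
  proof -
    have u: "(U ^^ m) k \<in> vecs K" using U_pow(2)[OF k] .
    have "ev (Y ((U ^^ m) k)) = ((U ^^ m) (Y k)) 0"
      using Y_vecs[OF u] by (simp add: ev_def Y_pow)
    then have "ev (Y ((U ^^ m) k)) = Y k m" by (simp add: U_pow(1)[OF Y_vecs[OF k]])
    then show ?thesis
      using k u by (simp add: adj_J KK.bounded_ops_diff[OF Y] KH.bounded_ops_diff[OF ev])
  qed
  have "(\<lambda>m. hnorm H ((adj H K J \<circ> Y \<circ> J) (k m) - Y k m)) \<longlonglongrightarrow> 0"
  proof (rule Lim_null_comparison)
    show "(\<lambda>m. opnorm K K Y * sqrt ((hnorm K k)\<^sup>2 - (hnorm H (k m))\<^sup>2)) \<longlonglongrightarrow> 0"
      by (rule orbit_gap_tendsto[OF k])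
    have "hnorm H (ev (Y (J (k m) - (U ^^ m) k))) \<le> opnorm K K Y * sqrt ((hnorm K k)\<^sup>2 - (hnorm H (k m))\<^sup>2)" for m
    proof -
      have z: "J (k m) - (U ^^ m) k \<in> vecs K" using k U_pow(2)[OF k] by simp
      have "hnorm H (ev (Y (J (k m) - (U ^^ m) k))) \<le> opnorm K K Y * hnorm K (J (k m) - (U ^^ m) k)"
        using ev_le[OF Y_vecs[OF z]] KK.opnorm_bound[OF Y z] by simp
      also have "\<dots> \<le> opnorm K K Y * sqrt ((hnorm K k)\<^sup>2 - (hnorm H (k m))\<^sup>2)"
        by (intro mult_left_mono J_orbit_le k KK.opnorm_nonneg Y)
      finally show ?thesis .
    qed
    then show "\<forall>\<^sub>F m in sequentially. norm (hnorm H ((adj H K J \<circ> Y \<circ> J) (k m) - Y k m)) \<le>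
      opnorm K K Y * sqrt ((hnorm K k)\<^sup>2 - (hnorm H (k m))\<^sup>2)"
      unfolding eq using k U_pow(2)[OF k] by simp
  qed
  then show "approx (\<lambda>m. (adj H K J \<circ> Y \<circ> J) (k m)) (Y k)"
    using k bounded_ops_vecs[OF compression_bounded_ops[OF Y]] unfolding approx_def by simp
qed

text \<open>With \<open>k = Y (J h)\<close>, the vector \<open>A h - k 0\<close> is
  \<open>Ps^m\<close> of \<open>A (P^m h) - k m\<close> for every \<open>m\<close>;
  \<open>Ps\<close> is a contraction and the latter tends to \<open>0\<close>.\<close>

lemma compression_of_fixed:
  assumes AY: "asym A Y" and fixed: "\<And>x. x \<in> vecs H \<Longrightarrow> Ps (A (P x)) = A x"
  shows "adj H K J \<circ> Y \<circ> J = A"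
proof (rule bounded_ops_ext[OF compression_bounded_ops[OF asymD(2)[OF AY]] asymD(1)[OF AY]])
  fix h assume h: "h \<in> vecs H"
  note A_vecs [simp] = bounded_ops_vecs[OF asymD(1)[OF AY]]
    and Y_vecs [simp] = bounded_ops_vecs[OF asymD(2)[OF AY]]
  have fixn: "(Ps ^^ l) (A ((P ^^ l) x)) = A x" if "x \<in> vecs H" for x l
    using that by (induction l arbitrary: x) (auto simp: funpow_swap1[of P] fixed)
  define k where "k = Y (J h)"
  have k: "k \<in> vecs K" using h by (simp add: k_def)
  have "hnorm H (A h - k 0) \<le> hnorm H (A ((P ^^ m) h) - k m)" for m
  proof -
    have "(Ps ^^ m) (A ((P ^^ m) h) - k m) = A h - k 0"
      using h k Ps_pow_orbit[OF k, of m 0] by (simp add: Ps_pow_diff fixn)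
    then show ?thesis using Ps_pow_le[of "A ((P ^^ m) h) - k m" m] h k by simp
  qed
  moreover have "(\<lambda>m. hnorm H (A ((P ^^ m) h) - k m)) \<longlonglongrightarrow> 0"
    using approxD(3)[OF approx_apply[OF AY approx_J[OF h]]] by (simp add: k_def)
  ultimately have "hnorm H (A h - k 0) \<le> 0" by (intro LIMSEQ_le_const) auto
  then have "hnorm H (A h - k 0) = 0"
    using h k by (intro antisym H.hnorm_nonneg) auto
  then have "A h - k 0 = 0"
    using h k H.hnorm_eq_0[of "A h - k 0"] by simp
  then show "(adj H K J \<circ> Y \<circ> J) h = A h"
    using h k by (simp add: adj_J ev_def k_def)
qed

text \<open>Taking partners in \<open>Ps A P = A\<close> gives \<open>V Y U = Y\<close>, and
  \<open>V\<close> inverts \<open>U\<close>.\<close>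

lemma fixed_commutes_U:
  assumes AY: "asym A Y" and fixed: "\<And>x. x \<in> vecs H \<Longrightarrow> Ps (A (P x)) = A x"
  shows "Y \<circ> U = U \<circ> Y"
proof -
  note A = asymD(1)[OF AY] and Y = asymD(2)[OF AY]
  have "Ps \<circ> A \<circ> P = A"
    using fixed bounded_ops_outside[OF A] bounded_ops_outside[OF P] HH.bounded_ops_0[OF A] HH.bounded_ops_0[OF Ps]
    by (auto simp: fun_eq_iff) (metis)
  then have "asym A (V \<circ> Y \<circ> U)"
    using asym_comp[OF asym_comp[OF asym_V AY] asym_U] by simp
  then have eq: "V \<circ> Y \<circ> U = Y" using asym_unique AY by blast
  show ?thesis
  proof
    fix k
    show "(Y \<circ> U) k = (U \<circ> Y) k"
    proof (cases "k \<in> vecs K")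
      case True
      have "V (Y (U k)) = Y k" using eq by (auto simp: fun_eq_iff)
      then have "U (V (Y (U k))) = U (Y k)" by simp
      then show ?thesis using True bounded_ops_vecs[OF Y, of "U k"] by simp
    next
      case False
      then show ?thesis
        using bounded_ops_outside[OF Y False] KK.bounded_ops_0[OF Y] KK.bounded_ops_0[OF U] by (simp add: U_def)
    qed
  qed
qed

text \<open>Prepares norm closedness: partners of a norm convergent sequence are strongly Cauchy.
  The distance from \<open>T (k m)\<close> to the limit is split into three errors, of which the
  first and the last are uniform in \<open>m\<close>.\<close>

lemma asym_op_limit:
  assumes XY: "\<And>n. asym (X n) (Y n)" and T: "T \<in> bounded_ops H H"
    and lim: "(\<lambda>n. opnorm H H (X n - T)) \<longlonglongrightarrow> 0"
  obtains Z where "asym T Z" "\<And>k. k \<in> vecs K \<Longrightarrow> (\<lambda>n. hnorm K (Y n k - Z k)) \<longlonglongrightarrow> 0"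
proof -
  note X = asymD(1)[OF XY]
  define e where "e n = opnorm H H (X n - T)" for n
  have e0: "0 \<le> e n" for n unfolding e_def by (intro HH.opnorm_nonneg HH.bounded_ops_minus X T)
  have e: "hnorm H (X n x - T x) \<le> e n * hnorm H x" if "x \<in> vecs H" for n x
    using HH.opnorm_bound[OF HH.bounded_ops_minus[OF X T] that] by (simp add: e_def)
  have elim: "e \<longlonglongrightarrow> 0" using lim by (simp add: e_def[abs_def])
  have "\<exists>y. approx (\<lambda>m. T (k m)) y" if k: "k \<in> vecs K" for k
  proof -
    have "hnorm K (Y m k - Y n k) \<le> (e m + e n) * hnorm K k" for m n
    proof (rule approx_norm_le[OF approx_diff[OF asymD(3)[OF XY k] asymD(3)[OF XY k]] approx_self[OF k]])
      show "hnorm H (X m (k j) - X n (k j)) \<le> (e m + e n) * hnorm H (k j)" for j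
        using H.hnorm_diff_triangle[of "X m (k j)" "T (k j)" "X n (k j)"]
          H.hnorm_minus_commute[of "T (k j)" "X n (k j)"] e[of "k j" m] e[of "k j" n] k
          bounded_ops_vecs[OF X] bounded_ops_vecs[OF T] by (simp add: distrib_right)
    qed (use e0 in auto)
    note dist = this
    have "\<exists>y. y \<in> vecs K \<and> (\<lambda>n. hnorm K (Y n k - y)) \<longlonglongrightarrow> 0"
    proof (rule K.Cauchy_converges[of "\<lambda>n. Y n k"])
      show "Y n k \<in> vecs K" for n using bounded_ops_vecs[OF asymD(2)[OF XY] k] .
      fix r :: real assume r: "0 < r"
      have "(\<lambda>n. e n * hnorm K k) \<longlonglongrightarrow> 0" using tendsto_mult_right[OF elim] by simp
      from LIMSEQ_D[OF this, of "r / 2"] r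
      obtain N where N: "\<And>n. n \<ge> N \<Longrightarrow> \<bar>e n * hnorm K k\<bar> < r / 2" by auto
      have "hnorm K (Y m k - Y n k) < r" if "m \<ge> N" "n \<ge> N" for m n
        using dist[of m n] N[OF that(1)] N[OF that(2)] by (simp add: distrib_right)
      then show "\<exists>N. \<forall>m\<ge>N. \<forall>n\<ge>N. hnorm K (Y m k - Y n k) < r" by blast
    qed blast
    then obtain y where y: "y \<in> vecs K" "(\<lambda>n. hnorm K (Y n k - y)) \<longlonglongrightarrow> 0" by blast
    have "(\<lambda>m. hnorm H (T (k m) - y m)) \<longlonglongrightarrow> 0"
    proof (rule LIMSEQ_I)
      fix r :: real assume r: "0 < r"
      have "(\<lambda>n. e n * hnorm K k + hnorm K (Y n k - y)) \<longlonglongrightarrow> 0 * hnorm K k + 0"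
        by (intro tendsto_intros elim y)
      from LIMSEQ_D[OF this, of "r / 2"] r
      obtain n where n: "\<bar>e n * hnorm K k + hnorm K (Y n k - y)\<bar> < r / 2" by auto
      have "0 < r / 2" using r by simp
      from LIMSEQ_D[OF approxD(3)[OF asymD(3)[OF XY k]] this] obtain N where
        N: "\<And>m. m \<ge> N \<Longrightarrow> \<bar>hnorm H (X n (k m) - Y n k m)\<bar> < r / 2" by auto
      have yn: "Y n k \<in> vecs K" using bounded_ops_vecs[OF asymD(2)[OF XY] k] .
      have "hnorm H (T (k m) - y m) < r" if "m \<ge> N" for m
      proof -
        have v: "T (k m) \<in> vecs H" "X n (k m) \<in> vecs H" "Y n k m \<in> vecs H" "y m \<in> vecs H"
          using k yn y bounded_ops_vecs[OF X] bounded_ops_vecs[OF T] by auto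
        have "hnorm H (T (k m) - y m) \<le> hnorm H (T (k m) - X n (k m)) + hnorm H (X n (k m) - Y n k m)
          + hnorm H (Y n k m - y m)"
          using H.hnorm_diff_triangle[of "T (k m)" "X n (k m)" "y m"]
            H.hnorm_diff_triangle[of "X n (k m)" "Y n k m" "y m"] v by linarith
        moreover have "hnorm H (T (k m) - X n (k m)) \<le> e n * hnorm K k"
          using e[of "k m" n] H.hnorm_minus_commute[of "T (k m)" "X n (k m)"] v k
            mult_left_mono[OF hnorm_le_K[OF k, of m] e0[of n]] by simp
        moreover have "hnorm H (Y n k m - y m) \<le> hnorm K (Y n k - y)"
          using hnorm_le_K[of "Y n k - y" m] yn y by simp
        ultimately show ?thesis using n N[OF that] by linarith
      qed
      then show "\<exists>N. \<forall>m\<ge>N. norm (hnorm H (T (k m) - y m) - 0) < r"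
        using k y bounded_ops_vecs[OF T] by (intro exI[of _ N]) simp
    qed
    then show ?thesis using k y bounded_ops_vecs[OF T] by (intro exI[of _ y]) (simp add: approx_def)
  qed
  then obtain Z where Z: "asym T Z" using asym_exists[OF T] by blast
  have "(\<lambda>n. hnorm K (Y n k - Z k)) \<longlonglongrightarrow> 0" if k: "k \<in> vecs K" for k
  proof (rule Lim_null_comparison)
    have "hnorm K (Y n k - Z k) \<le> e n * hnorm K k" for n
      by (rule approx_norm_le[OF approx_diff[OF asymD(3)[OF XY k] asymD(3)[OF Z k]] approx_self[OF k]])
        (use e e0 k in auto)
    then show "\<forall>\<^sub>F n in sequentially. norm (hnorm K (Y n k - Z k)) \<le> e n * hnorm K k"
      using bounded_ops_vecs[OF asymD(2)[OF XY] k] bounded_ops_vecs[OF asymD(2)[OF Z] k] by simp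
    show "(\<lambda>n. e n * hnorm K k) \<longlonglongrightarrow> 0" using tendsto_mult_right[OF elim] by simp
  qed
  then show thesis using that Z by blast
qed

end

section \<open>The Taylor spectrum of a commuting normal tuple\<close>

context hilbert_space
begin

interpretation self: hilbert_pair H H by (rule hilbert_pair_self)

text \<open>With respect to the inner product \<open>\<Sum>i. \<langle>T\<^sub>i x, T\<^sub>i y\<rangle>\<close> the space is again a Hilbert space; the Riesz
  representation there inverts \<open>\<Sum>i. T\<^sub>i\<^sup>* T\<^sub>i\<close>.\<close>

lemma coercive_inverse:
  assumes T: "\<And>i. i \<in> I \<Longrightarrow> T i \<in> bounded_ops H H" and c: "0 < c"
    and coercive: "\<And>x. x \<in> vecs H \<Longrightarrow> c * (hnorm H x)\<^sup>2 \<le> (\<Sum>i\<in>I. (hnorm H (T i x))\<^sup>2)"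
  obtains G where "G \<in> bounded_ops H H"
    "\<And>x. x \<in> vecs H \<Longrightarrow> (\<Sum>i\<in>I. adj H H (T i) (T i (G x))) = x"
    "\<And>x. x \<in> vecs H \<Longrightarrow> G (\<Sum>i\<in>I. adj H H (T i) (T i x)) = x"
proof -
  have Tv [simp]: "T i x \<in> vecs H" if "i \<in> I" "x \<in> vecs H" for i x
    using bounded_ops_vecs[OF T] that by blast
  define A where "A x = (\<Sum>i\<in>I. adj H H (T i) (T i x))" for x
  have adjv: "adj H H (T i) x \<in> vecs H" if "i \<in> I" "x \<in> vecs H" for i x
    using bounded_ops_vecs[OF self.adj_bounded_ops[OF T]] that by blast
  have Av: "A x \<in> vecs H" if "x \<in> vecs H" for x
    unfolding A_def using that adjv by (intro vecs_sum) auto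
  have ipA: "ip H (A x) y = (\<Sum>i\<in>I. ip H (T i x) (T i y))" if "x \<in> vecs H" "y \<in> vecs H" for x y
    unfolding A_def using that adjv by (subst ip_sum) (auto intro!: sum.cong self.ip_adj'[symmetric] T)
  have A_add: "A (x + y) = A x + A y" if "x \<in> vecs H" "y \<in> vecs H" for x y
    unfolding A_def sum.distrib[symmetric] using that
    by (intro sum.cong refl) (simp add: bounded_ops_add[OF T] bounded_ops_add[OF self.adj_bounded_ops[OF T]])
  have A_smul: "A (smul H a x) = smul H a (A x)" if "x \<in> vecs H" for x a
    unfolding A_def scale_sum_right using that
    by (intro sum.cong refl) (simp add: bounded_ops_smul[OF T] bounded_ops_smul[OF self.adj_bounded_ops[OF T]])
  define L where "L = H\<lparr>ip := \<lambda>x y. \<Sum>i\<in>I. ip H (T i x) (T i y)\<rparr>"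
  have L [simp]: "vecs L = vecs H" "smul L = smul H" by (simp_all add: L_def)
  have ipL: "ip L x y = (\<Sum>i\<in>I. ip H (T i x) (T i y))" for x y by (simp add: L_def)
  have ReL: "Re (ip L x x) = (\<Sum>i\<in>I. (hnorm H (T i x))\<^sup>2)" if "x \<in> vecs H" for x
    using that by (simp add: ipL hnorm_sq)
  have "pre_hilbert L"
  proof (intro pre_hilbert.intro pre_hilbert_axioms.intro; (unfold L)?)
    show "vector_space (smul H)" by (rule vector_space_axioms)
    show "subspace (vecs H)" by (rule vecs_subspace)
    show "ip L y x = cnj (ip L x y)" if "x \<in> vecs H" "y \<in> vecs H" for x y
      unfolding ipL cnj_sum using that by (intro sum.cong refl ip_cnj) auto
    show "ip L (x + y) z = ip L x z + ip L y z" if "x \<in> vecs H" "y \<in> vecs H" "z \<in> vecs H" for x y z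
      unfolding ipL sum.distrib[symmetric] using that
      by (intro sum.cong refl) (simp add: bounded_ops_add[OF T] ip_add)
    show "ip L (smul H a x) y = a * ip L x y" if "x \<in> vecs H" "y \<in> vecs H" for x y a
      unfolding ipL sum_distrib_left using that
      by (intro sum.cong refl) (simp add: bounded_ops_smul[OF T] ip_smul)
    show "0 \<le> Re (ip L x x)" if "x \<in> vecs H" for x
      using that by (simp add: ReL sum_nonneg)
    show "x = 0" if "x \<in> vecs H" "ip L x x = 0" for x
    proof -
      have "c * (hnorm H x)\<^sup>2 \<le> 0" using coercive[OF that(1)] ReL[OF that(1)] that(2) by simp
      then have "(hnorm H x)\<^sup>2 \<le> 0" using c by (simp add: mult_le_0_iff)
      then show ?thesis using that(1) by simp
    qed
  qed
  then interpret L: pre_hilbert L .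
  \<comment> \<open>Coercivity bounds the norm of \<open>H\<close> by that of \<open>L\<close>, and
    boundedness of the \<open>T i\<close> gives the converse, so completeness carries over to
    \<open>L\<close>.\<close>
  have normL: "sqrt c * hnorm H x \<le> hnorm L x" if "x \<in> vecs H" for x
  proof -
    have "sqrt c * hnorm H x = sqrt (c * (hnorm H x)\<^sup>2)"
      using that by (simp add: real_sqrt_mult)
    also have "\<dots> \<le> hnorm L x"
      unfolding hnorm_def[of L] ReL[OF that] using coercive[OF that] by (rule real_sqrt_le_mono)
    finally show ?thesis .
  qed
  have "hilbert_space L"
  proof (intro hilbert_space.intro hilbert_space_axioms.intro)
    show "Metric_space.mcomplete (vecs L) (hdist L)"
      unfolding L.metric.mcomplete_def
    proof (intro allI impI)
      fix X assume "L.metric.MCauchy X"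
      then have X: "\<And>n. X n \<in> vecs H"
        and Cau: "\<And>e. 0 < e \<Longrightarrow> \<exists>N. \<forall>m\<ge>N. \<forall>n\<ge>N. hnorm L (X m - X n) < e"
        unfolding L.MCauchy_iff by auto
      obtain l where l: "l \<in> vecs H" "(\<lambda>n. hnorm H (X n - l)) \<longlonglongrightarrow> 0"
      proof (rule Cauchy_converges[OF X])
        fix e :: real assume e: "0 < e"
        then obtain N where N: "\<And>m n. m \<ge> N \<Longrightarrow> n \<ge> N \<Longrightarrow> hnorm L (X m - X n) < sqrt c * e"
          using Cau[of "sqrt c * e"] c by auto
        have "hnorm H (X m - X n) < e" if "m \<ge> N" "n \<ge> N" for m n
        proof -
          have "sqrt c * hnorm H (X m - X n) < sqrt c * e"
            using N[OF that] normL[of "X m - X n"] X by simp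
          then show ?thesis using c by simp
        qed
        then show "\<exists>N. \<forall>m\<ge>N. \<forall>n\<ge>N. hnorm H (X m - X n) < e" by blast
      qed blast
      have "(\<lambda>n. hnorm H (T i (X n) - T i l)) \<longlonglongrightarrow> 0" if "i \<in> I" for i
        by (rule self.tendsto_op[OF T[OF that] X l])
      then have "(\<lambda>n. sqrt (\<Sum>i\<in>I. (hnorm H (T i (X n) - T i l))\<^sup>2)) \<longlonglongrightarrow> sqrt (\<Sum>i\<in>I. 0\<^sup>2)"
        by (intro tendsto_real_sqrt tendsto_sum tendsto_power)
      moreover have "hnorm L (X n - l) = sqrt (\<Sum>i\<in>I. (hnorm H (T i (X n) - T i l))\<^sup>2)" for n
        unfolding hnorm_def[of L] using X l
        by (subst ReL) (auto intro!: arg_cong[where f = sqrt] sum.cong simp: self.bounded_ops_diff[OF T])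
      ultimately have "(\<lambda>n. hnorm L (X n - l)) \<longlonglongrightarrow> 0" by simp
      then have "limitin (htopology L) X l sequentially"
        using X l by (subst L.limitin_iff) auto
      then show "\<exists>l. limitin L.metric.mtopology X l sequentially" by (auto simp: htopology_def)
    qed
  qed (assumption | rule L.vector_space_axioms L.vecs_subspace L.ip_cnj L.ip_add L.ip_smul L.ip_nonneg L.ip_definite)+
  then interpret LH: hilbert_space L .
  \<comment> \<open>Riesz in \<open>L\<close> for the functional \<open>x |-> <x, y>\<close> gives
    \<open>z\<close> with \<open><x, y> = <x, A z>\<close>, that is \<open>A z = y\<close>.\<close>
  have surj: "\<exists>z\<in>vecs H. A z = y" if y: "y \<in> vecs H" for y
  proof -
    have "cmod (ip H x y) \<le> (hnorm H y / sqrt c) * hnorm L x" if "x \<in> vecs L" for x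
    proof -
      have x: "x \<in> vecs H" using that by simp
      have "hnorm H x \<le> hnorm L x / sqrt c" using normL[OF x] c by (simp add: field_simps)
      then have "hnorm H x * hnorm H y \<le> (hnorm L x / sqrt c) * hnorm H y"
        using y by (intro mult_right_mono) auto
      then show ?thesis using Cauchy_Schwarz[OF x y] by (simp add: mult.commute)
    qed
    then obtain z where z: "z \<in> vecs H" "\<And>x. x \<in> vecs H \<Longrightarrow> ip H x y = ip L x z"
      using LH.riesz[of "\<lambda>x. ip H x y" "hnorm H y / sqrt c"] y ip_add ip_smul by auto
    have "ip H (A z) x = ip H y x" if x: "x \<in> vecs H" for x
    proof -
      have "ip H (A z) x = ip L z x" using ipA[OF z(1) x] by (simp add: ipL)
      also have "\<dots> = cnj (ip L x z)" using L.ip_cnj[of x z] x z(1) by simp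
      also have "\<dots> = cnj (ip H x y)" using z(2)[OF x] by simp
      also have "\<dots> = ip H y x" using ip_cnj[OF x y] by simp
      finally show ?thesis .
    qed
    from this[of "A z - y"] have "ip H (A z - y) (A z - y) = 0"
      using Av[OF z(1)] y by (simp add: ip_diff)
    then show ?thesis using ip_definite[of "A z - y"] Av[OF z(1)] y z(1) by auto
  qed
  have lower: "c * (hnorm H x)\<^sup>2 \<le> Re (ip H (A x) x)" if "x \<in> vecs H" for x
    using coercive[OF that] ReL[OF that] ipA[OF that that] by (simp add: ipL)
  have inj: "z = z'" if "z \<in> vecs H" "z' \<in> vecs H" "A z = A z'" for z z'
  proof -
    have "A (z - z') = A z + A (smul H (-1) z')"
      using A_add[of z "smul H (-1) z'"] that by simp
    also have "\<dots> = 0" using that(3) A_smul[OF that(2), of "-1"] by simp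
    finally have "c * (hnorm H (z - z'))\<^sup>2 \<le> 0" using lower[of "z - z'"] that by simp
    then have "(hnorm H (z - z'))\<^sup>2 \<le> 0" using c by (simp add: mult_le_0_iff)
    then show ?thesis using that by simp
  qed
  define G where "G y = (if y \<in> vecs H then SOME z. z \<in> vecs H \<and> A z = y else 0)" for y
  have G: "G y \<in> vecs H" "A (G y) = y" if "y \<in> vecs H" for y
    using someI_ex[of "\<lambda>z. z \<in> vecs H \<and> A z = y"] surj[OF that] that by (auto simp: G_def)
  have "G \<in> bounded_ops H H"
  proof (rule self.bounded_opsI)
    show "G (x + y) = G x + G y" if "x \<in> vecs H" "y \<in> vecs H" for x y
      using G that by (intro inj[OF G(1) vecs_add]) (auto simp: A_add)
    show "G (smul H a x) = smul H a (G x)" if "x \<in> vecs H" for x a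
      using G that by (intro inj[OF G(1) vecs_scale]) (auto simp: A_smul)
    show "hnorm H (G y) \<le> (1 / c) * hnorm H y" if y: "y \<in> vecs H" for y
    proof (cases "G y = 0")
      case False
      have n: "hnorm H (G y) > 0"
        using False G(1)[OF y] hnorm_nonneg[of "G y"] hnorm_eq_0[of "G y"] by linarith
      have "c * (hnorm H (G y))\<^sup>2 \<le> Re (ip H y (G y))" using lower[OF G(1)[OF y]] G(2)[OF y] by simp
      also have "\<dots> \<le> hnorm H y * hnorm H (G y)" using Re_ip_le[OF y G(1)[OF y]] .
      finally have "(c * hnorm H (G y)) * hnorm H (G y) \<le> hnorm H y * hnorm H (G y)"
        by (simp add: power2_eq_square mult.assoc)
      then have "c * hnorm H (G y) \<le> hnorm H y" using n by simp
      then show ?thesis using c by (simp add: field_simps)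
    qed (use y c in simp)
    show "G x \<in> vecs H" if "x \<in> vecs H" for x by (rule G(1)[OF that])
    show "G x = 0" if "x \<notin> vecs H" for x using that by (simp add: G_def)
  qed
  moreover have "G (A x) = x" if "x \<in> vecs H" for x
    using G[OF Av[OF that]] that inj by blast
  ultimately show thesis using that G(2) by (simp add: A_def)
qed

text \<open>If \<open>\<Sum>i. T\<^sub>i\<^sup>* T\<^sub>i\<close> with \<open>T\<^sub>i = R\<^sub>i - w\<^sub>i\<close> has an inverse \<open>G\<close>, then the operators \<open>G T\<^sub>i\<^sup>*\<close> give a contracting
  homotopy of the Koszul complex.\<close>

lemma taylor_spectrum_approx_eigenvector:
  assumes R: "\<And>i. i \<in> {1..d} \<Longrightarrow> R i \<in> bounded_ops H H"
    and comm: "\<And>i j. \<lbrakk>i \<in> {1..d}; j \<in> {1..d}\<rbrakk> \<Longrightarrow> R i \<circ> R j = R j \<circ> R i"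
    and normal: "\<And>i j. \<lbrakk>i \<in> {1..d}; j \<in> {1..d}\<rbrakk> \<Longrightarrow> adj H H (R i) \<circ> R j = R j \<circ> adj H H (R i)"
    and w: "w \<in> taylor_spectrum d H R" and e: "0 < e"
  shows "\<exists>x\<in>vecs H. hnorm H x = 1 \<and> (\<forall>i\<in>{1..d}. hnorm H (R i x - smul H (w i) x) < e)"
proof (rule ccontr)
  assume no: "\<not> ?thesis"
  define T where "T i = R i - opscale H (w i) (idop H)" for i
  have T: "T i \<in> bounded_ops H H" if "i \<in> {1..d}" for i
    unfolding T_def using R[OF that] by (intro self.bounded_ops_minus self.bounded_ops_opscale bounded_ops_idop)
  have Tx: "T i x = R i x - smul H (w i) x" if "x \<in> vecs H" for i x
    using that by (simp add: T_def opscale_def idop_def)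
  \<comment> \<open>Without approximate eigenvectors for \<open>e\<close>, at each unit vector some
    \<open>T i\<close> has norm at least \<open>e\<close>; hence the constant
    \<open>e^2\<close>.\<close>
  have coercive: "e\<^sup>2 * (hnorm H x)\<^sup>2 \<le> (\<Sum>i\<in>{1..d}. (hnorm H (T i x))\<^sup>2)" if x: "x \<in> vecs H" for x
  proof (cases "x = 0")
    case False
    define n where "n = hnorm H x"
    have n: "n > 0" using False x hnorm_nonneg[of x] hnorm_eq_0[of x] unfolding n_def by linarith
    define y where "y = smul H (of_real (1 / n)) x"
    have y: "y \<in> vecs H" and y1: "hnorm H y = 1"
      using x n by (auto simp: y_def hnorm_smul norm_divide n_def[symmetric])
    then obtain i where i: "i \<in> {1..d}" "\<not> hnorm H (R i y - smul H (w i) y) < e" using no by blast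
    have "hnorm H (T i y) = (1 / n) * hnorm H (T i x)"
      unfolding y_def using bounded_ops_smul[OF T[OF i(1)] x] bounded_ops_vecs[OF T[OF i(1)] x] n
      by (simp add: hnorm_smul norm_divide)
    moreover have "e * n \<le> hnorm H (T i y) * n" using i(2) Tx[OF y] n by simp
    ultimately have "e * n \<le> hnorm H (T i x)" using n by simp
    then have "(e * n)\<^sup>2 \<le> (hnorm H (T i x))\<^sup>2" using e n by (intro power_mono) auto
    also have "\<dots> \<le> (\<Sum>i\<in>{1..d}. (hnorm H (T i x))\<^sup>2)"
      using i(1) by (intro member_le_sum) auto
    finally show ?thesis by (simp add: n_def power_mult_distrib)
  qed (simp add: sum_nonneg)
  have "0 < e\<^sup>2" using e by simp
  obtain G where G: "G \<in> bounded_ops H H"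
    "\<And>x. x \<in> vecs H \<Longrightarrow> (\<Sum>i\<in>{1..d}. adj H H (T i) (T i (G x))) = x"
    "\<And>x. x \<in> vecs H \<Longrightarrow> G (\<Sum>i\<in>{1..d}. adj H H (T i) (T i x)) = x"
    using coercive_inverse[OF T \<open>0 < e\<^sup>2\<close> coercive] by blast
  note Rv = bounded_ops_vecs[OF R] and Tv = bounded_ops_vecs[OF T]
    and Nv = bounded_ops_vecs[OF self.adj_bounded_ops[OF T]] and NRv = bounded_ops_vecs[OF self.adj_bounded_ops[OF R]]
  have adjT: "adj H H (T i) x = adj H H (R i) x - smul H (cnj (w i)) x" if i: "i \<in> {1..d}" and x: "x \<in> vecs H" for i x
  proof -
    have "T i = R i + opscale H (- w i) (idop H)" by (simp add: T_def opscale_def fun_eq_iff)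
    then have "adj H H (T i) = adj H H (R i) + opscale H (cnj (- w i)) (idop H)"
      using R[OF i] by (simp add: adj_plus adj_opscale adj_idop bounded_ops_idop self.bounded_ops_opscale)
    then show ?thesis using x by (simp add: opscale_def idop_def)
  qed
  have TT: "T i (T j x) = T j (T i x)" if "i \<in> {1..d}" "j \<in> {1..d}" "x \<in> vecs H" for i j x
  proof -
    have "R i (R j x) = R j (R i x)" using fun_cong[OF comm[OF that(1,2)], of x] by simp
    then show ?thesis
      using that Rv by (simp add: Tx self.bounded_ops_diff[OF R] bounded_ops_smul[OF R] scale_right_diff_distrib
          scale_left_commute algebra_simps)
  qed
  have NT: "adj H H (T i) (T j x) = T j (adj H H (T i) x)" if "i \<in> {1..d}" "j \<in> {1..d}" "x \<in> vecs H" for i j x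
  proof -
    have "adj H H (R i) (R j x) = R j (adj H H (R i) x)" using fun_cong[OF normal[OF that(1,2)], of x] by simp
    then show ?thesis
      using that Rv NRv Tv Nv
      by (simp add: Tx adjT self.bounded_ops_diff[OF R] bounded_ops_smul[OF R] scale_right_diff_distrib
          self.bounded_ops_diff[OF self.adj_bounded_ops[OF R]] bounded_ops_smul[OF self.adj_bounded_ops[OF R]]
          scale_left_commute algebra_simps)
  qed
  define A where "A x = (\<Sum>i\<in>{1..d}. adj H H (T i) (T i x))" for x
  have Av: "A x \<in> vecs H" if "x \<in> vecs H" for x
    unfolding A_def using that Tv Nv by (intro vecs_sum) auto
  \<comment> \<open>\<open>A\<close> commutes with every \<open>T j\<close>, hence so does its
    inverse \<open>G\<close>; this is half of the commutation of \<open>B i\<close> with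
    \<open>T j\<close>.\<close>
  have TA: "T j (A x) = A (T j x)" if "j \<in> {1..d}" "x \<in> vecs H" for j x
  proof -
    have "T j (A x) = (\<Sum>i\<in>{1..d}. T j (adj H H (T i) (T i x)))"
      unfolding A_def using that Tv Nv by (intro self.bounded_ops_sum T) auto
    also have "\<dots> = A (T j x)"
      unfolding A_def using that Tv by (intro sum.cong refl) (simp add: NT[symmetric] TT)
    finally show ?thesis .
  qed
  have Gv: "G x \<in> vecs H" if "x \<in> vecs H" for x using bounded_ops_vecs[OF G(1) that] .
  have AG: "A (G x) = x" and GA: "G (A x) = x" if "x \<in> vecs H" for x
    using G(2,3)[OF that] by (simp_all add: A_def)
  have GT: "G (T j x) = T j (G x)" if "j \<in> {1..d}" "x \<in> vecs H" for j x
  proof -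
    have "T j (G x) = G (A (T j (G x)))" using that Tv Gv by (simp add: GA)
    also have "\<dots> = G (T j x)" using that Gv by (simp add: TA[symmetric] AG)
    finally show ?thesis by simp
  qed
  define B where "B i = G \<circ> adj H H (T i)" for i
  have B: "B i \<in> bounded_ops H H" if "i \<in> {1..d}" for i
    unfolding B_def by (intro ops_comp
        self.adj_bounded_ops T that G)
  have "koszul_exact d H T"
  proof (rule koszul_exactI[OF T B])
    show "T i \<circ> T j = T j \<circ> T i" if "i \<in> {1..d}" "j \<in> {1..d}" for i j
      using ops_comp[OF T T] that TT
      by (intro bounded_ops_ext[of _ H H]) auto
    show "B i \<circ> T j = T j \<circ> B i" if "i \<in> {1..d}" "j \<in> {1..d}" for i j
    proof (rule bounded_ops_ext[of _ H H])
      show "B i \<circ> T j \<in> bounded_ops H H" "T j \<circ> B i \<in> bounded_ops H H"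
        using ops_comp T B that by blast+
      show "(B i \<circ> T j) x = (T j \<circ> B i) x" if "x \<in> vecs H" for x
        using \<open>i \<in> {1..d}\<close> \<open>j \<in> {1..d}\<close> that Nv by (simp add: B_def NT GT)
    qed
    show "(\<Sum>j\<in>{1..d}. B j (T j x)) = x" if x: "x \<in> vecs H" for x
    proof -
      have "G (A x) = (\<Sum>j\<in>{1..d}. G (adj H H (T j) (T j x)))"
        unfolding A_def using x Tv Nv by (intro self.bounded_ops_sum G) auto
      then show ?thesis using GA[OF x] by (simp add: B_def)
    qed
  qed
  then have "koszul_exact d H (\<lambda>i. R i - opscale H (w i) (idop H))" by (simp add: T_def[abs_def])
  then show False using w by (simp add: taylor_spectrum_def)
qed

end

section \<open>Polynomials in a commuting tuple\<close>

context pre_hilbert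
begin

interpretation self: pre_hilbert_pair H H by (rule pre_hilbert_pair_self)

lemma poly_act_superset:
  assumes "finite B" "Poly_Mapping.keys f \<subseteq> B"
  shows "poly_act d H S f h = (\<Sum>m\<in>B. smul H (Poly_Mapping.lookup f m) (monomial_act d S m h))"
  unfolding poly_act_def using assms
  by (intro sum.mono_neutral_left) (auto simp: in_keys_iff)

lemma poly_act_add: "poly_act d H S (f + g) h = poly_act d H S f h + poly_act d H S g h"
proof -
  let ?B = "Poly_Mapping.keys f \<union> Poly_Mapping.keys g"
  have "finite ?B" by simp
  then show ?thesis
    using keys_add[of f g]
    by (simp add: poly_act_superset[of ?B] lookup_add scale_left_distrib sum.distrib)
qed

lemma poly_act_single: "poly_act d H S (Poly_Mapping.single m c) h = smul H c (monomial_act d S m h)"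
  by (subst poly_act_superset[of "{m}"]) auto

end

lemma monomial_act_0: "monomial_act d S 0 h = h"
proof -
  have "foldr (\<lambda>i x. (S i ^^ Poly_Mapping.lookup 0 i) x) xs h = h" for xs
    by (induction xs) auto
  then show ?thesis by (simp add: monomial_act_def)
qed

lemma monomial_act_add_single:
  assumes comm: "\<And>j. j \<in> {1..d} \<Longrightarrow> S i \<circ> S j = S j \<circ> S i" and i: "i \<in> {1..d}"
  shows "monomial_act d S (m + Poly_Mapping.single i 1) h = S i (monomial_act d S m h)"
proof -
  have pow: "S i ((S j ^^ n) x) = (S j ^^ n) (S i x)" if "j \<in> {1..d}" for j n x
    using comm[OF that] by (induction n) (auto simp: fun_eq_iff)
  have "foldr (\<lambda>j x. (S j ^^ Poly_Mapping.lookup (m + Poly_Mapping.single i 1) j) x) xs h =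
    (if i \<in> set xs then S i (foldr (\<lambda>j x. (S j ^^ Poly_Mapping.lookup m j) x) xs h)
     else foldr (\<lambda>j x. (S j ^^ Poly_Mapping.lookup m j) x) xs h)"
    if "distinct xs" "set xs \<subseteq> {1..d}" for xs
    using that
    by (induction xs) (auto simp: lookup_add lookup_single when_def pow funpow_swap1)
  moreover have "set [1..<Suc d] = {1..d}" by auto
  ultimately show ?thesis using i unfolding monomial_act_def by (simp add: atLeastLessThanSuc_atLeastAtMost del: upt_Suc)
qed

lemma monomial_act_single:
  assumes "\<And>j. j \<in> {1..d} \<Longrightarrow> S i \<circ> S j = S j \<circ> S i" "i \<in> {1..d}"
  shows "monomial_act d S (Poly_Mapping.single i 1) h = S i h"
  using monomial_act_add_single[of d S i 0 h] assms by (simp add: monomial_act_0)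

context pre_hilbert
begin

interpretation self: pre_hilbert_pair H H by (rule pre_hilbert_pair_self)

text \<open>Each application of some \<open>R i\<close> multiplies the scalar by \<open>w i\<close>
  up to a vanishing error, so the estimate is carried through powers, monomials and sums with an
  accumulated scalar \<open>c\<close>.\<close>

lemma poly_act_eigenvector_tendsto:
  assumes R: "\<And>i. i \<in> {1..d} \<Longrightarrow> R i \<in> bounded_ops H H"
    and X: "\<And>n. X n \<in> vecs H"
    and eig: "\<And>i. i \<in> {1..d} \<Longrightarrow> (\<lambda>n. hnorm H (R i (X n) - smul H (w i) (X n))) \<longlonglongrightarrow> 0"
  shows "(\<lambda>n. hnorm H (poly_act d H R f (X n) - smul H (poly_eval d f w) (X n))) \<longlonglongrightarrow> 0"
proof -
  have step: "(\<lambda>n. hnorm H (R i (Y n) - smul H (w i * c) (X n))) \<longlonglongrightarrow> 0"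
    if i: "i \<in> {1..d}" and Y: "\<And>n. Y n \<in> vecs H" and lim: "(\<lambda>n. hnorm H (Y n - smul H c (X n))) \<longlonglongrightarrow> 0"
    for i Y c
  proof (rule Lim_null_comparison)
    note Rv = bounded_ops_vecs[OF R[OF i]]
    have "hnorm H (R i (Y n) - smul H (w i * c) (X n)) \<le>
      opnorm H H (R i) * hnorm H (Y n - smul H c (X n)) + cmod c * hnorm H (R i (X n) - smul H (w i) (X n))" for n
    proof -
      have "R i (Y n) - smul H (w i * c) (X n) = R i (Y n - smul H c (X n)) + smul H c (R i (X n) - smul H (w i) (X n))"
        using X Y by (simp add: self.bounded_ops_diff[OF R[OF i]] bounded_ops_smul[OF R[OF i]]
            scale_right_diff_distrib mult.commute)
      then show ?thesis
        using hnorm_triangle[of "R i (Y n - smul H c (X n))" "smul H c (R i (X n) - smul H (w i) (X n))"]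
          self.opnorm_bound[OF R[OF i], of "Y n - smul H c (X n)"] X Y Rv
          hnorm_smul[of "R i (X n) - smul H (w i) (X n)" c]
        by (simp del: scale_right_diff_distrib)
    qed
    then show "\<forall>\<^sub>F n in sequentially. norm (hnorm H (R i (Y n) - smul H (w i * c) (X n))) \<le>
      opnorm H H (R i) * hnorm H (Y n - smul H c (X n)) + cmod c * hnorm H (R i (X n) - smul H (w i) (X n))"
      using X Y Rv by simp
    have "(\<lambda>n. opnorm H H (R i) * hnorm H (Y n - smul H c (X n)) + cmod c * hnorm H (R i (X n) - smul H (w i) (X n)))
      \<longlonglongrightarrow> opnorm H H (R i) * 0 + cmod c * 0"
      by (intro tendsto_intros lim eig i)
    then show "(\<lambda>n. opnorm H H (R i) * hnorm H (Y n - smul H c (X n)) + cmod c * hnorm H (R i (X n) - smul H (w i) (X n)))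
      \<longlonglongrightarrow> 0" by simp
  qed
  have pow: "(\<forall>n. (R i ^^ p) (Y n) \<in> vecs H) \<and>
      (\<lambda>n. hnorm H ((R i ^^ p) (Y n) - smul H (w i ^ p * c) (X n))) \<longlonglongrightarrow> 0"
    if i: "i \<in> {1..d}" and Y: "\<And>n. Y n \<in> vecs H" and lim: "(\<lambda>n. hnorm H (Y n - smul H c (X n))) \<longlonglongrightarrow> 0"
    for i Y c p
  proof (induction p)
    case (Suc p)
    then show ?case using step[OF i, of "\<lambda>n. (R i ^^ p) (Y n)" "w i ^ p * c"] bounded_ops_vecs[OF R[OF i]]
      by (simp add: mult.assoc)
  qed (use Y lim in auto)
  have fold: "(\<forall>n. foldr (\<lambda>i x. (R i ^^ Poly_Mapping.lookup m i) x) xs (X n) \<in> vecs H) \<and>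
    (\<lambda>n. hnorm H (foldr (\<lambda>i x. (R i ^^ Poly_Mapping.lookup m i) x) xs (X n) -
      smul H (\<Prod>i\<in>set xs. w i ^ Poly_Mapping.lookup m i) (X n))) \<longlonglongrightarrow> 0"
    if "distinct xs" "set xs \<subseteq> {1..d}" for xs m
    using that
  proof (induction xs)
    case (Cons i xs)
    define Y where "Y n = foldr (\<lambda>i x. (R i ^^ Poly_Mapping.lookup m i) x) xs (X n)" for n
    have "\<And>n. Y n \<in> vecs H"
      "(\<lambda>n. hnorm H (Y n - smul H (\<Prod>i\<in>set xs. w i ^ Poly_Mapping.lookup m i) (X n))) \<longlonglongrightarrow> 0"
      using Cons by (auto simp: Y_def)
    from pow[OF _ this, of i "Poly_Mapping.lookup m i"] show ?case
      using Cons.prems by (simp add: Y_def)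
  qed (use X in simp)
  have set_d: "set [1..<Suc d] = {1..d}" by auto
  have mon: "\<forall>n. monomial_act d R m (X n) \<in> vecs H"
    "(\<lambda>n. hnorm H (monomial_act d R m (X n) - smul H (\<Prod>i\<in>{1..d}. w i ^ Poly_Mapping.lookup m i) (X n))) \<longlonglongrightarrow> 0" for m
    using fold[of "[1..<Suc d]" m] unfolding set_d monomial_act_def by (simp_all del: upt_Suc)
  define D where "D m n = monomial_act d R m (X n) - smul H (\<Prod>i\<in>{1..d}. w i ^ Poly_Mapping.lookup m i) (X n)" for m n
  have Dv: "D m n \<in> vecs H" for m n using mon(1) X by (simp add: D_def)
  have eq: "poly_act d H R f (X n) - smul H (poly_eval d f w) (X n) =
    (\<Sum>m\<in>Poly_Mapping.keys f. smul H (Poly_Mapping.lookup f m) (D m n))" for n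
    by (simp add: poly_act_def poly_eval_def D_def scale_sum_left scale_right_diff_distrib sum_subtractf)
  show ?thesis unfolding eq
  proof (rule Lim_null_comparison)
    have "hnorm H (\<Sum>m\<in>Poly_Mapping.keys f. smul H (Poly_Mapping.lookup f m) (D m n)) \<le>
      (\<Sum>m\<in>Poly_Mapping.keys f. cmod (Poly_Mapping.lookup f m) * hnorm H (D m n))" for n
      using hnorm_sum_le[of "Poly_Mapping.keys f" "\<lambda>m. smul H (Poly_Mapping.lookup f m) (D m n)"] Dv
      by (simp add: hnorm_smul)
    then show "\<forall>\<^sub>F n in sequentially. norm (hnorm H (\<Sum>m\<in>Poly_Mapping.keys f. smul H (Poly_Mapping.lookup f m) (D m n))) \<le>
      (\<Sum>m\<in>Poly_Mapping.keys f. cmod (Poly_Mapping.lookup f m) * hnorm H (D m n))"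
      using Dv vecs_sum[of "Poly_Mapping.keys f" "\<lambda>m. smul H (Poly_Mapping.lookup f m) (D m _)"]
      by (intro always_eventually allI) simp
    show "(\<lambda>n. \<Sum>m\<in>Poly_Mapping.keys f. cmod (Poly_Mapping.lookup f m) * hnorm H (D m n)) \<longlonglongrightarrow> 0"
      using mon(2) by (intro tendsto_null_sum tendsto_mult_right_zero) (simp add: D_def)
  qed
qed

end

text \<open>At approximate joint eigenvectors of norm \<open>1\<close>, contractivity bounds
  \<open>|f w|\<close> by the supremum of \<open>|f|\<close> on \<open>Gamma d\<close>, so
  \<open>w\<close> lies in the polynomial hull; isometry of the last entry gives
  \<open>|w d| = 1\<close>.\<close>

lemma taylor_spectrum_subset_Gamma:
  assumes K: "contractive_hilbert_module d K R"
    and normal: "\<And>i j. \<lbrakk>i \<in> {1..d}; j \<in> {1..d}\<rbrakk> \<Longrightarrow> adj K K (R i) \<circ> R j = R j \<circ> adj K K (R i)"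
    and isometric: "\<And>x. x \<in> vecs K \<Longrightarrow> hnorm K (R d x) = hnorm K x" and d: "1 \<le> d"
  shows "taylor_spectrum d K R \<subseteq> bGamma d"
proof
  fix w assume w: "w \<in> taylor_spectrum d K R"
  have "hilbert_space K" using K by (simp add: contractive_hilbert_module_def)
  then interpret hilbert_space K .
  have R: "R i \<in> bounded_ops K K" if "i \<in> {1..d}" for i
    using K that by (auto simp: contractive_hilbert_module_def commuting_tuple_def)
  have comm: "R i \<circ> R j = R j \<circ> R i" if "i \<in> {1..d}" "j \<in> {1..d}" for i j
    using K that unfolding contractive_hilbert_module_def commuting_tuple_def by blast
  have "\<exists>x\<in>vecs K. hnorm K x = 1 \<and> (\<forall>i\<in>{1..d}. hnorm K (R i x - smul K (w i) x) < 1 / real (Suc n))" for n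
    using taylor_spectrum_approx_eigenvector[OF R comm normal w] by simp
  then obtain X where X: "\<And>n. X n \<in> vecs K" "\<And>n. hnorm K (X n) = 1"
    and lt: "\<And>n i. i \<in> {1..d} \<Longrightarrow> hnorm K (R i (X n) - smul K (w i) (X n)) < 1 / real (Suc n)" by metis
  have eig: "(\<lambda>n. hnorm K (R i (X n) - smul K (w i) (X n))) \<longlonglongrightarrow> 0" if i: "i \<in> {1..d}" for i
  proof (rule Lim_null_comparison)
    show "\<forall>\<^sub>F n in sequentially. norm (hnorm K (R i (X n) - smul K (w i) (X n))) \<le> 1 / real (Suc n)"
      using less_imp_le[OF lt[OF i]] X bounded_ops_vecs[OF R[OF i]] by (intro always_eventually allI) simp
    show "(\<lambda>n. 1 / real (Suc n)) \<longlonglongrightarrow> 0" by (rule LIMSEQ_Suc[OF lim_1_over_n])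
  qed
  interpret self: pre_hilbert_pair K K by (rule pre_hilbert_pair_self)
  have "cmod (poly_eval d f w) \<le> (SUP z\<in>Gamma d. cmod (poly_eval d f z))" if f: "f \<in> polys d" for f
  proof -
    let ?M = "SUP z\<in>Gamma d. cmod (poly_eval d f z)"
    define \<delta> where "\<delta> n = hnorm K (poly_act d K R f (X n) - smul K (poly_eval d f w) (X n))" for n
    have fv: "poly_act d K R f x \<in> vecs K" if x: "x \<in> vecs K" for x
    proof -
      have "(R i ^^ p) y \<in> vecs K" if "i \<in> {1..d}" "y \<in> vecs K" for i p y
        using that by (induction p) (auto simp: bounded_ops_vecs[OF R])
      then have "foldr (\<lambda>i x. (R i ^^ Poly_Mapping.lookup m i) x) xs x \<in> vecs K" if "set xs \<subseteq> {1..d}" for xs m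
        using that x by (induction xs) auto
      then have "monomial_act d R m x \<in> vecs K" for m
        unfolding monomial_act_def by (simp add: atLeastLessThanSuc_atLeastAtMost del: upt_Suc)
      then show ?thesis unfolding poly_act_def by (intro vecs_sum vecs_scale)
    qed
    have "cmod (poly_eval d f w) \<le> ?M + \<delta> n" for n
    proof -
      have "cmod (poly_eval d f w) = hnorm K (smul K (poly_eval d f w) (X n))"
        using X by (simp add: hnorm_smul)
      also have "\<dots> \<le> hnorm K (poly_act d K R f (X n)) + \<delta> n"
        using hnorm_reverse_triangle[of "poly_act d K R f (X n)" "smul K (poly_eval d f w) (X n)"] X fv
        by (simp add: \<delta>_def)
      also have "hnorm K (poly_act d K R f (X n)) \<le> ?M"
        using K f X unfolding contractive_hilbert_module_def by (metis mult.right_neutral)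
      finally show ?thesis by simp
    qed
    moreover have "(\<lambda>n. ?M + \<delta> n) \<longlonglongrightarrow> ?M + 0"
      unfolding \<delta>_def by (intro tendsto_intros poly_act_eigenvector_tendsto R X eig)
    ultimately show ?thesis by (intro LIMSEQ_le_const) auto
  qed
  then have "w \<in> Gamma d"
    using w by (intro Gamma_polynomially_convex) (auto simp: taylor_spectrum_def)
  moreover have "cmod (w d) = 1"
  proof -
    have dd: "d \<in> {1..d}" using d by simp
    have "\<bar>1 - cmod (w d)\<bar> \<le> hnorm K (R d (X n) - smul K (w d) (X n))" for n
      using hnorm_reverse_triangle[of "R d (X n)" "smul K (w d) (X n)"] X isometric bounded_ops_vecs[OF R[OF dd]]
      by (simp add: hnorm_smul)
    then have "\<bar>1 - cmod (w d)\<bar> \<le> 0" by (intro LIMSEQ_le_const[OF eig[OF dd]]) auto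
    then show ?thesis by simp
  qed
  ultimately show "w \<in> bGamma d" by (simp add: bGamma_def)
qed

section \<open>The canonical unitary module\<close>

text \<open>Comparison of orders at \<open>t = 0\<close>: any \<open>s\<close> above
  \<open>M\<close> makes \<open>t = r / s\<close> a contradiction unless \<open>r = 0\<close>. It
  isolates first order terms in the computation of adjoints.\<close>

lemma linear_le_quadratic_imp_zero:
  fixes r M :: real
  assumes "\<And>t. t * r \<le> t\<^sup>2 * M"
  shows "r = 0"
proof (rule ccontr)
  assume r: "r \<noteq> 0"
  define s where "s = \<bar>M\<bar> + 1"
  have s: "s > 0" "M < s" by (auto simp: s_def)
  have "(r / s) * r \<le> (r / s)\<^sup>2 * M" by (rule assms)
  also have "\<dots> < (r / s)\<^sup>2 * s" using s r by (intro mult_strict_left_mono) auto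
  also have "\<dots> = (r / s) * r" using s by (simp add: power2_eq_square)
  finally show False by simp
qed

lemma poly_eval_var: "i \<in> {1..d} \<Longrightarrow> poly_eval d (Poly_Mapping.single (Poly_Mapping.single i 1) c) z = c * z i"
  by (simp add: poly_eval_single prod_power_single[simplified])

lemma cmod_Gamma_last_le:
  assumes w: "w \<in> Gamma d" and "1 \<le> d"
  shows "cmod (w d) \<le> 1"
proof -
  obtain z where z: "\<And>j. j \<in> {1..d} \<Longrightarrow> cmod (z j) \<le> 1" and wz: "w = restrict (\<lambda>k. esym d k z) {1..d}"
    using w unfolding Gamma_def by blast
  have "cmod (esym d d z) \<le> 1"
    unfolding esym_last prod_norm[symmetric] using z by (intro prod_le_1) auto
  then show ?thesis using assms(2) by (simp add: wz)
qed

locale gamma_module =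
  fixes d :: nat and H :: "'a::ab_group_add hspace" and S :: "nat \<Rightarrow> 'a \<Rightarrow> 'a" and Q :: "'a \<Rightarrow> 'a"
  assumes d2: "2 \<le> d" and contractive: "contractive_hilbert_module d H S"
    and sot: "sot_limit H (adj_powers H (S d)) Q"
begin

lemma S: "i \<in> {1..d} \<Longrightarrow> S i \<in> bounded_ops H H"
  using contractive by (auto simp: contractive_hilbert_module_def commuting_tuple_def)

lemma S_comm: "\<lbrakk>i \<in> {1..d}; j \<in> {1..d}\<rbrakk> \<Longrightarrow> S i \<circ> S j = S j \<circ> S i"
  using contractive unfolding contractive_hilbert_module_def commuting_tuple_def by blast

lemma d_in: "d \<in> {1..d}"
  using d2 by simp

lemma contraction: "contraction H (S d) Q"
proof -
  interpret hilbert_space H using contractive by (simp add: contractive_hilbert_module_def)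
  show ?thesis
  proof
    show "S d \<in> bounded_ops H H" by (rule S[OF d_in])
    show "sot_limit H (adj_powers H (S d)) Q" by (rule sot)
    fix h assume h: "h \<in> vecs H"
    let ?f = "Poly_Mapping.single (Poly_Mapping.single d 1) (1::complex)"
    have "?f \<in> polys d" using d_in by (intro polys_single) auto
    then have "hnorm H (poly_act d H S ?f h) \<le> (SUP z\<in>Gamma d. cmod (poly_eval d ?f z)) * hnorm H h"
      using contractive h by (auto simp: contractive_hilbert_module_def)
    also have "\<dots> \<le> 1 * hnorm H h"
    proof (rule mult_right_mono[OF cSUP_least[OF Gamma_nonempty]])
      show "cmod (poly_eval d ?f z) \<le> 1" if "z \<in> Gamma d" for z
      proof -
        have "cmod (z d) \<le> 1" by (rule cmod_Gamma_last_le[OF that]) (use d2 in simp)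
        then show ?thesis by (simp only: poly_eval_var[OF d_in]) simp
      qed
    qed (use h in simp)
    finally show "hnorm H (S d h) \<le> hnorm H h"
      using monomial_act_single[of d S d h] S_comm d_in by (simp only: poly_act_single) simp
  qed
qed

section \<open>The tuple of partners and the unitary module\<close>

sublocale contraction H "S d" Q
  by (rule contraction)

definition R :: "nat \<Rightarrow> (nat \<Rightarrow> 'a) \<Rightarrow> nat \<Rightarrow> 'a" where
  "R i = (SOME Y. asym (S i) Y)"

lemma asym_R: "i \<in> {1..d} \<Longrightarrow> asym (S i) (R i)"
proof -
  assume i: "i \<in> {1..d}"
  obtain Y where "asym (S i) Y" using asym_commuting[OF S[OF i] S_comm[OF i d_in]] by blast
  then show ?thesis unfolding R_def by (rule someI[of "asym (S i)"])
qed

lemma R: "i \<in> {1..d} \<Longrightarrow> R i \<in> bounded_ops K K"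
  using asymD(2)[OF asym_R] .

lemma R_vecs: "i \<in> {1..d} \<Longrightarrow> k \<in> vecs K \<Longrightarrow> R i k \<in> vecs K"
  using bounded_ops_vecs[OF R] .

lemma R_d: "R d = U"
  using asym_unique[OF asym_R[OF d_in] asym_U] .

text \<open>Algebraic identities between the \<open>S i\<close> transfer by uniqueness: both
  products are partners of one and the same operator.\<close>

lemma R_comm: "\<lbrakk>i \<in> {1..d}; j \<in> {1..d}\<rbrakk> \<Longrightarrow> R i \<circ> R j = R j \<circ> R i"
  using asym_unique[OF asym_comp[OF asym_R asym_R]] asym_comp[OF asym_R asym_R] S_comm by metis

lemma approx_poly_act:
  assumes k: "approx x k"
  shows "approx (\<lambda>n. poly_act d H S f (x n)) (poly_act d K R f k)"
proof -
  have pow: "approx (\<lambda>n. (S i ^^ p) (y n)) ((R i ^^ p) l)" if "i \<in> {1..d}" "approx y l" for i p y l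
    using that by (induction p) (auto intro: approx_apply[OF asym_R])
  have "approx (\<lambda>n. foldr (\<lambda>i x. (S i ^^ Poly_Mapping.lookup m i) x) xs (x n))
    (foldr (\<lambda>i x. (R i ^^ Poly_Mapping.lookup m i) x) xs k)" if "set xs \<subseteq> {1..d}" for xs m
    using that k by (induction xs) (auto intro!: pow)
  then have "approx (\<lambda>n. monomial_act d S m (x n)) (monomial_act d R m k)" for m
    unfolding monomial_act_def by (simp add: atLeastLessThanSuc_atLeastAtMost del: upt_Suc)
  then show ?thesis unfolding poly_act_def by (intro approx_sum approx_smul)
qed

text \<open>The inequality for \<open>S\<close> holds at each coordinate \<open>k n\<close> with the
  same supremum, and it survives the limit.\<close>

lemma contractive_K: "contractive_hilbert_module d K R"
  unfolding contractive_hilbert_module_def commuting_tuple_def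
proof (intro conjI ballI hilbert_space_K R R_comm)
  fix f k assume f: "f \<in> polys d" and k: "k \<in> vecs K"
  show "hnorm K (poly_act d K R f k) \<le> (SUP z\<in>Gamma d. cmod (poly_eval d f z)) * hnorm K k"
    by (rule approx_norm_le[OF approx_poly_act[OF approx_self[OF k]] approx_self[OF k]])
      (use contractive f k SUP_poly_eval_nonneg in \<open>auto simp: contractive_hilbert_module_def\<close>)
qed

lemma second_order_bound:
  assumes i: "i \<in> {1..d - 1}" and x: "x \<in> vecs K"
  shows "hnorm K (U x + smul K l (R (d - i) x) - smul K (cnj l) (U (R i x)))
    \<le> sqrt (1 + 4 * (cmod l * 2 ^ d)\<^sup>2) * hnorm K x"
proof -
  have ij: "i \<in> {1..d}" "d - i \<in> {1..d}" using i by auto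
  let ?X = "\<lambda>j. Poly_Mapping.single j (1::nat)"
  let ?f = "Poly_Mapping.single (?X d) 1 + Poly_Mapping.single (?X (d - i)) l
    + Poly_Mapping.single (?X d + ?X i) (- cnj l)"
  have f: "?f \<in> polys d"
    using ij d_in keys_add_single[of "?X d" i] by (intro polys_add polys_single) auto
  have act: "poly_act d K R ?f x = U x + smul K l (R (d - i) x) - smul K (cnj l) (U (R i x))"
  proof -
    have "monomial_act d R (?X d + ?X i) x = R i (R d x)"
      using R_comm ij d_in by (subst monomial_act_add_single) (auto simp: monomial_act_single[simplified])
    also have "\<dots> = U (R i x)" using fun_cong[OF R_comm[OF ij(1) d_in], of x] by (simp add: R_d)
    finally have "monomial_act d R (?X d + ?X i) x = U (R i x)" .
    moreover have "monomial_act d R (?X j) x = R j x" if "j \<in> {1..d}" for j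
      using that by (intro monomial_act_single R_comm)
    note this[OF d_in, unfolded R_d] this[OF ij(2)]
    ultimately show ?thesis
      by (simp only: K.poly_act_add K.poly_act_single) simp
  qed
  have sup: "(SUP z\<in>Gamma d. cmod (poly_eval d ?f z)) \<le> sqrt (1 + 4 * (cmod l * 2 ^ d)\<^sup>2)"
  proof (rule cSUP_least[OF Gamma_nonempty])
    fix z assume z: "z \<in> Gamma d"
    have "poly_eval d (Poly_Mapping.single (?X d + ?X i) (- cnj l)) z = - cnj l * (z d * z i)"
      using prod_power_single[OF d_in, of z] prod_power_single[OF ij(1), of z]
      by (simp add: poly_eval_single lookup_add power_add prod.distrib)
    then have "poly_eval d ?f z = z d + l * z (d - i) - cnj l * (z d * z i)"
      using ij d_in by (simp only: poly_eval_add poly_eval_var) simp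
    then show "cmod (poly_eval d ?f z) \<le> sqrt (1 + 4 * (cmod l * 2 ^ d)\<^sup>2)"
      using Gamma_second_order_bound[OF z i, of l] by simp
  qed
  have "hnorm K (poly_act d K R ?f x) \<le> (SUP z\<in>Gamma d. cmod (poly_eval d ?f z)) * hnorm K x"
    using contractive_K f x unfolding contractive_hilbert_module_def by blast
  also have "\<dots> \<le> sqrt (1 + 4 * (cmod l * 2 ^ d)\<^sup>2) * hnorm K x"
    by (rule mult_right_mono[OF sup K.hnorm_nonneg[OF x]])
  finally show ?thesis unfolding act .
qed

text \<open>Perturbation to first order: \<open>|U x + y|^2\<close>, with \<open>y\<close>
  real-linear in \<open>l\<close>, exceeds \<open>|x|^2\<close> by at most a second order term, so
  \<open>Re <U x, y>\<close> vanishes. Since \<open>U\<close> is unitary this compares the quadratic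
  forms of \<open>R i\<close> and \<open>V R (d - i)\<close>, and polarization finishes.\<close>

lemma adj_R:
  assumes i: "i \<in> {1..d - 1}"
  shows "adj K K (R i) = V \<circ> R (d - i)"
proof (rule KK.adj_eqI)
  have ij: "i \<in> {1..d}" "d - i \<in> {1..d}" using i by auto
  show VR: "V \<circ> R (d - i) \<in> bounded_ops K K"
    by (intro K.ops_comp R V ij)
  have eq: "ip K (R i x) x = ip K x (V (R (d - i) x))" if x: "x \<in> vecs K" for x
  proof -
    define a b where "a = ip K (R i x) x" and "b = ip K (V (R (d - i) x)) x"
    note v = R_vecs[OF ij(1) x] R_vecs[OF ij(2) x] x U_vecs[OF x]
    have re: "Re (l * b - cnj l * a) = 0" for l
    proof (rule linear_le_quadratic_imp_zero)
      fix t :: real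
      define m where "m = of_real t * l"
      define y where "y = smul K m (R (d - i) x) - smul K (cnj m) (U (R i x))"
      have y: "y \<in> vecs K" using v by (simp add: y_def)
      have "ip K y (U x) = m * b - cnj m * a"
        using v by (simp add: y_def K.ip_diff K.ip_smul ip_U_U ip_V a_def b_def)
      also have "\<dots> = of_real t * (l * b - cnj l * a)" by (simp add: m_def algebra_simps)
      finally have "ip K (U x) y = cnj (of_real t * (l * b - cnj l * a))"
        using K.ip_cnj[of y "U x"] v y by simp
      then have "Re (ip K (U x) y) = t * Re (l * b - cnj l * a)" by simp
      then have 1: "(hnorm K (U x + y))\<^sup>2 = (hnorm K x)\<^sup>2 + (hnorm K y)\<^sup>2 + 2 * (t * Re (l * b - cnj l * a))"
        using v y K.hnorm_add_sq[of "U x" y] by (simp add: U_isometric)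
      have "(hnorm K (U x + y))\<^sup>2 \<le> (sqrt (1 + 4 * (cmod m * 2 ^ d)\<^sup>2) * hnorm K x)\<^sup>2"
        using second_order_bound[OF i x, of m] v y by (intro power_mono) (simp_all add: y_def algebra_simps)
      also have "\<dots> = (1 + 4 * (cmod m * 2 ^ d)\<^sup>2) * (hnorm K x)\<^sup>2"
        by (simp add: power_mult_distrib)
      also have "(cmod m * 2 ^ d)\<^sup>2 = t\<^sup>2 * (cmod l * 2 ^ d)\<^sup>2"
        by (simp add: m_def norm_mult power_mult_distrib)
      also have "(1 + 4 * (t\<^sup>2 * (cmod l * 2 ^ d)\<^sup>2)) * (hnorm K x)\<^sup>2 =
        (hnorm K x)\<^sup>2 + 2 * (t\<^sup>2 * (2 * (cmod l * 2 ^ d)\<^sup>2 * (hnorm K x)\<^sup>2))"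
        by (simp add: algebra_simps)
      finally show "t * Re (l * b - cnj l * a) \<le> t\<^sup>2 * (2 * (cmod l * 2 ^ d)\<^sup>2 * (hnorm K x)\<^sup>2)"
        using 1 zero_le_power2[of "hnorm K y"] by linarith
    qed
    \<comment> \<open>\<open>l = 1\<close> compares the real parts and \<open>l = i\<close> the
      imaginary parts.\<close>
    from re[of 1] re[of \<i>] have "a = cnj b" by (simp add: complex_eq_iff)
    then show ?thesis
      using K.ip_cnj[of "V (R (d - i) x)" x] v by (simp add: a_def b_def)
  qed
  show "ip K (R i x) y = ip K x ((V \<circ> R (d - i)) y)" if "x \<in> vecs K" "y \<in> vecs K" for x y
    using K.polarization[of "R i" "V \<circ> R (d - i)" x y] eq that
      R_vecs[OF ij(1)] bounded_ops_vecs[OF VR] bounded_ops_add[OF R[OF ij(1)]] bounded_ops_add[OF VR]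
      bounded_ops_smul[OF R[OF ij(1)]] bounded_ops_smul[OF VR] by simp
qed

abbreviation R_commutant where "R_commutant \<equiv> commutant K (R ` {1..d})"

lemma R_commutantD:
  assumes "Y \<in> R_commutant"
  shows "Y \<in> bounded_ops K K" "i \<in> {1..d} \<Longrightarrow> Y \<circ> R i = R i \<circ> Y" "Y \<circ> U = U \<circ> Y"
proof -
  show Y: "Y \<in> bounded_ops K K" "i \<in> {1..d} \<Longrightarrow> Y \<circ> R i = R i \<circ> Y" for i
    using assms unfolding commutant_def by auto
  show "Y \<circ> U = U \<circ> Y" using Y(2)[OF d_in] by (simp add: R_d)
qed

lemma V_R_comm: "i \<in> {1..d} \<Longrightarrow> k \<in> vecs K \<Longrightarrow> R i (V k) = V (R i k)"
  using commutes_V[OF R _, of i k] R_comm[OF _ d_in] R_d by simp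

text \<open>The Koszul homotopy consumes these mixed relations, not just normality. They hold
  because the adjoint of \<open>R i\<close> is \<open>V\<close> or \<open>V R (d - i)\<close>, built
  from operators commuting with \<open>R j\<close>; Fuglede's theorem is thus avoided.\<close>

lemma adj_R_normal:
  assumes i: "i \<in> {1..d}" and j: "j \<in> {1..d}"
  shows "adj K K (R i) \<circ> R j = R j \<circ> adj K K (R i)"
proof (rule bounded_ops_ext)
  note A = KK.adj_bounded_ops[OF R[OF i]]
  show "adj K K (R i) \<circ> R j \<in> bounded_ops K K" "R j \<circ> adj K K (R i) \<in> bounded_ops K K"
    by (intro K.ops_comp A R j)+
  fix k assume k: "k \<in> vecs K"
  show "(adj K K (R i) \<circ> R j) k = (R j \<circ> adj K K (R i)) k"
  proof (cases "i = d")
    case True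
    then show ?thesis using V_R_comm[OF j k] by (simp add: R_d adj_U)
  next
    case False
    then have i': "i \<in> {1..d - 1}" "d - i \<in> {1..d}" using i by auto
    have "R (d - i) (R j k) = R j (R (d - i) k)" using fun_cong[OF R_comm[OF i'(2) j], of k] by simp
    then show ?thesis
      using V_R_comm[OF j R_vecs[OF i'(2) k]] by (simp add: adj_R[OF i'(1)])
  qed
qed

lemma unitary_module_K: "unitary_module d K R"
  unfolding unitary_module_def
proof (intro conjI ballI contractive_K adj_R_normal taylor_spectrum_subset_Gamma)
  show "hnorm K (R d x) = hnorm K x" if "x \<in> vecs K" for x
    using U_isometric[OF that] by (simp add: R_d)
qed (use d2 in auto)

lemma canonical_J: "canonical_module_map d H S K R J"
  unfolding canonical_module_map_def module_map_def
proof (intro conjI allI impI ballI J)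
  show "hnorm K (J h) \<le> hnorm H h" if "h \<in> vecs H" for h by (rule J_le[OF that])
  show "sot_limit H (adj_powers H (S d)) (adj H K J \<circ> J)" unfolding adj_J_J by (rule sot)
  fix f h assume f: "f \<in> polys d" and h: "h \<in> vecs H"
  have JS: "J (S i x) = R i (J x)" if "i \<in> {1..d}" for i x
    using fun_cong[OF J_intertwines[OF asym_R[OF that] S_comm[OF that d_in]], of x] by simp
  have "J ((S i ^^ p) x) = (R i ^^ p) (J x)" if "i \<in> {1..d}" for i p x
    by (induction p) (simp_all add: JS[OF that])
  then have "J (foldr (\<lambda>i x. (S i ^^ Poly_Mapping.lookup m i) x) xs x) =
    foldr (\<lambda>i x. (R i ^^ Poly_Mapping.lookup m i) x) xs (J x)" if "set xs \<subseteq> {1..d}" for xs m x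
    using that by (induction xs) auto
  then have mon: "J (monomial_act d S m x) = monomial_act d R m (J x)" for m x
    unfolding monomial_act_def by (simp add: atLeastLessThanSuc_atLeastAtMost del: upt_Suc)
  have "(S i ^^ p) x \<in> vecs H" if "i \<in> {1..d}" "x \<in> vecs H" for i p x
    using that by (induction p) (auto simp: bounded_ops_vecs[OF S])
  then have "foldr (\<lambda>i x. (S i ^^ Poly_Mapping.lookup m i) x) xs h \<in> vecs H" if "set xs \<subseteq> {1..d}" for xs m
    using that h by (induction xs) auto
  then have mv: "monomial_act d S m h \<in> vecs H" for m
    unfolding monomial_act_def by (simp add: atLeastLessThanSuc_atLeastAtMost del: upt_Suc)
  show "J (poly_act d H S f h) = poly_act d K R f (J h)"
    unfolding poly_act_def using mv
    by (subst HK.bounded_ops_sum[OF J]) (auto simp: bounded_ops_smul[OF J] mon)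
next
  fix M assume M: "closed_subspace K M \<and> J ` vecs H \<subseteq> M \<and> (\<forall>i\<in>{1..d}. reduces K M (R i))"
  \<comment> \<open>The adjoint half of \<open>reduces\<close> is what counts:
    \<open>orbit_dense\<close> reaches every vector through \<open>V\<close>, the adjoint of
    \<open>U\<close>.\<close>
  then have VM: "V k \<in> M" if "k \<in> M" for k
  proof -
    have "reduces K M (R d)" using M d_in by blast
    then show ?thesis using that by (auto simp: reduces_def R_d adj_U)
  qed
  have "k \<in> M" if k: "k \<in> vecs K" for k
  proof -
    have "(V ^^ m) (J (k m)) \<in> M" for m
    proof -
      have "(V ^^ n) (J (k m)) \<in> M" for n
        using M k by (induction n) (auto intro: VM)
      then show ?thesis .
    qed
    moreover have "closedin (htopology K) M" using M by (simp add: closed_subspace_def)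
    note this[unfolded K.closedin_iff, THEN conjunct2, rule_format, of "\<lambda>m. (V ^^ m) (J (k m))" k]
    ultimately show ?thesis using orbit_dense[OF k] k by blast
  qed
  moreover have "M \<subseteq> vecs K" using M unfolding closed_subspace_def K.closedin_iff by blast
  ultimately show "M = vecs K" by blast
qed

subsection \<open>Toeplitz operators\<close>

text \<open>\<open>Y\<close> commutes with \<open>V\<close>, the inverse of \<open>U\<close>, and
  with \<open>R (d - i)\<close>, hence with the adjoint of \<open>R i\<close>; taking adjoints of
  these relations gives the claim.\<close>

lemma R_commutant_adj:
  assumes Y: "Y \<in> R_commutant"
  shows "adj K K Y \<in> R_commutant"
  unfolding commutant_def
proof (intro CollectI conjI ballI KK.adj_bounded_ops R_commutantD(1)[OF Y])
  fix T assume "T \<in> R ` {1..d}"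
  then obtain i where i: "i \<in> {1..d}" "T = R i" by blast
  note Yb = R_commutantD(1)[OF Y]
  note Yv = bounded_ops_vecs[OF Yb]
  have "Y \<circ> adj K K (R i) = adj K K (R i) \<circ> Y"
  proof (rule bounded_ops_ext)
    show "Y \<circ> adj K K (R i) \<in> bounded_ops K K" "adj K K (R i) \<circ> Y \<in> bounded_ops K K"
      by (intro K.ops_comp KK.adj_bounded_ops R i Yb)+
    fix k assume k: "k \<in> vecs K"
    note YV = commutes_V[OF Yb R_commutantD(3)[OF Y]]
    show "(Y \<circ> adj K K (R i)) k = (adj K K (R i) \<circ> Y) k"
    proof (cases "i = d")
      case True
      then show ?thesis using YV[OF k] by (simp add: R_d adj_U)
    next
      case False
      then have i': "i \<in> {1..d - 1}" "d - i \<in> {1..d}" using i by auto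
      have "Y (R (d - i) k) = R (d - i) (Y k)" using fun_cong[OF R_commutantD(2)[OF Y i'(2)], of k] by simp
      then show ?thesis using YV[OF R_vecs[OF i'(2) k]] by (simp add: adj_R[OF i'(1)])
    qed
  qed
  then have "adj K K (Y \<circ> adj K K (R i)) = adj K K (adj K K (R i) \<circ> Y)" by simp
  then have "R i \<circ> adj K K Y = adj K K Y \<circ> R i"
    using K.adj_comp[OF Yb KK.adj_bounded_ops[OF R[OF i(1)]]] K.adj_comp[OF KK.adj_bounded_ops[OF R[OF i(1)]] Yb]
    by (simp add: K.adj_adj[OF R[OF i(1)]])
  then show "adj K K Y \<circ> T = T \<circ> adj K K Y" using i by simp
qed

lemma idop_R_commutant: "idop K \<in> R_commutant"
  using K.bounded_ops_idop bounded_ops_vecs[OF R] bounded_ops_outside[OF R] KK.bounded_ops_0[OF R]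
  by (auto simp: commutant_def idop_def fun_eq_iff)

lemma asym_rho:
  assumes "Y \<in> R_commutant"
  shows "asym (adj H K J \<circ> Y \<circ> J) Y"
  by (rule asym_compression[OF R_commutantD(1)[OF assms] R_commutantD(3)[OF assms]])

text \<open>Compression of identities on \<open>K\<close>: the adjoint of \<open>R i\<close> times
  \<open>U\<close> is \<open>R (d - i)\<close>, the map \<open>J\<close> intertwines
  \<open>S\<close> with \<open>R\<close>, and \<open>ev\<close> intertwines the adjoints.\<close>

lemma rho_toeplitz:
  assumes Y: "Y \<in> R_commutant"
  shows "adj H K J \<circ> Y \<circ> J \<in> toeplitz_ops d H S"
  unfolding toeplitz_ops_def
proof (intro CollectI conjI ballI compression_bounded_ops R_commutantD(1)[OF Y])
  note Yb = R_commutantD(1)[OF Y]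
  note Yv = bounded_ops_vecs[OF Yb]
  have JS: "J (S i h) = R i (J h)" if "i \<in> {1..d}" for i h
    using fun_cong[OF J_intertwines[OF asym_R[OF that] S_comm[OF that d_in]], of h] by simp
  have YR: "Y (R i k) = R i (Y k)" if "i \<in> {1..d}" for i k
    using fun_cong[OF R_commutantD(2)[OF Y that], of k] by simp
  have adjS: "adj H H (S i) (ev k) = ev (adj K K (R i) k)" if "i \<in> {1..d}" "k \<in> vecs K" for i k
    using asym_adj_commuting(2)[OF S[OF that(1)] S_comm[OF that(1) d_in] asym_R[OF that(1)] that(2)]
      bounded_ops_vecs[OF KK.adj_bounded_ops[OF R[OF that(1)]] that(2)] that(2)
    by (simp add: ev_def)
  fix i assume i: "i \<in> {1..d - 1}"
  then have ij: "i \<in> {1..d}" "d - i \<in> {1..d}" by auto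
  show "adj H H (S i) \<circ> (adj H K J \<circ> Y \<circ> J) \<circ> S d = (adj H K J \<circ> Y \<circ> J) \<circ> S (d - i)"
  proof (rule bounded_ops_ext)
    show "adj H H (S i) \<circ> (adj H K J \<circ> Y \<circ> J) \<circ> S d \<in> bounded_ops H H"
      "(adj H K J \<circ> Y \<circ> J) \<circ> S (d - i) \<in> bounded_ops H H"
      by (intro H.ops_comp compression_bounded_ops Yb S ij d_in HH.adj_bounded_ops)+
    fix h assume h: "h \<in> vecs H"
    have Yh: "Y (J h) \<in> vecs K" using Yv h by simp
    have "adj H H (S i) (ev (Y (J (S d h)))) = ev (V (R (d - i) (U (Y (J h)))))"
      using h Yh by (simp add: JS[OF d_in, unfolded R_d] YR[OF d_in, unfolded R_d] adjS[OF ij(1)] adj_R[OF i])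
    also have "R (d - i) (U (Y (J h))) = U (R (d - i) (Y (J h)))"
      using fun_cong[OF R_comm[OF ij(2) d_in], of "Y (J h)"] by (simp add: R_d)
    also have "V (U (R (d - i) (Y (J h)))) = Y (J (S (d - i) h))"
      using R_vecs[OF ij(2) Yh] by (simp add: JS[OF ij(2)] YR[OF ij(2)])
    finally show "(adj H H (S i) \<circ> (adj H K J \<circ> Y \<circ> J) \<circ> S d) h = ((adj H K J \<circ> Y \<circ> J) \<circ> S (d - i)) h"
      by (simp add: adj_J)
  qed
next
  note Yb = R_commutantD(1)[OF Y]
  show "adj H H (S d) \<circ> (adj H K J \<circ> Y \<circ> J) \<circ> S d = adj H K J \<circ> Y \<circ> J"
  proof (rule bounded_ops_ext)
    show "adj H H (S d) \<circ> (adj H K J \<circ> Y \<circ> J) \<circ> S d \<in> bounded_ops H H"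
      "adj H K J \<circ> Y \<circ> J \<in> bounded_ops H H"
      by (intro H.ops_comp compression_bounded_ops Yb S d_in HH.adj_bounded_ops)+
    fix h assume h: "h \<in> vecs H"
    have Yh: "Y (J h) \<in> vecs K" using bounded_ops_vecs[OF Yb] h by simp
    have "J (S d h) = U (J h)"
      using fun_cong[OF J_intertwines[OF asym_U refl], of h] by simp
    moreover have "Y (U (J h)) = U (Y (J h))" using fun_cong[OF R_commutantD(3)[OF Y], of "J h"] by simp
    moreover have "Ps (ev (U (Y (J h)))) = ev (Y (J h))"
      using Yh U_vecs[OF Yh] by (simp add: ev_def) (simp add: U_def)
    ultimately show "(adj H H (S d) \<circ> (adj H K J \<circ> Y \<circ> J) \<circ> S d) h = (adj H K J \<circ> Y \<circ> J) h"
      by (simp add: adj_J)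
  qed
qed

text \<open>The Toeplitz relations pass to partners. With the adjoint of \<open>R i\<close> equal to
  \<open>V R (d - i)\<close> and \<open>Y U = U Y\<close>, the relation for \<open>i\<close>
  collapses to commutation with \<open>R (d - i)\<close>.\<close>

lemma toeplitz_asym:
  assumes A: "A \<in> toeplitz_ops d H S"
  obtains Y where "Y \<in> R_commutant" "asym A Y" "adj H K J \<circ> Y \<circ> J = A"
proof -
  have Ab: "A \<in> bounded_ops H H" and rel: "\<And>i. i \<in> {1..d - 1} \<Longrightarrow> adj H H (S i) \<circ> A \<circ> S d = A \<circ> S (d - i)"
    and fixed: "Ps \<circ> A \<circ> S d = A"
    using A by (auto simp: toeplitz_ops_def)
  have fixed': "Ps (A (S d x)) = A x" for x using fun_cong[OF fixed, of x] by simp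
  obtain Y where Y: "asym A Y" using asym_fixed_exists[OF Ab fixed'] by blast
  note Yb = asymD(2)[OF Y]
  note Yv = bounded_ops_vecs[OF Yb]
  have YU: "Y \<circ> U = U \<circ> Y" by (rule fixed_commutes_U[OF Y fixed'])
  have "Y \<circ> R j = R j \<circ> Y" if j: "j \<in> {1..d}" for j
  proof (cases "j = d")
    case True
    then show ?thesis using YU by (simp add: R_d)
  next
    case False
    \<comment> \<open>The relation indexed by \<open>i\<close> concerns \<open>R (d - i)\<close>,
      hence the reflected index.\<close>
    define i where "i = d - j"
    have i: "i \<in> {1..d - 1}" "i \<in> {1..d}" and ji: "j = d - i" using False j by (auto simp: i_def)
    note adjS = asym_adj_commuting(1)[OF S[OF i(2)] S_comm[OF i(2) d_in] asym_R[OF i(2)]]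
    have YR: "adj K K (R i) \<circ> Y \<circ> R d = Y \<circ> R j"
      using asym_unique[OF asym_comp[OF asym_comp[OF adjS Y] asym_R[OF d_in]]] asym_comp[OF Y asym_R[OF j]]
        rel[OF i(1)] ji by simp
    have eq: "V (R j (Y (U k))) = Y (R j k)" for k
      using fun_cong[OF YR, of k] by (simp add: adj_R[OF i(1)] R_d ji)
    show ?thesis
    proof (rule bounded_ops_ext)
      show "Y \<circ> R j \<in> bounded_ops K K" "R j \<circ> Y \<in> bounded_ops K K"
        by (intro K.ops_comp R j Yb)+
      fix k assume k: "k \<in> vecs K"
      have "R j (Y (U k)) = U (R j (Y k))"
        using fun_cong[OF YU, of k] fun_cong[OF R_comm[OF j d_in], of "Y k"] by (simp add: R_d)
      then show "(Y \<circ> R j) k = (R j \<circ> Y) k"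
        using eq[of k] R_vecs[OF j Yv[OF k]] by simp
    qed
  qed
  then have "Y \<in> R_commutant" using Yb by (auto simp: commutant_def)
  moreover have "adj H K J \<circ> Y \<circ> J = A" by (rule compression_of_fixed[OF Y fixed'])
  ultimately show thesis using that Y by blast
qed

text \<open>The clause for the adjoint is built in because a strong limit says nothing about
  adjoints; it is what makes this set selfadjoint. For \<open>pi\<close> it is enough that the
  generated algebra lies inside.\<close>

definition asym_algebra :: "('a \<Rightarrow> 'a) set" where
  "asym_algebra = {T. \<exists>Y\<in>R_commutant. \<exists>Z\<in>R_commutant. asym T Y \<and> asym (adj H H T) Z}"

lemma R_commutant_closed:
  assumes "Y \<in> R_commutant" "Z \<in> R_commutant"
  shows "Y + Z \<in> R_commutant" "Y \<circ> Z \<in> R_commutant" "opscale K c Y \<in> R_commutant"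
proof -
  note Y = R_commutantD[OF assms(1)] and Z = R_commutantD[OF assms(2)]
  have YR: "Y (R i k) = R i (Y k)" and ZR: "Z (R i k) = R i (Z k)" if "i \<in> {1..d}" for i k
    using fun_cong[OF Y(2)[OF that], of k] fun_cong[OF Z(2)[OF that], of k] by simp_all
  show "Y \<circ> Z \<in> R_commutant"
  proof -
    have "Y \<circ> Z \<circ> R i = R i \<circ> (Y \<circ> Z)" if "i \<in> {1..d}" for i
      by (rule ext) (simp add: YR[OF that] ZR[OF that])
    then show ?thesis using K.ops_comp[OF Y(1) Z(1)] by (auto simp: commutant_def)
  qed
  have "(Y + Z) \<circ> R i = R i \<circ> (Y + Z)" if i: "i \<in> {1..d}" for i
    by (rule bounded_ops_ext[OF K.ops_comp[OF KK.bounded_ops_plus[OF Y(1) Z(1)] R[OF i]] K.ops_comp[OF R[OF i] KK.bounded_ops_plus[OF Y(1) Z(1)]]])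
      (use bounded_ops_vecs[OF Y(1)] bounded_ops_vecs[OF Z(1)] in \<open>simp add: YR[OF i] ZR[OF i] bounded_ops_add[OF R[OF i]]\<close>)
  then show "Y + Z \<in> R_commutant"
    using KK.bounded_ops_plus[OF Y(1) Z(1)] by (auto simp: commutant_def)
  have "opscale K c Y \<circ> R i = R i \<circ> opscale K c Y" if i: "i \<in> {1..d}" for i
    by (rule bounded_ops_ext[OF K.ops_comp[OF KK.bounded_ops_opscale[OF Y(1)] R[OF i]] K.ops_comp[OF R[OF i] KK.bounded_ops_opscale[OF Y(1)]]])
      (use bounded_ops_vecs[OF Y(1)] in \<open>simp add: opscale_def YR[OF i] bounded_ops_smul[OF R[OF i]]\<close>)
  then show "opscale K c Y \<in> R_commutant"
    using KK.bounded_ops_opscale[OF Y(1)] by (auto simp: commutant_def)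
qed

lemma asym_limit_in_R_commutant:
  assumes XY: "\<And>n. asym (X n) (Y n)" and Y: "\<And>n. Y n \<in> R_commutant" and T: "T \<in> bounded_ops H H"
    and lim: "(\<lambda>n. opnorm H H (X n - T)) \<longlonglongrightarrow> 0"
  obtains Z where "asym T Z" "Z \<in> R_commutant"
proof -
  obtain Z where Z: "asym T Z" and Zlim: "\<And>k. k \<in> vecs K \<Longrightarrow> (\<lambda>n. hnorm K (Y n k - Z k)) \<longlonglongrightarrow> 0"
    using asym_op_limit[OF XY T lim] by blast
  note Zb = asymD(2)[OF Z]
  have "Z \<circ> R i = R i \<circ> Z" if i: "i \<in> {1..d}" for i
  proof (rule bounded_ops_ext)
    show "Z \<circ> R i \<in> bounded_ops K K" "R i \<circ> Z \<in> bounded_ops K K"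
      by (intro K.ops_comp R i Zb)+
    fix k assume k: "k \<in> vecs K"
    note Yv = bounded_ops_vecs[OF R_commutantD(1)[OF Y]]
    have "R i (Y n k) = Y n (R i k)" for n using fun_cong[OF R_commutantD(2)[OF Y i], of n k] by simp
    moreover have "(\<lambda>n. hnorm K (R i (Y n k) - R i (Z k))) \<longlonglongrightarrow> 0"
      using Yv[OF k] bounded_ops_vecs[OF Zb k] Zlim[OF k] by (rule KK.tendsto_op[OF R[OF i]])
    ultimately have "(\<lambda>n. hnorm K (Y n (R i k) - R i (Z k))) \<longlonglongrightarrow> 0" by simp
    then have "Z (R i k) = R i (Z k)"
      using Zlim[OF R_vecs[OF i k]] Yv[OF R_vecs[OF i k]] bounded_ops_vecs[OF Zb] R_vecs[OF i] k
      by (intro K.limit_unique[of "\<lambda>n. Y n (R i k)"]) auto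
    then show "(Z \<circ> R i) k = (R i \<circ> Z) k" by simp
  qed
  then have "Z \<in> R_commutant" using Zb by (auto simp: commutant_def)
  then show thesis using that Z by blast
qed

lemma asym_algebra_bounded: "T \<in> asym_algebra \<Longrightarrow> T \<in> bounded_ops H H"
  unfolding asym_algebra_def using asymD(1) by blast

lemma cstar_asym_algebra: "cstar_subalgebra H asym_algebra"
  unfolding cstar_subalgebra_def
proof (intro conjI ballI allI)
  show sub: "asym_algebra \<subseteq> bounded_ops H H" using asym_algebra_bounded by blast
  show "adj H H T \<in> asym_algebra" if T: "T \<in> asym_algebra" for T
    using T H.adj_adj[OF asym_algebra_bounded[OF T]] unfolding asym_algebra_def by auto
  show scale: "opscale H c T \<in> asym_algebra" if T: "T \<in> asym_algebra" for c T
  proof -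
    obtain Y Z where "Y \<in> R_commutant" "Z \<in> R_commutant" "asym T Y" "asym (adj H H T) Z"
      using T by (auto simp: asym_algebra_def)
    then show ?thesis unfolding asym_algebra_def H.adj_opscale[OF asym_algebra_bounded[OF T], of c, symmetric]
      using R_commutant_closed(3) asym_opscale H.adj_opscale[OF asym_algebra_bounded[OF T], of c]
      by (intro CollectI bexI[of _ "opscale K c Y"] bexI[of _ "opscale K (cnj c) Z"]) auto
  qed
  show "S + T \<in> asym_algebra" and "S \<circ> T \<in> asym_algebra" if S: "S \<in> asym_algebra" and T: "T \<in> asym_algebra" for S T
  proof -
    obtain Y Z where Y: "Y \<in> R_commutant" "Z \<in> R_commutant" "asym S Y" "asym (adj H H S) Z"
      using S by (auto simp: asym_algebra_def)
    obtain Y' Z' where Y': "Y' \<in> R_commutant" "Z' \<in> R_commutant" "asym T Y'" "asym (adj H H T) Z'"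
      using T by (auto simp: asym_algebra_def)
    note b = asym_algebra_bounded[OF S] asym_algebra_bounded[OF T]
    show "S + T \<in> asym_algebra" unfolding asym_algebra_def H.adj_plus[OF b, symmetric]
      using R_commutant_closed(1) asym_add Y Y' H.adj_plus[OF b]
      by (intro CollectI bexI[of _ "Y + Y'"] bexI[of _ "Z + Z'"]) auto
    show "S \<circ> T \<in> asym_algebra" unfolding asym_algebra_def
      using R_commutant_closed(2) asym_comp Y Y' H.adj_comp[OF b]
      by (intro CollectI bexI[of _ "Y \<circ> Y'"] bexI[of _ "Z' \<circ> Z"]) auto
  qed
  have id: "idop H \<in> asym_algebra"
    unfolding asym_algebra_def using asym_idop idop_R_commutant H.adj_idop by auto
  have "opscale H 0 (idop H) = 0" by (simp add: opscale_def fun_eq_iff)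
  then show "0 \<in> asym_algebra" using scale[OF id, of 0] by simp
  show "closedin (Metric_space.mtopology (bounded_ops H H) (opdist H)) asym_algebra"
    unfolding H.opmetric.metric_closedin_iff_sequentially_closed
  proof (intro conjI allI impI sub)
    fix \<sigma> T assume a: "range \<sigma> \<subseteq> asym_algebra \<and> limitin H.opmetric.mtopology \<sigma> T sequentially"
    then have \<sigma>: "\<sigma> n \<in> asym_algebra" for n by blast
    note T = H.op_limitD[OF conjunct2[OF a] asym_algebra_bounded[OF \<sigma>]]
    obtain Y Z where Y: "\<And>n. Y n \<in> R_commutant" "\<And>n. asym (\<sigma> n) (Y n)"
      and Z: "\<And>n. Z n \<in> R_commutant" "\<And>n. asym (adj H H (\<sigma> n)) (Z n)"
      using \<sigma> unfolding asym_algebra_def by (auto simp: Bex_def) metis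
    obtain Y' where Y': "asym T Y'" "Y' \<in> R_commutant"
      using asym_limit_in_R_commutant[OF Y(2,1) T] by blast
    \<comment> \<open>Taking adjoints does not increase the operator norm, so the clause for the
      adjoint is closed as well.\<close>
    have "(\<lambda>n. opnorm H H (adj H H (\<sigma> n) - adj H H T)) \<longlonglongrightarrow> 0"
    proof (rule Lim_null_comparison[OF _ T(2)])
      have "opnorm H H (adj H H (\<sigma> n) - adj H H T) \<le> opnorm H H (\<sigma> n - T)" for n
      proof (rule HH.opnorm_le)
        note b = asym_algebra_bounded[OF \<sigma>, of n]
        note D = HH.bounded_ops_minus[OF b T(1)]
        show "0 \<le> opnorm H H (\<sigma> n - T)" by (rule HH.opnorm_nonneg[OF D])
        have "\<sigma> n - T = \<sigma> n + opscale H (-1) T" by (simp add: opscale_def fun_eq_iff)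
        then have "adj H H (\<sigma> n - T) = adj H H (\<sigma> n) + opscale H (-1) (adj H H T)"
          using H.adj_plus[OF b HH.bounded_ops_opscale[OF T(1)], of "-1"] H.adj_opscale[OF T(1), of "-1"]
          by (simp only: complex_cnj_neg_numeral complex_cnj_one complex_cnj_minus)
        then have eq: "adj H H (\<sigma> n - T) = adj H H (\<sigma> n) - adj H H T"
          by (simp add: opscale_def fun_eq_iff)
        show "hnorm H ((adj H H (\<sigma> n) - adj H H T) x) \<le> opnorm H H (\<sigma> n - T) * hnorm H x"
          if "x \<in> vecs H" for x
          using HH.hnorm_adj_le[OF D that HH.opnorm_nonneg[OF D] HH.opnorm_bound[OF D]] unfolding eq .
      qed
      then show "\<forall>\<^sub>F n in sequentially. norm (opnorm H H (adj H H (\<sigma> n) - adj H H T)) \<le> opnorm H H (\<sigma> n - T)"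
        using HH.opnorm_nonneg[OF HH.bounded_ops_minus[OF HH.adj_bounded_ops HH.adj_bounded_ops]]
          asym_algebra_bounded[OF \<sigma>] T(1) by simp
    qed
    from asym_limit_in_R_commutant[where X = "\<lambda>n. adj H H (\<sigma> n)", OF Z(2,1) HH.adj_bounded_ops[OF T(1)] this]
    obtain Z' where "asym (adj H H T) Z'" "Z' \<in> R_commutant" .
    then show "T \<in> asym_algebra" using Y' by (auto simp: asym_algebra_def)
  qed
qed

text \<open>The adjoint of a compression is the compression of the adjoint, and
  \<open>R_commutant\<close> is selfadjoint; so the adjoint of a Toeplitz operator has a partner
  too.\<close>

lemma toeplitz_subset_asym_algebra: "{idop H} \<union> toeplitz_ops d H S \<subseteq> asym_algebra"
proof -
  have "idop H \<in> asym_algebra"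
    unfolding asym_algebra_def using asym_idop idop_R_commutant H.adj_idop by auto
  moreover have "A \<in> asym_algebra" if A: "A \<in> toeplitz_ops d H S" for A
  proof -
    obtain Y where Y: "Y \<in> R_commutant" "asym A Y" "adj H K J \<circ> Y \<circ> J = A"
      using toeplitz_asym[OF A] by blast
    note Ys = R_commutant_adj[OF Y(1)]
    have "adj H H A = adj H K J \<circ> adj K K Y \<circ> J"
    proof (rule HH.adj_eqI[OF compression_bounded_ops[OF R_commutantD(1)[OF Ys]]])
      fix x y assume x: "x \<in> vecs H" and y: "y \<in> vecs H"
      note Yb = R_commutantD(1)[OF Y(1)]
      have v: "Y (J x) \<in> vecs K" "adj K K Y (J y) \<in> vecs K"
        using bounded_ops_vecs[OF Yb] bounded_ops_vecs[OF R_commutantD(1)[OF Ys]] x y by auto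
      have "ip H (A x) y = ip H (ev (Y (J x))) y" by (simp add: adj_J flip: Y(3))
      also have "\<dots> = ip K (Y (J x)) (J y)" using HK.ip_adj'[OF J y v(1)] by (simp add: adj_J)
      also have "\<dots> = ip K (J x) (adj K K Y (J y))" by (rule KK.ip_adj[OF Yb]) (use x y in auto)
      also have "\<dots> = ip H x (ev (adj K K Y (J y)))" using HK.ip_adj[OF J x v(2)] by (simp add: adj_J)
      finally show "ip H (A x) y = ip H x ((adj H K J \<circ> adj K K Y \<circ> J) y)" by (simp add: adj_J)
    qed
    then have "asym (adj H H A) (adj K K Y)" using asym_rho[OF Ys] by simp
    then show ?thesis unfolding asym_algebra_def using Y Ys by blast
  qed
  ultimately show ?thesis by blast
qed

section \<open>The representation of the Toeplitz algebra\<close>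

abbreviation toeplitz_algebra where
  "toeplitz_algebra \<equiv> cstar_generated H ({idop H} \<union> toeplitz_ops d H S)"

lemma toeplitz_algebra_subset: "toeplitz_algebra \<subseteq> asym_algebra"
  using cstar_asym_algebra toeplitz_subset_asym_algebra unfolding cstar_generated_def by blast

lemma generators_in_toeplitz_algebra: "{idop H} \<union> toeplitz_ops d H S \<subseteq> toeplitz_algebra"
  unfolding cstar_generated_def by blast

definition \<pi> :: "('a \<Rightarrow> 'a) \<Rightarrow> (nat \<Rightarrow> 'a) \<Rightarrow> nat \<Rightarrow> 'a" where
  "\<pi> T = (SOME Y. asym T Y)"

lemma \<pi>_eq: "asym T Y \<Longrightarrow> \<pi> T = Y"
  unfolding \<pi>_def using asym_unique by (metis someI)

lemma \<pi>_algebra: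
  assumes "T \<in> toeplitz_algebra"
  shows "asym T (\<pi> T)" "\<pi> T \<in> R_commutant" "asym (adj H H T) (\<pi> (adj H H T))"
proof -
  obtain Y Z where "Y \<in> R_commutant" "asym T Y" "asym (adj H H T) Z"
    using assms toeplitz_algebra_subset unfolding asym_algebra_def by blast
  then show "asym T (\<pi> T)" "\<pi> T \<in> R_commutant" "asym (adj H H T) (\<pi> (adj H H T))"
    by (simp_all add: \<pi>_eq)
qed

lemma \<pi>_rho: "Y \<in> R_commutant \<Longrightarrow> \<pi> (adj H K J \<circ> Y \<circ> J) = Y"
  by (rule \<pi>_eq[OF asym_rho])

lemma \<pi>_image: "\<pi> ` toeplitz_algebra = R_commutant"
proof
  show "R_commutant \<subseteq> \<pi> ` toeplitz_algebra"
  proof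
    fix Y assume Y: "Y \<in> R_commutant"
    have "adj H K J \<circ> Y \<circ> J \<in> toeplitz_algebra"
      using rho_toeplitz[OF Y] generators_in_toeplitz_algebra by blast
    then have "\<pi> (adj H K J \<circ> Y \<circ> J) \<in> \<pi> ` toeplitz_algebra" by (rule imageI)
    then show "Y \<in> \<pi> ` toeplitz_algebra" by (simp only: \<pi>_rho[OF Y])
  qed
qed (use \<pi>_algebra(2) in blast)

text \<open>Compressions are not multiplicative but partners are, so all identities follow from
  uniqueness of partners.\<close>

lemma \<pi>_representation: "unital_star_representation H K toeplitz_algebra \<pi>"
  unfolding unital_star_representation_def linear_on_ops_def multiplicative_on_def
proof (intro conjI ballI allI)
  show "\<pi> ` toeplitz_algebra \<subseteq> bounded_ops K K" using asymD(2)[OF \<pi>_algebra(1)] by blast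
  show "\<pi> (A + B) = \<pi> A + \<pi> B" "\<pi> (A \<circ> B) = \<pi> A \<circ> \<pi> B"
    if "A \<in> toeplitz_algebra" "B \<in> toeplitz_algebra" for A B
    by (intro \<pi>_eq asym_add asym_comp \<pi>_algebra(1) that)+
  show "\<pi> (opscale H c T) = opscale K c (\<pi> T)" if "T \<in> toeplitz_algebra" for c T
    by (rule \<pi>_eq[OF asym_opscale[OF \<pi>_algebra(1)[OF that]]])
  show "\<pi> (adj H H T) = adj K K (\<pi> T)" if "T \<in> toeplitz_algebra" for T
    by (rule asym_adj[OF \<pi>_algebra(1,3), OF that that, symmetric])
  show "\<pi> (idop H) = idop K" by (rule \<pi>_eq[OF asym_idop])
qed

text \<open>\<open>J\<close> and its adjoint are contractions, which gives one inequality of matrix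
  norms; the other holds because each entry is the partner of its compression.\<close>

lemma rho_complete_isometry: "complete_isometry K H R_commutant (\<lambda>Y. adj H K J \<circ> Y \<circ> J)"
  unfolding complete_isometry_def linear_on_ops_def
proof (intro conjI ballI allI impI)
  show "(\<lambda>Y. adj H K J \<circ> Y \<circ> J) ` R_commutant \<subseteq> bounded_ops H H"
    using compression_bounded_ops R_commutantD(1) by blast
  show "adj H K J \<circ> (Y + Z) \<circ> J = (adj H K J \<circ> Y \<circ> J) + (adj H K J \<circ> Z \<circ> J)"
    if "Y \<in> R_commutant" "Z \<in> R_commutant" for Y Z
  proof
    note v = bounded_ops_vecs[OF R_commutantD(1)[OF that(1)]] bounded_ops_vecs[OF R_commutantD(1)[OF that(2)]]
      and out = KK.bounded_ops_0[OF R_commutantD(1)[OF that(1)]] KK.bounded_ops_0[OF R_commutantD(1)[OF that(2)]]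
    show "(adj H K J \<circ> (Y + Z) \<circ> J) h = ((adj H K J \<circ> Y \<circ> J) + (adj H K J \<circ> Z \<circ> J)) h" for h
      using v[of "J h"] J_vecs[of h] bounded_ops_outside[OF J, of h] KH.bounded_ops_0[OF ev]
      by (cases "h \<in> vecs H") (simp_all add: adj_J bounded_ops_add[OF ev] out)
  qed
  show "adj H K J \<circ> opscale K c Y \<circ> J = opscale H c (adj H K J \<circ> Y \<circ> J)" if "Y \<in> R_commutant" for c Y
  proof
    note v = bounded_ops_vecs[OF R_commutantD(1)[OF that]] and out = KK.bounded_ops_0[OF R_commutantD(1)[OF that]]
    show "(adj H K J \<circ> opscale K c Y \<circ> J) h = opscale H c (adj H K J \<circ> Y \<circ> J) h" for h
      using v[of "J h"] J_vecs[of h] bounded_ops_outside[OF J, of h] KH.bounded_ops_0[OF ev]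
      by (cases "h \<in> vecs H") (simp_all add: adj_J opscale_def bounded_ops_smul[OF ev] out)
  qed
  fix n :: nat and Y :: "nat \<Rightarrow> nat \<Rightarrow> (nat \<Rightarrow> 'a) \<Rightarrow> nat \<Rightarrow> 'a"
  assume "\<forall>i<n. \<forall>j<n. Y i j \<in> R_commutant"
  then have Y: "Y i j \<in> R_commutant" if "i < n" "j < n" for i j using that by blast
  note Yb = R_commutantD(1)[OF Y]
  show "matrix_opnorm H n (\<lambda>i j. adj H K J \<circ> Y i j \<circ> J) = matrix_opnorm K n Y"
  proof (rule antisym)
    show "matrix_opnorm K n Y \<le> matrix_opnorm H n (\<lambda>i j. adj H K J \<circ> Y i j \<circ> J)"
      by (intro matrix_opnorm_asym_le asym_rho Y)
    have nonneg: "0 \<le> matrix_opnorm K n Y" by (rule K.matrix_opnorm_nonneg[OF Yb])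
    show "matrix_opnorm H n (\<lambda>i j. adj H K J \<circ> Y i j \<circ> J) \<le> matrix_opnorm K n Y"
    proof (rule H.matrix_opnorm_le[OF nonneg])
      fix x assume x: "\<And>j. j < n \<Longrightarrow> x j \<in> vecs H"
      have Yv: "Y i j (J (x j)) \<in> vecs K" if "i < n" "j < n" for i j
        using bounded_ops_vecs[OF Yb[OF that]] x that by simp
      have sv: "(\<Sum>j<n. Y i j (J (x j))) \<in> vecs K" if "i < n" for i
        using Yv that by (intro K.vecs_sum) auto
      have "(\<Sum>j<n. (adj H K J \<circ> Y i j \<circ> J) (x j)) = ev (\<Sum>j<n. Y i j (J (x j)))" if "i < n" for i
        using Yv that by (subst KH.bounded_ops_sum[OF ev]) (auto simp: adj_J)
      then have "sqrt (\<Sum>i<n. (hnorm H (\<Sum>j<n. (adj H K J \<circ> Y i j \<circ> J) (x j)))\<^sup>2) \<le>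
        sqrt (\<Sum>i<n. (hnorm K (\<Sum>j<n. Y i j (J (x j))))\<^sup>2)"
        using sv by (intro real_sqrt_le_mono sum_mono power_mono) (auto intro: ev_le)
      also have "\<dots> \<le> matrix_opnorm K n Y * sqrt (\<Sum>j<n. (hnorm K (J (x j)))\<^sup>2)"
        by (rule K.hnorm_matrix_le[where x = "\<lambda>j. J (x j)", OF Yb]) (use x in auto)
      also have "\<dots> \<le> matrix_opnorm K n Y * sqrt (\<Sum>j<n. (hnorm H (x j))\<^sup>2)"
        using x by (intro mult_left_mono real_sqrt_le_mono sum_mono power_mono J_le nonneg) auto
      finally show "sqrt (\<Sum>i<n. (hnorm H (\<Sum>j<n. (adj H K J \<circ> Y i j \<circ> J) (x j)))\<^sup>2) \<le>
        matrix_opnorm K n Y * sqrt (\<Sum>j<n. (hnorm H (x j))\<^sup>2)" .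
    qed
  qed
qed

lemma rho_image: "(\<lambda>Y. adj H K J \<circ> Y \<circ> J) ` R_commutant = toeplitz_ops d H S"
proof
  show "(\<lambda>Y. adj H K J \<circ> Y \<circ> J) ` R_commutant \<subseteq> toeplitz_ops d H S"
    using rho_toeplitz by blast
  show "toeplitz_ops d H S \<subseteq> (\<lambda>Y. adj H K J \<circ> Y \<circ> J) ` R_commutant"
  proof
    fix A assume "A \<in> toeplitz_ops d H S"
    then obtain Y where "Y \<in> R_commutant" "adj H K J \<circ> Y \<circ> J = A" using toeplitz_asym by blast
    then show "A \<in> (\<lambda>Y. adj H K J \<circ> Y \<circ> J) ` R_commutant" by (intro image_eqI) (rule sym)
  qed
qed

section \<open>Lifting the commutant of the module\<close>

abbreviation S_commutant where "S_commutant \<equiv> commutant H (S ` {1..d})"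

text \<open>From \<open>Y J = J X\<close> one gets \<open>J* J X = J* Y J\<close>, a Toeplitz
  operator, on which \<open>pi\<close> returns \<open>Y\<close>.\<close>

lemma S_commutant_asym:
  assumes X: "X \<in> S_commutant"
  obtains Y where "Y \<in> R_commutant" "asym X Y" "adj H K J \<circ> J \<circ> X = adj H K J \<circ> Y \<circ> J" "Y \<circ> J = J \<circ> X"
proof -
  have Xb: "X \<in> bounded_ops H H" and comm: "\<And>i. i \<in> {1..d} \<Longrightarrow> X \<circ> S i = S i \<circ> X"
    using X by (auto simp: commutant_def)
  obtain Y where Y: "asym X Y" using asym_commuting[OF Xb comm[OF d_in]] by blast
  have "Y \<circ> R i = R i \<circ> Y" if i: "i \<in> {1..d}" for i
    using asym_unique[OF asym_comp[OF Y asym_R[OF i]]] asym_comp[OF asym_R[OF i] Y] comm[OF i] by simp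
  then have "Y \<in> R_commutant" using asymD(2)[OF Y] by (auto simp: commutant_def)
  moreover have YJ: "Y \<circ> J = J \<circ> X" by (rule J_intertwines[OF Y comm[OF d_in]])
  moreover have "adj H K J \<circ> J \<circ> X = adj H K J \<circ> Y \<circ> J" by (simp only: comp_assoc YJ)
  ultimately show thesis using that Y by blast
qed

lemma \<pi>_adj_J_J:
  assumes X: "X \<in> S_commutant"
  shows "asym X (\<pi> (adj H K J \<circ> J \<circ> X))" "\<pi> (adj H K J \<circ> J \<circ> X) \<in> R_commutant"
    "adj H K J \<circ> J \<circ> X \<in> toeplitz_algebra" "\<pi> (adj H K J \<circ> J \<circ> X) \<circ> J = J \<circ> X"
proof -
  obtain Y where Y: "Y \<in> R_commutant" "asym X Y" "adj H K J \<circ> J \<circ> X = adj H K J \<circ> Y \<circ> J" "Y \<circ> J = J \<circ> X"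
    using S_commutant_asym[OF X] by blast
  then show "asym X (\<pi> (adj H K J \<circ> J \<circ> X))" "\<pi> (adj H K J \<circ> J \<circ> X) \<in> R_commutant"
    "\<pi> (adj H K J \<circ> J \<circ> X) \<circ> J = J \<circ> X"
    by (simp_all only: \<pi>_rho)
  show "adj H K J \<circ> J \<circ> X \<in> toeplitz_algebra"
    unfolding Y(3) using rho_toeplitz[OF Y(1)] generators_in_toeplitz_algebra by blast
qed

text \<open>Reduces the algebraic laws of \<open>X |-> pi (J* J X)\<close> to exhibiting partners of
  \<open>X\<close> itself, where products behave well.\<close>

lemma \<pi>_adj_J_J_eq:
  assumes "X \<in> S_commutant" "asym X Y"
  shows "\<pi> (adj H K J \<circ> J \<circ> X) = Y"
  using asym_unique \<pi>_adj_J_J(1) assms by blast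

lemma S_commutantI:
  assumes Z: "Z \<in> bounded_ops H H"
    and eq: "\<And>i h. \<lbrakk>i \<in> {1..d}; h \<in> vecs H\<rbrakk> \<Longrightarrow> Z (S i h) = S i (Z h)"
  shows "Z \<in> S_commutant"
proof -
  have "Z \<circ> S i = S i \<circ> Z" if i: "i \<in> {1..d}" for i
    by (rule bounded_ops_ext[of _ H H])
      (use H.ops_comp Z S[OF i] eq[OF i] in auto)
  then show ?thesis using Z by (auto simp: commutant_def)
qed

lemma S_commutantD:
  assumes "X \<in> S_commutant"
  shows "X \<in> bounded_ops H H" "i \<in> {1..d} \<Longrightarrow> X (S i h) = S i (X h)"
  using assms unfolding commutant_def by (auto simp: o_def dest: fun_cong)

lemma S_commutant_add:
  assumes "X \<in> S_commutant" "Y \<in> S_commutant"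
  shows "X + Y \<in> S_commutant"
  using S_commutantD[OF assms(1)] S_commutantD[OF assms(2)]
    bounded_ops_vecs[OF S_commutantD(1)[OF assms(1)]] bounded_ops_vecs[OF S_commutantD(1)[OF assms(2)]]
  by (intro S_commutantI HH.bounded_ops_plus) (auto simp: bounded_ops_add[OF S])

lemma S_commutant_comp:
  assumes "X \<in> S_commutant" "Y \<in> S_commutant"
  shows "X \<circ> Y \<in> S_commutant"
  using S_commutantD[OF assms(1)] S_commutantD[OF assms(2)]
  by (intro S_commutantI H.ops_comp) auto

lemma S_commutant_opscale:
  assumes "X \<in> S_commutant"
  shows "opscale H c X \<in> S_commutant"
  using S_commutantD[OF assms] bounded_ops_vecs[OF S_commutantD(1)[OF assms]]
  by (intro S_commutantI HH.bounded_ops_opscale) (auto simp: opscale_def bounded_ops_smul[OF S])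

lemma S_commutant_idop: "idop H \<in> S_commutant"
  by (intro S_commutantI H.bounded_ops_idop) (auto simp: idop_def bounded_ops_vecs[OF S])

text \<open>Since \<open>pi (J* J X)\<close> is the partner of \<open>X\<close> itself, the matrix
  norm estimate for partners applies to \<open>X\<close> directly.\<close>

lemma \<Theta>_complete_contraction: "complete_contraction H K S_commutant (\<lambda>X. \<pi> (adj H K J \<circ> J \<circ> X))"
  unfolding complete_contraction_def linear_on_ops_def
proof (intro conjI ballI allI impI)
  show "(\<lambda>X. \<pi> (adj H K J \<circ> J \<circ> X)) ` S_commutant \<subseteq> bounded_ops K K"
    using asymD(2)[OF \<pi>_adj_J_J(1)] by blast
  show "\<pi> (adj H K J \<circ> J \<circ> (X + Y)) = \<pi> (adj H K J \<circ> J \<circ> X) + \<pi> (adj H K J \<circ> J \<circ> Y)"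
    if "X \<in> S_commutant" "Y \<in> S_commutant" for X Y
    by (intro \<pi>_adj_J_J_eq S_commutant_add asym_add \<pi>_adj_J_J(1) that)
  show "\<pi> (adj H K J \<circ> J \<circ> opscale H c X) = opscale K c (\<pi> (adj H K J \<circ> J \<circ> X))"
    if "X \<in> S_commutant" for c X
    by (intro \<pi>_adj_J_J_eq S_commutant_opscale asym_opscale \<pi>_adj_J_J(1) that)
  show "matrix_opnorm K n (\<lambda>i j. \<pi> (adj H K J \<circ> J \<circ> T i j)) \<le> matrix_opnorm H n T"
    if "\<forall>i<n. \<forall>j<n. T i j \<in> S_commutant" for n T
    using that by (intro matrix_opnorm_asym_le \<pi>_adj_J_J(1)) auto
qed

lemma \<Theta>_multiplicative: "multiplicative_on S_commutant (\<lambda>X. \<pi> (adj H K J \<circ> J \<circ> X))"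
  unfolding multiplicative_on_def
  by (intro ballI \<pi>_adj_J_J_eq S_commutant_comp asym_comp \<pi>_adj_J_J(1))

lemma \<Theta>_unital: "\<pi> (adj H K J \<circ> J \<circ> idop H) = idop K"
  using S_commutant_idop asym_idop by (rule \<pi>_adj_J_J_eq)

end

theorem theorem2:
  fixes d :: nat
    and H :: "'a::ab_group_add hspace"
    and S :: "nat \<Rightarrow> 'a \<Rightarrow> 'a"
    and Q :: "'a \<Rightarrow> 'a"
  assumes "d \<ge> 2"
    and "contractive_hilbert_module d H S"
    and "sot_limit H (adj_powers H (S d)) Q"
    and "Q \<noteq> 0"
  shows "\<exists>(K :: (nat \<Rightarrow> 'a) hspace) R J.
    unitary_module d K R \<and>
    canonical_module_map d H S K R J \<and>
    (let R' = commutant K (R ` {1..d});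
         S' = commutant H (S ` {1..d});
         \<T> = toeplitz_ops d H S;
         \<C> = cstar_generated H ({idop H} \<union> \<T>);
         \<rho> = (\<lambda>Y. adj H K J \<circ> Y \<circ> J)
     in complete_isometry K H R' \<rho> \<and> \<rho> ` R' = \<T> \<and>
        (\<exists>\<pi>. unital_star_representation H K \<C> \<pi> \<and> \<pi> ` \<C> = R' \<and>
             (\<forall>Y\<in>R'. \<pi> (\<rho> Y) = Y) \<and>
             (\<exists>\<Theta>. (\<forall>X\<in>S'. adj H K J \<circ> J \<circ> X \<in> \<C> \<and> \<Theta> X = \<pi> (adj H K J \<circ> J \<circ> X)) \<and>
                  \<Theta> ` S' \<subseteq> R' \<and>
                  complete_contraction H K S' \<Theta> \<and>
                  \<Theta> (idop H) = idop K \<and>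
                  multiplicative_on S' \<Theta> \<and>
                  (\<forall>X\<in>S'. \<Theta> X \<circ> J = J \<circ> X))))"
proof -
  interpret gamma_module d H S Q
    using assms by unfold_locales auto
  have ex: "\<exists>\<pi>. unital_star_representation H K toeplitz_algebra \<pi> \<and> \<pi> ` toeplitz_algebra = R_commutant \<and>
      (\<forall>Y\<in>R_commutant. \<pi> (adj H K J \<circ> Y \<circ> J) = Y) \<and>
      (\<exists>\<Theta>. (\<forall>X\<in>S_commutant. adj H K J \<circ> J \<circ> X \<in> toeplitz_algebra \<and> \<Theta> X = \<pi> (adj H K J \<circ> J \<circ> X)) \<and>
        \<Theta> ` S_commutant \<subseteq> R_commutant \<and> complete_contraction H K S_commutant \<Theta> \<and>
        \<Theta> (idop H) = idop K \<and> multiplicative_on S_commutant \<Theta> \<and> (\<forall>X\<in>S_commutant. \<Theta> X \<circ> J = J \<circ> X))"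
  proof (rule exI[of _ \<pi>], intro conjI)
    show "\<exists>\<Theta>. (\<forall>X\<in>S_commutant. adj H K J \<circ> J \<circ> X \<in> toeplitz_algebra \<and> \<Theta> X = \<pi> (adj H K J \<circ> J \<circ> X)) \<and>
        \<Theta> ` S_commutant \<subseteq> R_commutant \<and> complete_contraction H K S_commutant \<Theta> \<and>
        \<Theta> (idop H) = idop K \<and> multiplicative_on S_commutant \<Theta> \<and> (\<forall>X\<in>S_commutant. \<Theta> X \<circ> J = J \<circ> X)"
      by (rule exI[of _ "\<lambda>X. \<pi> (adj H K J \<circ> J \<circ> X)"],
          intro conjI ballI \<Theta>_complete_contraction \<Theta>_unital \<Theta>_multiplicative \<pi>_adj_J_J(2,3,4) image_subsetI refl)
  qed (use \<pi>_representation \<pi>_image \<pi>_rho in blast)+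
  show ?thesis
    unfolding Let_def
    by (intro exI[of _ K] exI[of _ R] exI[of _ J] conjI unitary_module_K canonical_J
        rho_complete_isometry rho_image ex)
qed

end
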